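(* Let $p\in(1/2,1]$, $\bar p=1-p$ and $\rho=2p-1$. Assume that in the ASEP with parameter $p$ started from $Y_n(0)=n$, the limit $\lim_{t\to\infty}X_0(t)/t$ exists almost surely (and is uniform on $[-\rho,\rho]$), so that the ASEP speed process $\{U_n\}_{n\in\mathbb{Z}}$ is defined. Let $\mu^{(2)}$ be the joint law of $(U_0,U_1)$, a measure on $[-\rho,\rho]^2$, and let $\tilde\mu^{(2)}$ be the reflection of $\mu^{(2)}$ about the line $x=y$. Then on $\{(x,y): -\rho\le x<y\le\rho\}$ we have $$p\cdot\mu^{(2)}-\bar p\cdot\tilde\mu^{(2)}=\frac{y-x}{4\rho^2}\,dx\,dy .$$
   Context: Multi-type ASEP with parameter $p\in(1/2,1]$: a continuous-time Markov process $Y(t)=\{Y_n(t)\}_{n\in\mathbb{Z}}$ on $\mathbb{R}^{\mathbb{Z}}$, where $Y_n(t)$ is the class of the particle at site $n$. To each $n\in\mathbb{Z}$ attach an independent rate $1$ Poisson process; at each of its points, independently of everything else, with probability $p$ the values at sites $n,n+1$ are sorted into decreasing order (larger value at $n$, smaller at $n+1$), and with probability $1-p$ they are sorted into increasing order; all other values are unchanged. When $Y_n(0)=n$ for all $n$, $X_n(t)$ denotes the position of particle $n$ at time $t$: $Y_{X_n(t)}(t)=n$. Under the assumption in the claim, translation invariance gives that almost surely for every $n$ the limit $U_n=\lim_{t\to\infty}(X_n(t)-n)/t$ exists, uniform on $[-\rho,\rho]$; $\{U_n\}_{n\in\mathbb{Z}}$ is the ASEP speed process. The reflection $\tilde\mu^{(2)}$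 is the image of $\mu^{(2)}$ under $(x,y)\mapsto(y,x)$. *)

theory Defs
  imports "HOL-Probability.Probability"
begin

text \<open>
  The Poisson process of the edge \<open>{n, n+1}\<close> is given by its i.i.d. exponential
  waiting times \<open>gap n 0, gap n 1, \<dots>\<close>; its points are the partial sums.  The coin
  \<open>coin n k\<close> belongs to the \<open>k\<close>-th point: \<open>True\<close> (probability \<open>p\<close>) means
  sorting into decreasing order.
\<close>

definition ring_time :: "(int \<Rightarrow> nat \<Rightarrow> 'w \<Rightarrow> real) \<Rightarrow> 'w \<Rightarrow> int \<Rightarrow> nat \<Rightarrow> real" where
  "ring_time gap \<omega> n k = (\<Sum>j\<le>k. gap n j \<omega>)"

text \<open>
  \<open>clock_law\<close> and \<open>clock_indep\<close> together say that all waiting times are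
  exponential with rate 1, all coins are Bernoulli, and all of these, over all edges, are
  jointly independent.
\<close>

locale asep_clocks = prob_space M for M :: "'w measure" +
  fixes p :: real
    and gap :: "int \<Rightarrow> nat \<Rightarrow> 'w \<Rightarrow> real"
    and coin :: "int \<Rightarrow> nat \<Rightarrow> 'w \<Rightarrow> bool"
  assumes clock_indep:
      "indep_vars (\<lambda>_. borel \<Otimes>\<^sub>M count_space UNIV)
         (\<lambda>(n, k) \<omega>. (gap n k \<omega>, coin n k \<omega>)) (UNIV :: (int \<times> nat) set)"
    and clock_law: "\<And>n k.
      distr M (borel \<Otimes>\<^sub>M count_space UNIV) (\<lambda>\<omega>. (gap n k \<omega>, coin n k \<omega>))
        = density lborel (exponential_density 1) \<Otimes>\<^sub>M measure_pmf (bernoulli_pmf p)"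

text \<open>
  Pathwise evolution \<open>y\<close> (time, then site) from the configuration \<open>\<eta>\<close>, driven by ring
  times \<open>T\<close> and coins \<open>c\<close>.  The value at site \<open>n\<close> can change only when the edge
  \<open>{n-1, n}\<close> or \<open>{n, n+1}\<close> rings; at a ring, the values just before it are sorted.
  For almost every realisation of the clocks this determines \<open>y\<close> on nonnegative times:
  up to any given time, edges that have not rung split the line into finite blocks
  (Harris' graphical construction).
\<close>

definition asep_path ::
  "(int \<Rightarrow> nat \<Rightarrow> real) \<Rightarrow> (int \<Rightarrow> nat \<Rightarrow> bool) \<Rightarrow> (int \<Rightarrow> real) \<Rightarrow> (real \<Rightarrow> int \<Rightarrow> real) \<Rightarrow> bool"
where
  "asep_path T c \<eta> y \<longleftrightarrow>
     y 0 = \<eta> \<and>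
     (\<forall>n s t. 0 \<le> s \<and> s \<le> t \<and> (\<forall>k. T (n - 1) k \<notin> {s<..t} \<and> T n k \<notin> {s<..t})
        \<longrightarrow> y t n = y s n) \<and>
     (\<forall>n k. \<forall>\<^sub>F s in at_left (T n k).
        if c n k
        then y (T n k) n = max (y s n) (y s (n + 1)) \<and> y (T n k) (n + 1) = min (y s n) (y s (n + 1))
        else y (T n k) n = min (y s n) (y s (n + 1)) \<and> y (T n k) (n + 1) = max (y s n) (y s (n + 1)))"

locale multi_type_asep = asep_clocks M p gap coin
  for M :: "'w measure" and p :: real
    and gap :: "int \<Rightarrow> nat \<Rightarrow> 'w \<Rightarrow> real" and coin :: "int \<Rightarrow> nat \<Rightarrow> 'w \<Rightarrow> bool" +
  fixes \<eta> :: "int \<Rightarrow> real"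
    and Y :: "real \<Rightarrow> 'w \<Rightarrow> int \<Rightarrow> real"
  assumes Y_measurable: "\<And>t n. 0 \<le> t \<Longrightarrow> random_variable borel (\<lambda>\<omega>. Y t \<omega> n)"
    and Y_path: "AE \<omega> in M. asep_path (ring_time gap \<omega>) (\<lambda>n k. coin n k \<omega>) \<eta> (\<lambda>t. Y t \<omega>)"

definition asep_position :: "(real \<Rightarrow> 'w \<Rightarrow> int \<Rightarrow> real) \<Rightarrow> int \<Rightarrow> real \<Rightarrow> 'w \<Rightarrow> int" where
  "asep_position Y n t \<omega> = (THE m. Y t \<omega> m = real_of_int n)"

definition asep_speed :: "(real \<Rightarrow> 'w \<Rightarrow> int \<Rightarrow> real) \<Rightarrow> int \<Rightarrow> 'w \<Rightarrow> real" where
  "asep_speed Y n \<omega> =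
     Lim at_top (\<lambda>t. (real_of_int (asep_position Y n t \<omega>) - real_of_int n) / t)"

text \<open>
  The speeds are limits only almost surely and are arbitrary on the exceptional null set,
  so they are random variables with respect to the completion of \<open>M\<close>; their laws are
  therefore taken there.
\<close>

definition speed_law :: "'w measure \<Rightarrow> (real \<Rightarrow> 'w \<Rightarrow> int \<Rightarrow> real) \<Rightarrow> int \<Rightarrow> real measure" where
  "speed_law M Y n = distr (completion M) borel (asep_speed Y n)"

definition speed_law2 :: "'w measure \<Rightarrow> (real \<Rightarrow> 'w \<Rightarrow> int \<Rightarrow> real) \<Rightarrow> (real \<times> real) measure" where
  "speed_law2 M Y = distr (completion M) borel (\<lambda>\<omega>. (asep_speed Y 0 \<omega>, asep_speed Y 1 \<omega>))"

definition reflection :: "(real \<times> real) measure \<Rightarrow> (real \<times> real) measure" where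
  "reflection \<mu> = distr \<mu> borel (\<lambda>(x, y). (y, x))"

end

theory Submission
  imports Defs "HOL-Combinatorics.Transposition"
begin

text \<open>
  Let \<open>X t\<close> be the inverse of the configuration at time \<open>t\<close>, so that \<open>X t n\<close> is the position of
  particle \<open>n\<close>.  Sorting two neighbouring sites and sorting two neighbouring classes commute on
  average, and they agree at the identity; hence \<open>X\<close> satisfies the same evolution equation as the
  configuration, with the generator acting on labels instead of sites.  After division by \<open>t\<close> this
  makes the law of the speeds \<open>U\<close> stationary for the multi-type ASEP.

  With \<open>j x (u, v) = p [u \<le> x < v] - (1 - p) [v \<le> x < u]\<close>, stationarity applied to
  \<open>[U 0 \<le> x] [U k > y]\<close> for \<open>x \<le> y\<close> shows that
  \<open>E j x (U 0, U 1) [U (k + 1) > y] + E [U 0 \<le> x] j y (U k, U (k + 1))\<close> does not depend on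
  \<open>k \<ge> 1\<close> and equals \<open>p P (U 0 \<le> x, U 1 > y) - (1 - p) P (U 0 > y, U 1 \<le> x)\<close>.  The speeds are a
  shift-equivariant function of i.i.d. clocks, hence mixing, and \<open>k \<rightarrow> \<infinity>\<close> turns the sum into
  \<open>J x P (U 0 > y) + P (U 0 \<le> x) J y\<close> with \<open>J x = E j x (U 0, U 1)\<close>.  Finally
  \<open>J x = (\<rho>\<^sup>2 - x\<^sup>2) / (4 \<rho>)\<close>, because the time derivative of the mean of the positive part of
  \<open>z - X t 0\<close> is the mean of \<open>j z (X t 0, X t 1)\<close> and the law of \<open>U 0\<close> is uniform.
\<close>

subsection \<open>Sorting sites and sorting classes\<close>

text \<open>The evolution equation for \<open>X\<close> is proved on a finite edge set
  \<open>E\<close> first. There the number of rings up to \<open>t\<close> is Poisson, and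
  expectations are \<open>exp (- t * card E)\<close> times power series in \<open>t\<close> whose
  coefficients are powers of one averaging operator; the symmetry between configuration and inverse
  is an identity between these coefficients. Passing to the line costs the probability that no
  silent edges separate the observed labels from the boundary of the window. This error is uniform
  over bounded times, so the equation survives in mean-value form: an increment is its length times
  the mean of the generator at an unknown intermediate time, up to an arbitrarily small error. The
  unknown time is harmless, since after scaling only its ratio to the length scale matters. The
  density arises from the value (\<rho> + x) (\<rho> - y) (2 \<rho> + y - x) / (8 \<rho>^2) found
  for the quadrant u \<le> x, v > y: minus its mixed derivative in x and y is (y - x) / (4
  \<rho>^2).\<close>

definition act :: "int \<times> bool \<Rightarrow> (int \<Rightarrow> int) \<Rightarrow> int \<Rightarrow> int" where
  "act x \<pi> = (if (\<pi> (fst x) < \<pi> (fst x + 1)) = snd x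
     then \<pi> \<circ> Transposition.transpose (fst x) (fst x + 1) else \<pi>)"

lemma bij_act: "bij \<pi> \<Longrightarrow> bij (act x \<pi>)"
  by (auto simp: act_def intro: bij_comp)

lemma bij_fold_act: "bij \<pi> \<Longrightarrow> bij (fold act l \<pi>)"
  by (induction l arbitrary: \<pi>) (auto simp: bij_act)

lemma act_other: "n \<noteq> fst x \<Longrightarrow> n \<noteq> fst x + 1 \<Longrightarrow> act x \<pi> n = \<pi> n"
  by (auto simp: act_def Transposition.transpose_def)

text \<open>Sorting classes instead of sites: conjugation by inversion turns \<open>act\<close> into
  an exchange of the classes \<open>m\<close> and \<open>m + 1\<close>, decided by the order of the
  sites that carry them.\<close>

definition lact :: "int \<times> bool \<Rightarrow> (int \<Rightarrow> int) \<Rightarrow> int \<Rightarrow> int" where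
  "lact x \<pi> = inv (act x (inv \<pi>))"

lemma inv_comp_transpose: "bij \<pi> \<Longrightarrow> inv (\<pi> \<circ> Transposition.transpose a b) = Transposition.transpose a b \<circ> inv \<pi>"
  by (simp add: o_inv_distrib inv_unique_comp)

lemma lact_eq:
  assumes "bij \<pi>"
  shows "lact x \<pi> = (if (inv \<pi> (fst x) < inv \<pi> (fst x + 1)) = snd x
     then Transposition.transpose (fst x) (fst x + 1) \<circ> \<pi> else \<pi>)"
  using assms by (simp add: lact_def act_def inv_comp_transpose bij_imp_bij_inv inv_inv_eq)

lemma inv_lact: "bij \<pi> \<Longrightarrow> inv (lact x \<pi>) = act x (inv \<pi>)"
  by (simp add: lact_def bij_act bij_imp_bij_inv inv_inv_eq)

lemma lact_id: "lact x id = act x id"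
  by (auto simp: lact_eq act_def)

text \<open>An adjacent transposition reverses the order of no pair but the one it exchanges. This
  makes the comparison in one sorting insensitive to the other sorting.\<close>

lemma transpose_succ_less_iff:
  fixes u v m :: int
  assumes "u \<noteq> v" "{u, v} \<noteq> {m, m + 1}"
  shows "Transposition.transpose m (m + 1) u < Transposition.transpose m (m + 1) v \<longleftrightarrow> u < v"
  using assms by (auto simp: Transposition.transpose_def doubleton_eq_iff)

text \<open>Exchanging sites multiplies \<pi> by a transposition on the right, exchanging classes on
  the left, so the exchanges themselves commute. Only the comparisons could interfere, and they do
  so only when the sites \<open>n\<close>, \<open>n + 1\<close> carry exactly the classes
  \<open>m\<close>, \<open>m + 1\<close>.\<close>

lemma act_lact_commute:
  assumes \<pi>: "bij \<pi>" and ne: "{\<pi> n, \<pi> (n + 1)} \<noteq> {m, m + 1}"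
  shows "act (n, b) (lact (m, b') \<pi>) = lact (m, b') (act (n, b) \<pi>)"
proof -
  have inj: "\<pi> n \<noteq> \<pi> (n + 1)"
    using \<pi> by (simp add: bij_is_inj inj_eq)
  have inj': "inv \<pi> m \<noteq> inv \<pi> (m + 1)"
    using bij_imp_bij_inv[OF \<pi>] by (simp add: bij_is_inj inj_eq)
  have "\<pi> (inv \<pi> k) = k" for k using \<pi> by (simp add: bij_is_surj surj_f_inv_f)
  then have ne': "{inv \<pi> m, inv \<pi> (m + 1)} \<noteq> {n, n + 1}"
    using ne unfolding doubleton_eq_iff by metis
  have bt: "bij (\<pi> \<circ> Transposition.transpose n (n + 1))" using \<pi> by (simp add: bij_comp)
  have 1: "lact (m, b') \<pi> = (if (inv \<pi> m < inv \<pi> (m + 1)) = b'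
      then Transposition.transpose m (m + 1) \<circ> \<pi> else \<pi>)"
    using lact_eq[OF \<pi>, of "(m, b')"] by simp
  have 2: "lact (m, b') (\<pi> \<circ> Transposition.transpose n (n + 1)) = (if (inv \<pi> m < inv \<pi> (m + 1)) = b'
      then Transposition.transpose m (m + 1) \<circ> (\<pi> \<circ> Transposition.transpose n (n + 1))
      else \<pi> \<circ> Transposition.transpose n (n + 1))"
    using lact_eq[OF bt, of "(m, b')"] transpose_succ_less_iff[OF inj' ne']
    by (simp only: inv_comp_transpose[OF \<pi>] comp_apply fst_conv snd_conv)
  have 3: "act (n, b) \<pi> = (if (\<pi> n < \<pi> (n + 1)) = b
      then \<pi> \<circ> Transposition.transpose n (n + 1) else \<pi>)"
    by (simp add: act_def)
  have 4: "act (n, b) (Transposition.transpose m (m + 1) \<circ> \<pi>) = (if (\<pi> n < \<pi> (n + 1)) = b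
      then Transposition.transpose m (m + 1) \<circ> \<pi> \<circ> Transposition.transpose n (n + 1)
      else Transposition.transpose m (m + 1) \<circ> \<pi>)"
    using transpose_succ_less_iff[OF inj ne] by (simp only: act_def comp_apply fst_conv snd_conv)
  show ?thesis
    by (cases "(inv \<pi> m < inv \<pi> (m + 1)) = b'"; cases "(\<pi> n < \<pi> (n + 1)) = b")
      (simp_all only: 1 2 3 4 if_True if_False comp_assoc refl simp_thms)
qed

text \<open>Both operations put the same two classes in order, and the last one decides.\<close>

lemma act_lact_same:
  assumes "bij \<pi>" and eq: "{\<pi> n, \<pi> (n + 1)} = {m, m + 1}"
  shows "act (n, b) (lact (m, b') \<pi>) = act (n, b) \<pi>"
    and "lact (m, b') (act (n, b) \<pi>) = lact (m, b') \<pi>"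
    and "act (n, b) \<pi> = lact (m, b) \<pi>"
proof -
  let ?t = "Transposition.transpose n (n + 1)"
  note [simp] = assms(1)
  have inv: "inv \<pi> (\<pi> k) = k" for k by (simp add: bij_is_inj inv_f_f)
  have inj: "\<pi> j = \<pi> k \<longleftrightarrow> j = k" for j k by (simp add: bij_is_inj inj_eq)
  \<comment> \<open>When the two sites carry the two classes, exchanging the classes and exchanging
    the sites are the same permutation.\<close>
  have T: "Transposition.transpose m (m + 1) \<circ> \<pi> = \<pi> \<circ> Transposition.transpose n (n + 1)"
  proof
    fix k
    show "(Transposition.transpose m (m + 1) \<circ> \<pi>) k = (\<pi> \<circ> Transposition.transpose n (n + 1)) k"
    proof -
      consider "k = n" | "k = n + 1" | "\<pi> k \<noteq> m" "\<pi> k \<noteq> m + 1" "k \<noteq> n" "k \<noteq> n + 1"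
        using eq inj[of k n] inj[of k "n + 1"] unfolding doubleton_eq_iff by metis
      then show ?thesis
        using eq unfolding doubleton_eq_iff by cases (elim disjE; clarsimp)+
    qed
  qed
  have TT: "Transposition.transpose m (m + 1) \<circ> (\<pi> \<circ> ?t) = \<pi>"
  proof
    fix k
    show "(Transposition.transpose m (m + 1) \<circ> (\<pi> \<circ> ?t)) k = \<pi> k"
      using fun_cong[OF T, of "?t k"] by simp
  qed
  have bt: "bij (\<pi> \<circ> Transposition.transpose n (n + 1))" by (simp add: bij_comp)
  consider "\<pi> n = m" "\<pi> (n + 1) = m + 1" "inv \<pi> m = n" "inv \<pi> (m + 1) = n + 1"
    | "\<pi> n = m + 1" "\<pi> (n + 1) = m" "inv \<pi> m = n + 1" "inv \<pi> (m + 1) = n"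
    using eq inv[of n] inv[of "n + 1"] unfolding doubleton_eq_iff by metis
  from this have *: "act (n, b) (lact (m, b') \<pi>) = act (n, b) \<pi>
     \<and> lact (m, b') (act (n, b) \<pi>) = lact (m, b') \<pi> \<and> act (n, b) \<pi> = lact (m, b) \<pi>"
  proof cases
    case 1
    have L: "lact (m, c) \<pi> = (if c then \<pi> \<circ> ?t else \<pi>)" for c
      using 1 lact_eq[OF assms(1), of "(m, c)"] by (simp add: T)
    have R: "act (n, c) \<pi> = (if c then \<pi> \<circ> ?t else \<pi>)" for c
      using 1 by (simp add: act_def)
    have R': "act (n, c) (\<pi> \<circ> ?t) = (if c then \<pi> \<circ> ?t else \<pi>)" for c
      using 1 by (simp add: act_def comp_assoc)
    have L': "lact (m, c) (\<pi> \<circ> ?t) = (if c then \<pi> \<circ> ?t else \<pi>)" for c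
      using 1 lact_eq[OF bt, of "(m, c)"]
      by (simp add: inv_comp_transpose TT)
    show ?thesis by (cases b; cases b'; simp add: L R L' R')
  next
    case 2
    have L: "lact (m, c) \<pi> = (if c then \<pi> else \<pi> \<circ> ?t)" for c
      using 2 lact_eq[OF assms(1), of "(m, c)"] by (simp add: T)
    have R: "act (n, c) \<pi> = (if c then \<pi> else \<pi> \<circ> ?t)" for c
      using 2 by (simp add: act_def)
    have R': "act (n, c) (\<pi> \<circ> ?t) = (if c then \<pi> else \<pi> \<circ> ?t)" for c
      using 2 by (simp add: act_def comp_assoc)
    have L': "lact (m, c) (\<pi> \<circ> ?t) = (if c then \<pi> else \<pi> \<circ> ?t)" for c
      using 2 lact_eq[OF bt, of "(m, c)"]
      by (simp add: inv_comp_transpose TT)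
    show ?thesis by (cases b; cases b'; simp add: L R L' R')
  qed
  then show "act (n, b) (lact (m, b') \<pi>) = act (n, b) \<pi>"
    and "lact (m, b') (act (n, b) \<pi>) = lact (m, b') \<pi>"
    and "act (n, b) \<pi> = lact (m, b) \<pi>" by blast+
qed

section \<open>Averaged sorting operators\<close>

definition wt :: "real \<Rightarrow> bool \<Rightarrow> real" where
  "wt p b = (if b then p else 1 - p)"

lemma sum_wt [simp]: "(\<Sum>b\<in>UNIV. wt p b) = 1"
  by (simp add: wt_def UNIV_bool)

lemma wt_nonneg: "0 \<le> p \<Longrightarrow> p \<le> 1 \<Longrightarrow> 0 \<le> wt p b"
  by (simp add: wt_def)

text \<open>Not normalised: a step has total weight \<open>card E\<close>, which is also the total
  ring rate. It is \<open>card E\<close> times the transition operator of the chain that sorts at a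
  uniformly chosen edge with an independent coin.\<close>

definition step_op :: "int set \<Rightarrow> real \<Rightarrow> ((int \<Rightarrow> int) \<Rightarrow> real) \<Rightarrow> (int \<Rightarrow> int) \<Rightarrow> real" where
  "step_op E p F \<pi> = (\<Sum>n\<in>E. \<Sum>b\<in>UNIV. wt p b * F (act (n, b) \<pi>))"

definition lstep_op :: "int set \<Rightarrow> real \<Rightarrow> ((int \<Rightarrow> int) \<Rightarrow> real) \<Rightarrow> (int \<Rightarrow> int) \<Rightarrow> real" where
  "lstep_op E p F \<pi> = (\<Sum>m\<in>E. \<Sum>b\<in>UNIV. wt p b * F (lact (m, b) \<pi>))"

lemma step_lstep_commute:
  assumes "bij \<pi>"
  shows "step_op E p (lstep_op E p F) \<pi> = lstep_op E p (step_op E p F) \<pi>"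
proof -
  let ?w = "wt p"
  have edge: "(\<Sum>b\<in>UNIV. \<Sum>b'\<in>UNIV. ?w b * ?w b' * F (lact (m, b') (act (n, b) \<pi>)))
      = (\<Sum>b\<in>UNIV. \<Sum>b'\<in>UNIV. ?w b * ?w b' * F (act (n, b) (lact (m, b') \<pi>)))" for m n
  proof (cases "{\<pi> n, \<pi> (n + 1)} = {m, m + 1}")
    \<comment> \<open>The later sorting overwrites the earlier one, so one of the two coins sums out
      to 1. The surviving coin has the same law in either order, which is why commutation holds for
      the sums although it can fail coin by coin.\<close>
    case True
    have "(\<Sum>b\<in>UNIV. \<Sum>b'\<in>UNIV. ?w b * ?w b' * F (lact (m, b') (act (n, b) \<pi>)))
        = (\<Sum>b\<in>UNIV. \<Sum>b'\<in>UNIV. ?w b * (?w b' * F (lact (m, b') \<pi>)))"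
      by (simp add: act_lact_same(2)[OF assms True] mult.assoc)
    also have "\<dots> = (\<Sum>b\<in>UNIV. ?w b * F (lact (m, b) \<pi>))"
      unfolding sum_distrib_left[symmetric] sum_distrib_right[symmetric] by simp
    also have "\<dots> = (\<Sum>b\<in>UNIV. (\<Sum>b'\<in>UNIV. ?w b') * (?w b * F (act (n, b) \<pi>)))"
      by (simp add: act_lact_same(3)[OF assms True])
    also have "\<dots> = (\<Sum>b\<in>UNIV. \<Sum>b'\<in>UNIV. ?w b * ?w b' * F (act (n, b) (lact (m, b') \<pi>)))"
      unfolding sum_distrib_right
      by (simp add: act_lact_same(1)[OF assms True] mult_ac)
    finally show ?thesis .
  next
    case False
    then show ?thesis by (simp add: act_lact_commute[OF assms])
  qed
  have "step_op E p (lstep_op E p F) \<pi>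
      = (\<Sum>n\<in>E. \<Sum>m\<in>E. \<Sum>b\<in>UNIV. \<Sum>b'\<in>UNIV. ?w b * ?w b' * F (lact (m, b') (act (n, b) \<pi>)))"
    unfolding step_op_def lstep_op_def sum_distrib_left
    by (intro sum.cong refl, subst sum.swap) (simp add: mult.assoc)
  also have "\<dots> = (\<Sum>n\<in>E. \<Sum>m\<in>E. \<Sum>b\<in>UNIV. \<Sum>b'\<in>UNIV. ?w b * ?w b' * F (act (n, b) (lact (m, b') \<pi>)))"
    by (simp add: edge)
  also have "\<dots> = (\<Sum>m\<in>E. \<Sum>n\<in>E. \<Sum>b\<in>UNIV. \<Sum>b'\<in>UNIV. ?w b * ?w b' * F (act (n, b) (lact (m, b') \<pi>)))"
    by (rule sum.swap)
  also have "\<dots> = (\<Sum>m\<in>E. \<Sum>n\<in>E. \<Sum>b'\<in>UNIV. \<Sum>b\<in>UNIV. ?w b' * (?w b * F (act (n, b) (lact (m, b') \<pi>))))"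
    by (rule sum.cong[OF refl], rule sum.cong[OF refl], subst sum.swap) (simp only: mult_ac)
  also have "\<dots> = (\<Sum>m\<in>E. \<Sum>b'\<in>UNIV. \<Sum>n\<in>E. \<Sum>b\<in>UNIV. ?w b' * (?w b * F (act (n, b) (lact (m, b') \<pi>))))"
    by (intro sum.cong refl, rule sum.swap)
  also have "\<dots> = lstep_op E p (step_op E p F) \<pi>"
    unfolding step_op_def lstep_op_def sum_distrib_left ..
  finally show ?thesis .
qed

lemma lstep_step_funpow:
  "bij \<pi> \<Longrightarrow> lstep_op E p ((step_op E p ^^ n) F) \<pi> = (step_op E p ^^ n) (lstep_op E p F) \<pi>"
proof (induction n arbitrary: \<pi>)
  case (Suc n)
  have "lstep_op E p ((step_op E p ^^ Suc n) F) \<pi> = step_op E p (lstep_op E p ((step_op E p ^^ n) F)) \<pi>"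
    by (simp add: step_lstep_commute Suc.prems)
  also have "\<dots> = (step_op E p ^^ Suc n) (lstep_op E p F) \<pi>"
    by (simp add: step_op_def[of E p "lstep_op _ _ _"] step_op_def[of E p "(step_op E p ^^ n) _"] Suc.IH Suc.prems bij_act)
  finally show ?case .
qed simp

lemma step_funpow_cong:
  assumes "bij \<pi>" "\<And>\<pi>. bij \<pi> \<Longrightarrow> F \<pi> = F' \<pi>"
  shows "(step_op E p ^^ n) F \<pi> = (step_op E p ^^ n) F' \<pi>"
  using assms by (induction n arbitrary: \<pi>) (auto simp: step_op_def bij_act)

text \<open>
  The first step taken at the end: at the identity, sorting sites and sorting classes agree, and the
  latter can be commuted past all other steps.  This is the symmetry between the configuration
  and its inverse.
\<close>

lemma step_funpow_Suc_inv:
  "(step_op E p ^^ Suc n) (\<lambda>\<pi>. F (inv \<pi>)) id = (step_op E p ^^ n) (\<lambda>\<pi>. step_op E p F (inv \<pi>)) id"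
proof -
  have "(step_op E p ^^ Suc n) (\<lambda>\<pi>. F (inv \<pi>)) id
      = lstep_op E p ((step_op E p ^^ n) (\<lambda>\<pi>. F (inv \<pi>))) id"
    by (simp add: step_op_def[of E p "(step_op E p ^^ n) _"] lstep_op_def lact_id)
  also have "\<dots> = (step_op E p ^^ n) (lstep_op E p (\<lambda>\<pi>. F (inv \<pi>))) id"
    by (rule lstep_step_funpow) simp
  also have "\<dots> = (step_op E p ^^ n) (\<lambda>\<pi>. step_op E p F (inv \<pi>)) id"
    by (rule step_funpow_cong) (simp_all add: lstep_op_def step_op_def inv_lact)
  finally show ?thesis .
qed

section \<open>Powers of the operator as sums over ring words\<close>

definition words :: "int set \<Rightarrow> nat \<Rightarrow> (int \<times> bool) list set" where
  "words E n = {l. set l \<subseteq> E \<times> UNIV \<and> length l = n}"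

definition word_wt :: "real \<Rightarrow> (int \<times> bool) list \<Rightarrow> real" where
  "word_wt p l = (\<Prod>x\<leftarrow>l. wt p (snd x))"

lemma word_wt_simps [simp]: "word_wt p [] = 1" "word_wt p (x # l) = wt p (snd x) * word_wt p l"
  by (simp_all add: word_wt_def)

lemma word_wt_nonneg: "0 \<le> p \<Longrightarrow> p \<le> 1 \<Longrightarrow> 0 \<le> word_wt p l"
  by (induction l) (auto simp: wt_nonneg)

lemma finite_words: "finite E \<Longrightarrow> finite (words E n)"
  unfolding words_def by (rule finite_lists_length_eq) simp

lemma words_Suc: "words E (Suc n) = (\<lambda>(x, l). x # l) ` ((E \<times> UNIV) \<times> words E n)"
  by (auto simp: words_def length_Suc_conv image_iff)

text \<open>Since \<open>fold\<close> performs the head of the list first, splitting off the head of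
  the word corresponds to the outermost \<open>step_op\<close> of the power.\<close>

lemma sum_words:
  assumes "finite E"
  shows "(\<Sum>l\<in>words E n. word_wt p l * F (fold act l \<pi>)) = (step_op E p ^^ n) F \<pi>"
proof (induction n arbitrary: \<pi>)
  case 0
  have "words E 0 = {[]}" by (auto simp: words_def)
  then show ?case by simp
next
  case (Suc n)
  have "(\<Sum>l\<in>words E (Suc n). word_wt p l * F (fold act l \<pi>))
      = (\<Sum>(x, l)\<in>(E \<times> UNIV) \<times> words E n. wt p (snd x) * (word_wt p l * F (fold act l (act x \<pi>))))"
    unfolding words_Suc by (subst sum.reindex) (auto simp: inj_on_def split_def mult.assoc)
  also have "\<dots> = (\<Sum>x\<in>E \<times> UNIV. wt p (snd x) * (step_op E p ^^ n) F (act x \<pi>))"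
    by (simp add: sum.cartesian_product[symmetric] sum_distrib_left[symmetric] Suc.IH)
  also have "\<dots> = (step_op E p ^^ Suc n) F \<pi>"
    by (simp add: step_op_def[of E p "(step_op E p ^^ n) F"] sum.cartesian_product split_def)
  finally show ?case .
qed

text \<open>The constant test function 1. This supplies the Poisson weights for the length of the
  word.\<close>

lemma sum_word_wt: "finite E \<Longrightarrow> (\<Sum>l\<in>words E n. word_wt p l) = real (card E) ^ n"
proof -
  assume "finite E"
  then have "(\<Sum>l\<in>words E n. word_wt p l) = (step_op E p ^^ n) (\<lambda>_. 1) id"
    using sum_words[where F = "\<lambda>_. 1"] by simp
  also have "(step_op E p ^^ n) (\<lambda>_. 1) = (\<lambda>_. real (card E) ^ n)"
    by (induction n) (auto simp: step_op_def fun_eq_iff sum_distrib_right[symmetric])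
  finally show ?thesis .
qed

subsection \<open>The law of the ring sequence\<close>

definition mark_law :: "real \<Rightarrow> (real \<times> bool) measure" where
  "mark_law p = density lborel (exponential_density 1) \<Otimes>\<^sub>M measure_pmf (bernoulli_pmf p)"

type_synonym clocks = "int \<times> nat \<Rightarrow> real \<times> bool"

abbreviation clock_space :: "clocks measure" where
  "clock_space \<equiv> \<Pi>\<^sub>M i\<in>UNIV. borel \<Otimes>\<^sub>M count_space UNIV"

definition clocks_law :: "real \<Rightarrow> clocks measure" where
  "clocks_law p = (\<Pi>\<^sub>M i\<in>UNIV. mark_law p)"

lemma sets_mark_law [measurable_cong]: "sets (mark_law p) = sets (borel \<Otimes>\<^sub>M count_space UNIV)"
  unfolding mark_law_def by (intro sets_pair_measure_cong) simp_all

lemma space_mark_law [simp]: "space (mark_law p) = UNIV"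
  by (simp add: mark_law_def space_pair_measure)

lemma sets_clocks_law [measurable_cong]: "sets (clocks_law p) = sets clock_space"
  unfolding clocks_law_def by (intro sets_PiM_cong) (simp_all add: sets_mark_law)

lemma space_clocks_law [simp]: "space (clocks_law p) = UNIV"
  by (simp add: clocks_law_def space_PiM)

lemma space_clock_space [simp]: "space clock_space = UNIV"
  by (simp add: space_PiM space_pair_measure)

lemma UNIV_in_sets_clock_space [simp]: "UNIV \<in> sets clock_space"
  using sets.top[of clock_space] by simp

lemma prob_space_mark_law: "prob_space (mark_law p)"
proof -
  interpret A: prob_space "density lborel (exponential_density 1)"
    by (rule prob_space_exponential_density) simp
  interpret B: prob_space "measure_pmf (bernoulli_pmf p)" by (rule prob_space_measure_pmf)
  interpret pair_prob_space "density lborel (exponential_density 1)" "measure_pmf (bernoulli_pmf p)" ..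
  show ?thesis unfolding mark_law_def by (rule prob_space_axioms)
qed

lemma prob_space_clocks_law: "prob_space (clocks_law p)"
  unfolding clocks_law_def by (rule prob_space_PiM) (rule prob_space_mark_law)

lemma emeasure_clocks_law_box:
  assumes "finite K" "\<And>i. i \<in> K \<Longrightarrow> A i \<in> sets (borel \<Otimes>\<^sub>M count_space UNIV)"
  shows "emeasure (clocks_law p) {\<omega>. \<forall>i\<in>K. \<omega> i \<in> A i} = (\<Prod>i\<in>K. emeasure (mark_law p) (A i))"
proof -
  have "{\<omega>. \<forall>i\<in>K. \<omega> i \<in> A i} = prod_emb UNIV (\<lambda>_. mark_law p) K (Pi\<^sub>E K A)"
    by (auto simp: prod_emb_def PiE_iff)
  then show ?thesis
    using assms unfolding clocks_law_def
    by (simp add: emeasure_PiM_emb prob_space_mark_law sets_mark_law)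
qed

lemma emeasure_mark_law:
  assumes [measurable]: "A \<in> sets (borel \<Otimes>\<^sub>M count_space UNIV)"
  shows "emeasure (mark_law p) A
    = (\<integral>\<^sup>+x. exponential_density 1 x * emeasure (measure_pmf (bernoulli_pmf p)) (Pair x -` A) \<partial>lborel)"
proof -
  have A': "A \<in> sets (borel \<Otimes>\<^sub>M measure_pmf (bernoulli_pmf p))"
    using assms by (simp cong: sets_pair_measure_cong)
  have "A \<in> sets (density lborel (exponential_density 1) \<Otimes>\<^sub>M measure_pmf (bernoulli_pmf p))"
    using sets_mark_law[of p] assms by (simp add: mark_law_def)
  then have "emeasure (mark_law p) A = (\<integral>\<^sup>+x. emeasure (measure_pmf (bernoulli_pmf p)) (Pair x -` A)
      \<partial>density lborel (exponential_density 1))"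
    unfolding mark_law_def by (rule measure_pmf.emeasure_pair_measure_alt)
  also have "\<dots> = (\<integral>\<^sup>+x. exponential_density 1 x * emeasure (measure_pmf (bernoulli_pmf p)) (Pair x -` A) \<partial>lborel)"
    using measure_pmf.measurable_emeasure_Pair[OF A'] by (subst nn_integral_density) simp_all
  finally show ?thesis .
qed

text \<open>Lack of memory of the exponential law, with the coin carried along: beyond
  \<open>s\<close> the density is \<open>exp (- s)\<close> times the shifted density.\<close>

lemma emeasure_mark_law_shift:
  assumes A: "A \<in> sets (borel \<Otimes>\<^sub>M count_space UNIV)" and "0 \<le> s"
  shows "emeasure (mark_law p) {z. s < fst z \<and> (fst z - s, snd z) \<in> A}
    = ennreal (exp (- s)) * emeasure (mark_law p) A"
proof -
  let ?B = "measure_pmf (bernoulli_pmf p)"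
  let ?S = "{z. s < fst z \<and> (fst z - s, snd z) \<in> A}"
  have "{z \<in> space (borel \<Otimes>\<^sub>M count_space UNIV). s < fst z \<and> (fst z - s, snd z) \<in> A}
      \<in> sets (borel \<Otimes>\<^sub>M count_space UNIV :: (real \<times> bool) measure)"
    using A by measurable
  then have S: "?S \<in> sets (borel \<Otimes>\<^sub>M count_space UNIV)" by (simp add: space_pair_measure)
  have S': "X \<in> sets (borel \<Otimes>\<^sub>M ?B)" if "X \<in> sets (borel \<Otimes>\<^sub>M count_space UNIV)" for X :: "(real \<times> bool) set"
    using that by (simp cong: sets_pair_measure_cong)
  note [measurable] = measure_pmf.measurable_emeasure_Pair[OF S'[OF S]] measure_pmf.measurable_emeasure_Pair[OF S'[OF A]]
  have "emeasure (mark_law p) ?S = (\<integral>\<^sup>+x. exponential_density 1 x * emeasure ?B (Pair x -` ?S) \<partial>lborel)"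
    by (rule emeasure_mark_law[OF S])
  also have "\<dots> = (\<integral>\<^sup>+x. exponential_density 1 (s + x) * emeasure ?B (Pair (s + x) -` ?S) \<partial>lborel)"
  proof -
    have "(\<lambda>x. exponential_density 1 x * emeasure ?B (Pair x -` ?S)) \<in> borel_measurable borel"
      by measurable
    then show ?thesis by (subst nn_integral_real_affine[where c = 1 and t = s]) simp_all
  qed
  also have "\<dots> = (\<integral>\<^sup>+x. ennreal (exp (- s)) * (exponential_density 1 x * emeasure ?B (Pair x -` A)) \<partial>lborel)"
  proof (rule nn_integral_cong_AE)
    show "AE x in lborel. exponential_density 1 (s + x) * emeasure ?B (Pair (s + x) -` ?S)
        = ennreal (exp (- s)) * (exponential_density 1 x * emeasure ?B (Pair x -` A))"
      \<comment> \<open>At \<open>x = 0\<close> the strict inequality on the left excludes the point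
        while the density on the right is 1, so this one point has to be removed.\<close>
      using AE_lborel_singleton[of 0]
    proof eventually_elim
      case (elim x)
      show ?case
      proof (cases "0 < x")
        case True
        then have "Pair (s + x) -` ?S = Pair x -` A" by auto
        moreover have "exponential_density 1 (s + x) = exp (- s) * exponential_density 1 x"
          using True assms(2) by (simp add: exponential_density_def exp_diff exp_minus field_simps exp_add)
        ultimately show ?thesis by (simp add: ennreal_mult' exponential_density_nonneg mult.assoc)
      next
        case False
        then have "Pair (s + x) -` ?S = {}" by auto
        moreover have "exponential_density 1 x = 0"
          using False elim by (simp add: exponential_density_def)
        ultimately show ?thesis by (simp only: emeasure_empty mult_zero_right mult_zero_left ennreal_0)
      qed
    qed
  qed
  also have "\<dots> = ennreal (exp (- s)) * (\<integral>\<^sup>+x. exponential_density 1 x * emeasure ?B (Pair x -` A) \<partial>lborel)"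
    by (rule nn_integral_cmult) measurable
  also have "\<dots> = ennreal (exp (- s)) * emeasure (mark_law p) A"
    by (simp add: emeasure_mark_law[OF A])
  finally show ?thesis .
qed

section \<open>Residual clocks and the first ring\<close>

definition delay :: "(int \<times> nat) set \<Rightarrow> real \<Rightarrow> clocks \<Rightarrow> clocks" where
  "delay J s \<omega> i = (if i \<in> J then (fst (\<omega> i) - s, snd (\<omega> i)) else \<omega> i)"

lemma measurable_delay [measurable]: "delay J s \<in> measurable clock_space clock_space"
  by (rule measurable_PiM_single') (auto simp: delay_def space_pair_measure)

text \<open>Both sides are finite measures in \<open>W\<close>, so boxes suffice, and there
  independence reduces the claim to lack of memory of the single gaps. Every gap in \<open>J\<close>
  contributes one factor \<open>exp (- s)\<close>.\<close>

lemma emeasure_delay: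
  assumes W: "W \<in> sets clock_space" and J: "finite J" and s: "0 \<le> s"
  shows "emeasure (clocks_law p) {\<omega>. (\<forall>j\<in>J. s < fst (\<omega> j)) \<and> delay J s \<omega> \<in> W}
    = ennreal (exp (- s * card J)) * emeasure (clocks_law p) W"
proof -
  interpret P: prob_space "clocks_law p" by (rule prob_space_clocks_law)
  let ?c = "ennreal (exp (- s * card J))"
  let ?N = "borel \<Otimes>\<^sub>M count_space UNIV :: (real \<times> bool) measure"
  let ?R = "{\<omega>. \<forall>j\<in>J. s < fst (\<omega> j)}"
  have "{\<omega> \<in> space clock_space. \<forall>j\<in>J. s < fst (\<omega> j)} \<in> sets clock_space"
    using J by measurable
  then have R [measurable]: "?R \<in> sets clock_space" by simp
  define Q where "Q = distr (density (clocks_law p) (indicator ?R)) clock_space (delay J s)"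
  have Q: "emeasure Q V = emeasure (clocks_law p) {\<omega>. (\<forall>j\<in>J. s < fst (\<omega> j)) \<and> delay J s \<omega> \<in> V}"
    if V: "V \<in> sets clock_space" for V
  proof -
    have "delay J s -` V \<inter> space clock_space \<in> sets clock_space"
      using V by measurable
    then have V': "delay J s -` V \<in> sets clock_space" by simp
    have "emeasure Q V = emeasure (density (clocks_law p) (indicator ?R)) (delay J s -` V)"
      unfolding Q_def using V by (subst emeasure_distr) simp_all
    also have "\<dots> = (\<integral>\<^sup>+\<omega>. indicator ?R \<omega> * indicator (delay J s -` V) \<omega> \<partial>clocks_law p)"
      using V' by (subst emeasure_density) (simp_all add: sets_clocks_law)
    also have "\<dots> = (\<integral>\<^sup>+\<omega>. indicator (?R \<inter> delay J s -` V) \<omega> \<partial>clocks_law p)"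
      by (simp add: indicator_inter_arith)
    also have "\<dots> = emeasure (clocks_law p) (?R \<inter> delay J s -` V)"
      using V' by (subst nn_integral_indicator) (simp_all add: sets_clocks_law)
    also have "?R \<inter> delay J s -` V = {\<omega>. (\<forall>j\<in>J. s < fst (\<omega> j)) \<and> delay J s \<omega> \<in> V}" by auto
    finally show ?thesis .
  qed
  have "density (clocks_law p) (\<lambda>_. ?c) = Q"
  proof (rule measure_eqI_PiM_infinite)
    show "sets (density (clocks_law p) (\<lambda>_. ?c)) = sets clock_space"
      by (simp add: sets_clocks_law)
    show "sets Q = sets clock_space" by (simp add: Q_def)
    show "finite_measure (density (clocks_law p) (\<lambda>_. ?c))"
      by (rule finite_measureI, subst emeasure_density_const)
        (use P.emeasure_space_1 in \<open>simp_all add: space_density ennreal_mult_eq_top_iff sets_clocks_law\<close>)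
    fix A :: "int \<times> nat \<Rightarrow> (real \<times> bool) set" and K :: "(int \<times> nat) set"
    assume K: "finite K" and A: "\<And>i. i \<in> K \<Longrightarrow> A i \<in> sets ?N"
    let ?box = "\<lambda>K A. prod_emb UNIV (\<lambda>_. ?N) K (Pi\<^sub>E K A)"
    have box: "?box K A = {\<omega>. \<forall>i\<in>K. \<omega> i \<in> A i}" for K and A :: "int \<times> nat \<Rightarrow> (real \<times> bool) set"
      by (auto simp: prod_emb_def PiE_iff space_pair_measure)
    \<comment> \<open>Coordinates in \<open>J\<close> but not in \<open>K\<close> are not restricted
      by the box and still have to exceed \<open>s\<close>. With \<open>UNIV\<close> there, both
      sides become products over \<open>K \<union> J\<close>.\<close>
    define A' where "A' i = (if i \<in> K then A i else UNIV)" for i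
    have A': "A' i \<in> sets ?N" for i using A sets.top[of ?N] by (simp add: A'_def space_pair_measure)
    define B where "B i = (if i \<in> J then {z. s < fst z \<and> (fst z - s, snd z) \<in> A' i} else A' i)" for i
    have B: "B i \<in> sets ?N" for i
    proof -
      note [measurable] = A'[of i]
      have "{z \<in> space ?N. s < fst z \<and> (fst z - s, snd z) \<in> A' i} \<in> sets ?N" by measurable
      then show ?thesis using A' by (simp add: B_def space_pair_measure)
    qed
    have boxK: "?box K A \<in> sets clock_space"
      by (rule sets_PiM_I) (use K A in auto)
    have eqA: "?box K A = {\<omega>. \<forall>i\<in>K \<union> J. \<omega> i \<in> A' i}" unfolding box by (auto simp: A'_def)
    have "emeasure Q (?box K A) = emeasure (clocks_law p) {\<omega>. \<forall>i\<in>K \<union> J. \<omega> i \<in> B i}"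
      unfolding Q[OF boxK] unfolding box
      by (rule arg_cong[where f = "emeasure _"]) (auto simp: B_def A'_def delay_def split: if_splits)
    also have "\<dots> = (\<Prod>i\<in>K \<union> J. emeasure (mark_law p) (B i))"
      by (rule emeasure_clocks_law_box) (use K J B in auto)
    also have "\<dots> = (\<Prod>i\<in>K \<union> J. (if i \<in> J then ennreal (exp (- s)) else 1) * emeasure (mark_law p) (A' i))"
      by (rule prod.cong) (auto simp: B_def emeasure_mark_law_shift[OF A' s])
    also have "\<dots> = (\<Prod>i\<in>K \<union> J. if i \<in> J then ennreal (exp (- s)) else 1) * (\<Prod>i\<in>K \<union> J. emeasure (mark_law p) (A' i))"
      by (rule prod.distrib)
    also have "(\<Prod>i\<in>K \<union> J. if i \<in> J then ennreal (exp (- s)) else 1) = ?c"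
    proof -
      have "(\<Prod>i\<in>K \<union> J. if i \<in> J then ennreal (exp (- s)) else 1) = (\<Prod>i\<in>J. ennreal (exp (- s)))"
        using K J by (intro prod.mono_neutral_cong_right) auto
      also have "\<dots> = ?c" by (simp add: ennreal_power exp_of_nat_mult[symmetric] mult.commute)
      finally show ?thesis .
    qed
    also have "(\<Prod>i\<in>K \<union> J. emeasure (mark_law p) (A' i)) = emeasure (clocks_law p) (?box K A)"
      unfolding eqA by (rule emeasure_clocks_law_box[symmetric]) (use K J A' in auto)
    finally show "emeasure (density (clocks_law p) (\<lambda>_. ?c)) (?box K A) = emeasure Q (?box K A)"
      using boxK by (simp add: emeasure_density_const sets_clocks_law)
  qed
  then have "emeasure Q W = ?c * emeasure (clocks_law p) W"
    using W by (metis emeasure_density_const sets_clocks_law)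
  then show ?thesis by (simp add: Q[OF W])
qed

text \<open>
  The clocks as seen from the first ring in \<open>E\<close>, when this occurs at the edge \<open>e\<close>.  Clocks outside
  \<open>E\<close> are not moved: they may have rung before, and their residual times would not be exponential.
\<close>

definition adv :: "int set \<Rightarrow> int \<Rightarrow> clocks \<Rightarrow> clocks" where
  "adv E e \<omega> i = (if fst i = e then \<omega> (e, Suc (snd i))
     else if fst i \<in> E \<and> snd i = 0 then (fst (\<omega> i) - fst (\<omega> (e, 0)), snd (\<omega> i)) else \<omega> i)"

text \<open>The list \<open>l\<close> consists of the edges of \<open>E\<close> that ring up to time \<open>t\<close>, in order, with their coins.\<close>

primrec ring_word :: "int set \<Rightarrow> clocks \<Rightarrow> real \<Rightarrow> (int \<times> bool) list \<Rightarrow> bool" where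
  "ring_word E \<omega> t [] \<longleftrightarrow> (\<forall>f\<in>E. t < fst (\<omega> (f, 0)))"
| "ring_word E \<omega> t (x # l) \<longleftrightarrow> fst x \<in> E \<and> fst (\<omega> (fst x, 0)) \<le> t \<and> snd (\<omega> (fst x, 0)) = snd x
     \<and> (\<forall>f\<in>E - {fst x}. fst (\<omega> (fst x, 0)) < fst (\<omega> (f, 0)))
     \<and> ring_word E (adv E (fst x) \<omega>) (t - fst (\<omega> (fst x, 0))) l"

lemma ring_word_Nil_Cons: "ring_word E \<omega> t [] \<Longrightarrow> \<not> ring_word E \<omega> t (x # l)"
  by (force simp: not_le)

text \<open>The first ring is the strict minimum of the first gaps in \<open>E\<close>, which fixes
  the head, and the advanced clocks fix the tail. If two edges tie for the minimum within the
  horizon, no word exists at all.\<close>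

lemma ring_word_unique: "ring_word E \<omega> t l \<Longrightarrow> ring_word E \<omega> t l' \<Longrightarrow> l = l'"
proof (induction l arbitrary: l' \<omega> t)
  case Nil
  then show ?case using ring_word_Nil_Cons by (cases l') blast+
next
  case (Cons x l)
  obtain y k where l': "l' = y # k"
    using Cons.prems ring_word_Nil_Cons by (cases l') blast+
  note x = Cons.prems(1)[unfolded ring_word.simps] and y = Cons.prems(2)[unfolded l' ring_word.simps]
  have "fst y = fst x"
  proof (rule ccontr)
    assume "fst y \<noteq> fst x"
    then have "fst (\<omega> (fst x, 0)) < fst (\<omega> (fst y, 0))" "fst (\<omega> (fst y, 0)) < fst (\<omega> (fst x, 0))"
      using x y by simp_all
    then show False by simp
  qed
  with x y have "y = x" by (intro prod_eqI) simp_all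
  moreover have "l = k"
    by (rule Cons.IH[OF conjunct2[OF conjunct2[OF conjunct2[OF conjunct2[OF x]]]]])
      (use y \<open>y = x\<close> in simp)
  ultimately show ?case by (simp add: l')
qed

lemma ring_word_set: "ring_word E \<omega> t l \<Longrightarrow> set l \<subseteq> E \<times> UNIV"
  by (induction l arbitrary: \<omega> t) (auto simp: subset_iff mem_Times_iff)

lemma ring_word_prefix: "ring_word E \<omega> t l \<Longrightarrow> s \<le> t \<Longrightarrow> \<exists>l'. ring_word E \<omega> s l'"
proof (induction l arbitrary: \<omega> t s)
  case Nil
  then have "ring_word E \<omega> s []" by auto
  then show ?case by blast
next
  case (Cons x l)
  show ?case
  proof (cases "fst (\<omega> (fst x, 0)) \<le> s")
    case True
    obtain l' where "ring_word E (adv E (fst x) \<omega>) (s - fst (\<omega> (fst x, 0))) l'"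
      using Cons.IH[of "adv E (fst x) \<omega>" "t - fst (\<omega> (fst x, 0))" "s - fst (\<omega> (fst x, 0))"] Cons.prems by auto
    then have "ring_word E \<omega> s (x # l')" using Cons.prems True by simp
    then show ?thesis by blast
  next
    case False
    have "s < fst (\<omega> (f, 0))" if "f \<in> E" for f
    proof (cases "f = fst x")
      case f: False
      then have "fst (\<omega> (fst x, 0)) < fst (\<omega> (f, 0))" using Cons.prems(1) that by simp
      then show ?thesis using False by linarith
    qed (use False in simp)
    then have "ring_word E \<omega> s []" by simp
    then show ?thesis by blast
  qed
qed

text \<open>Rings at time \<open>t\<close> itself are counted, and pending ones lie strictly beyond
  \<open>t\<close>; as there are finitely many edges, the word persists a little to the right of
  \<open>t\<close>.\<close>

lemma ring_word_right_cont:
  assumes "finite E"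
  shows "ring_word E \<omega> t l \<Longrightarrow> \<exists>\<epsilon>>0. \<forall>t'\<in>{t..<t + \<epsilon>}. ring_word E \<omega> t' l"
proof (induction l arbitrary: \<omega> t)
  case Nil
  have "\<forall>\<^sub>F t' in nhds t. \<forall>f\<in>E. t' < fst (\<omega> (f, 0))"
    using assms Nil by (intro eventually_ball_finite) (auto intro: order_tendstoD filterlim_ident)
  then obtain \<epsilon> where "\<epsilon> > 0" "\<And>t'. dist t' t < \<epsilon> \<Longrightarrow> \<forall>f\<in>E. t' < fst (\<omega> (f, 0))"
    unfolding eventually_nhds_metric by blast
  then show ?case by (intro exI[of _ \<epsilon>]) (auto simp: dist_real_def)
next
  case (Cons x l)
  let ?s = "fst (\<omega> (fst x, 0))"
  obtain \<epsilon> where "\<epsilon> > 0" "\<forall>t'\<in>{t - ?s..<t - ?s + \<epsilon>}. ring_word E (adv E (fst x) \<omega>) t' l"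
    using Cons.IH[of "adv E (fst x) \<omega>" "t - ?s"] Cons.prems by auto
  then show ?case using Cons.prems by (intro exI[of _ \<epsilon>]) auto
qed

lemma measurable_clock [measurable]:
  "(\<lambda>\<omega>. \<omega> i) \<in> measurable clock_space (borel \<Otimes>\<^sub>M count_space UNIV)"
  by (rule measurable_component_singleton) simp

lemma measurable_adv [measurable]: "adv E e \<in> measurable clock_space clock_space"
  by (rule measurable_PiM_single') (auto simp: adv_def space_pair_measure)

lemma measurable_ring_word:
  assumes "finite E"
  shows "\<omega> \<in> measurable N clock_space \<Longrightarrow> t \<in> borel_measurable N \<Longrightarrow> Measurable.pred N (\<lambda>x. ring_word E (\<omega> x) (t x) l)"
proof (induction l arbitrary: \<omega> t)
  case Nil
  note [measurable] = Nil
  show ?case using assms by simp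
next
  case (Cons a l)
  note [measurable] = Cons.prems
  have [measurable]: "Measurable.pred N
      (\<lambda>x. ring_word E (adv E (fst a) (\<omega> x)) (t x - fst (\<omega> x (fst a, 0))) l)"
    by (rule Cons.IH) measurable
  show ?case using assms by simp
qed

lemma sets_ring_word: "finite E \<Longrightarrow> {\<omega>. ring_word E \<omega> t l} \<in> sets clock_space"
  using measurable_ring_word[of E "\<lambda>\<omega>. \<omega>" clock_space "\<lambda>_. t" l] by (simp add: pred_def)

text \<open>The clocks after the first ring are obtained by dropping the used gap of
  \<open>e\<close> through re-indexing and reducing the first gaps of the other edges. The first
  operation preserves the product law, the second one does so on the event that those gaps exceed
  \<open>s\<close>.\<close>

lemma adv_upd:
  "adv E e (Z((e, 0) := (s, b)))
    = delay ((E - {e}) \<times> {0}) s (\<lambda>i. Z (if fst i = e then (e, Suc (snd i)) else i))"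
  by (auto simp: fun_eq_iff adv_def delay_def)

text \<open>Conditioning on time \<open>s\<close> and coin of the first ring: the density of
  \<open>s\<close> gives \<open>exp (- s)\<close>, the other \<open>card E - 1\<close> edges must
  stay silent up to \<open>s\<close>, and together this is the rate \<open>card E\<close>. By lack
  of memory the rest of the word is that of fresh clocks with horizon \<open>t - s\<close>.\<close>

lemma emeasure_first_ring:
  assumes p: "0 \<le> p" "p \<le> 1" and E: "finite E" "e \<in> E"
  shows "emeasure (clocks_law p) {\<omega>. ring_word E \<omega> t ((e, b) # l)}
    = (\<integral>\<^sup>+s. ennreal (wt p b * exp (- s * card E)) * emeasure (clocks_law p) {\<omega>. ring_word E \<omega> (t - s) l}
        * indicator {0..t} s \<partial>lborel)"
proof -
  let ?P = "clocks_law p" and ?i0 = "(e, 0) :: int \<times> nat"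
  let ?B = "measure_pmf (bernoulli_pmf p)"
  let ?I = "UNIV - {?i0}"
  let ?Pr = "\<Pi>\<^sub>M i\<in>?I. mark_law p"
  let ?J = "(E - {e}) \<times> {0 :: nat}"
  interpret P: prob_space ?P by (rule prob_space_clocks_law)
  interpret Pr: prob_space ?Pr by (rule prob_space_PiM) (rule prob_space_mark_law)
  interpret m: prob_space "mark_law p" by (rule prob_space_mark_law)
  define D where "D = {\<omega>. ring_word E \<omega> t ((e, b) # l)}"
  have D: "D \<in> sets ?P" unfolding D_def sets_clocks_law by (rule sets_ring_word) fact
  \<comment> \<open>An injection of all indices into those different from \<open>(e, 0)\<close>;
    re-indexing along it turns the product law with this coordinate removed into the full product
    law.\<close>
  define \<iota> where "\<iota> i = (if fst i = e then (e, Suc (snd i)) else i)" for i :: "int \<times> nat"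
  have \<iota>: "inj_on \<iota> UNIV" "\<iota> \<in> UNIV \<rightarrow> ?I"
    by (auto simp: \<iota>_def inj_on_def split: if_splits)
  have ins: "insert ?i0 ?I = UNIV" by auto
  have upd: "distr (mark_law p \<Otimes>\<^sub>M ?Pr) ?P (\<lambda>(x, Z). Z(?i0 := x)) = ?P"
    using distr_pair_PiM_eq_PiM[of ?I "\<lambda>_. mark_law p" ?i0] prob_space_mark_law
    unfolding ins by (simp add: clocks_law_def)
  have upd_meas [measurable]: "(\<lambda>(x, Z). Z(?i0 := x)) \<in> measurable (mark_law p \<Otimes>\<^sub>M ?Pr) ?P"
    unfolding clocks_law_def
  proof (rule measurable_PiM_single')
    show "(\<lambda>z. (case z of (x, Z) \<Rightarrow> Z(?i0 := x)) i) \<in> measurable (mark_law p \<Otimes>\<^sub>M ?Pr) (mark_law p)" for i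
    proof (cases "i = ?i0")
      case False
      then have "(\<lambda>z. snd z i) \<in> measurable (mark_law p \<Otimes>\<^sub>M ?Pr) (mark_law p)"
        by (intro measurable_compose[OF measurable_snd measurable_component_singleton]) simp
      then show ?thesis using False by (simp add: split_def)
    qed (simp add: split_def)
  qed simp
  have reidx: "distr ?Pr ?P (\<lambda>Z i. Z (\<iota> i)) = ?P"
    using distr_PiM_reindex[of ?I "\<lambda>_. mark_law p" \<iota> UNIV] prob_space_mark_law \<iota>
    by (simp add: clocks_law_def restrict_def)
  have reidx_meas: "(\<lambda>Z i. Z (\<iota> i)) \<in> measurable ?Pr ?P"
    unfolding clocks_law_def using \<iota>(2)
    by (intro measurable_PiM_single') (auto simp: space_PiM intro!: measurable_component_singleton)
  have [measurable]: "Measurable.pred (borel \<Otimes>\<^sub>M ?P) (\<lambda>x. ring_word E (snd x) (t - fst x) l)"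
    by (rule measurable_ring_word[OF E(1)]) (simp_all add: measurable_cong_sets[OF refl sets_clocks_law[symmetric]])
  have "{x \<in> space (borel \<Otimes>\<^sub>M ?P). ring_word E (snd x) (t - fst x) l} \<in> sets (borel \<Otimes>\<^sub>M ?P)"
    by measurable
  from P.measurable_emeasure_Pair[OF this]
  have hm [measurable]: "(\<lambda>s. emeasure ?P {\<omega>. ring_word E \<omega> (t - s) l}) \<in> borel_measurable borel"
    by (simp add: space_pair_measure vimage_def)
  have slice: "emeasure ?Pr (Pair (s, c) -` ((\<lambda>(x, Z). Z(?i0 := x)) -` D \<inter> space (mark_law p \<Otimes>\<^sub>M ?Pr)))
      = (if s \<le> t \<and> c = b then ennreal (exp (- s * card ?J)) * emeasure ?P {\<omega>. ring_word E \<omega> (t - s) l} else 0)"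
    if s: "0 \<le> s" for s c
  proof (cases "s \<le> t \<and> c = b")
    case True
    define V where "V = {\<omega>. (\<forall>j\<in>?J. s < fst (\<omega> j)) \<and> delay ?J s \<omega> \<in> {\<omega>. ring_word E \<omega> (t - s) l}}"
    have W: "{\<omega>. ring_word E \<omega> (t - s) l} \<in> sets clock_space" by (rule sets_ring_word) fact
    have "{\<omega> \<in> space clock_space. (\<forall>j\<in>?J. s < fst (\<omega> j)) \<and> delay ?J s \<omega> \<in> {\<omega>. ring_word E \<omega> (t - s) l}}
      \<in> sets clock_space" using W E(1) by measurable
    then have V: "V \<in> sets ?P" by (simp add: V_def sets_clocks_law)
    have "Pair (s, c) -` ((\<lambda>(x, Z). Z(?i0 := x)) -` D \<inter> space (mark_law p \<Otimes>\<^sub>M ?Pr))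
        = (\<lambda>Z i. Z (\<iota> i)) -` V \<inter> space ?Pr"
      using True E(2) by (auto simp: V_def D_def adv_upd \<iota>_def space_pair_measure)
    then have "emeasure ?Pr (Pair (s, c) -` ((\<lambda>(x, Z). Z(?i0 := x)) -` D \<inter> space (mark_law p \<Otimes>\<^sub>M ?Pr)))
        = emeasure (distr ?Pr ?P (\<lambda>Z i. Z (\<iota> i))) V"
      using V by (simp add: emeasure_distr[OF reidx_meas])
    also have "\<dots> = emeasure ?P V" by (simp add: reidx)
    also have "\<dots> = ennreal (exp (- s * card ?J)) * emeasure ?P {\<omega>. ring_word E \<omega> (t - s) l}"
      unfolding V_def by (rule emeasure_delay[OF W _ s]) (use E in simp)
    finally show ?thesis using True by simp
  next
    case False
    then have "Pair (s, c) -` ((\<lambda>(x, Z). Z(?i0 := x)) -` D \<inter> space (mark_law p \<Otimes>\<^sub>M ?Pr)) = {}"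
      by (auto simp: D_def)
    then show ?thesis by (simp only: False if_False emeasure_empty)
  qed
  have card: "real (card E) = 1 + real (card ?J)"
    using E card_Suc_Diff1[of E e] by (simp add: card_cartesian_product)
  let ?S = "(\<lambda>(x, Z). Z(?i0 := x)) -` D \<inter> space (mark_law p \<Otimes>\<^sub>M ?Pr)"
  let ?h = "\<lambda>x. emeasure ?Pr (Pair x -` ?S)"
  have S: "?S \<in> sets (mark_law p \<Otimes>\<^sub>M ?Pr)" using upd_meas D by (rule measurable_sets)
  have hmeas: "?h \<in> borel_measurable (mark_law p)" by (rule Pr.measurable_emeasure_Pair[OF S])
  have "emeasure ?P D = emeasure (distr (mark_law p \<Otimes>\<^sub>M ?Pr) ?P (\<lambda>(x, Z). Z(?i0 := x))) D"
    by (simp add: upd)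
  also have "\<dots> = emeasure (mark_law p \<Otimes>\<^sub>M ?Pr) ?S"
    by (rule emeasure_distr[OF upd_meas D])
  also have "\<dots> = (\<integral>\<^sup>+x. ?h x \<partial>mark_law p)"
    by (rule Pr.emeasure_pair_measure_alt[OF S])
  also have "\<dots> = (\<integral>\<^sup>+s. \<integral>\<^sup>+c. ?h (s, c) \<partial>?B \<partial>density lborel (exponential_density 1))"
    using hmeas unfolding mark_law_def by (rule measure_pmf.nn_integral_fst[symmetric])
  also have "\<dots> = (\<integral>\<^sup>+s. exponential_density 1 s * (\<integral>\<^sup>+c. ?h (s, c) \<partial>?B) \<partial>lborel)"
    using hmeas unfolding mark_law_def
    by (intro nn_integral_density) (auto intro!: measure_pmf.borel_measurable_nn_integral_fst cong: measurable_cong_sets)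
  also have "\<dots> = (\<integral>\<^sup>+s. ennreal (wt p b * exp (- s * card E)) * emeasure ?P {\<omega>. ring_word E \<omega> (t - s) l}
        * indicator {0..t} s \<partial>lborel)"
  proof (rule nn_integral_cong)
    fix s :: real
    let ?H = "emeasure ?P {\<omega>. ring_word E \<omega> (t - s) l}"
    show "exponential_density 1 s * (\<integral>\<^sup>+c. ?h (s, c) \<partial>?B)
        = ennreal (wt p b * exp (- s * card E)) * ?H * indicator {0..t} s"
    proof (cases "0 \<le> s")
      case True
      have "(\<integral>\<^sup>+c. ?h (s, c) \<partial>?B)
          = (\<integral>\<^sup>+c. (ennreal (exp (- s * card ?J)) * ?H * indicator {..t} s) * indicator {b} c \<partial>?B)"
        by (rule nn_integral_cong) (simp only: slice[OF True], auto)
      also have "\<dots> = (ennreal (exp (- s * card ?J)) * ?H * indicator {..t} s) * ennreal (wt p b)"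
        using p by (subst nn_integral_cmult_indicator) (auto simp: emeasure_pmf_single wt_def)
      finally have 1: "(\<integral>\<^sup>+c. ?h (s, c) \<partial>?B)
          = ennreal (wt p b) * (ennreal (exp (- s * card ?J)) * (?H * indicator {0..t} s))"
        using True by (simp add: indicator_def mult_ac)
      have "exponential_density 1 s * (wt p b * exp (- s * card ?J)) = wt p b * exp (- s * card E)"
        using True unfolding card by (simp add: exponential_density_def algebra_simps exp_add exp_diff exp_minus divide_inverse)
      then have 2: "ennreal (wt p b * exp (- s * card E))
          = ennreal (exponential_density 1 s) * (ennreal (wt p b) * ennreal (exp (- s * card ?J)))"
        using p by (simp only: ennreal_mult'[symmetric] wt_nonneg exponential_density_nonneg zero_less_one)
      show ?thesis unfolding 1 2 by (simp only: mult_ac)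
    qed (simp add: exponential_density_def)
  qed
  finally show ?thesis unfolding D_def .
qed

text \<open>Integrating \<open>(t - s) ^ n / fact n\<close> over the time \<open>s\<close> of the
  first ring raises the degree by one, while the exponentials combine to one without
  \<open>s\<close>. Hence the number of rings is Poisson with mean \<open>t * card E\<close>, and
  given this number the words occur in proportion to their weights.\<close>

lemma emeasure_ring_word:
  assumes p: "0 \<le> p" "p \<le> 1" and E: "finite E"
  shows "set l \<subseteq> E \<times> UNIV \<Longrightarrow> 0 \<le> t \<Longrightarrow> emeasure (clocks_law p) {\<omega>. ring_word E \<omega> t l}
    = ennreal (word_wt p l * exp (- t * card E) * t ^ length l / fact (length l))"
proof (induction l arbitrary: t)
  case Nil
  have "{\<omega>. ring_word E \<omega> t []} = {\<omega>. (\<forall>j\<in>E \<times> {0}. t < fst (\<omega> j)) \<and> delay (E \<times> {0}) t \<omega> \<in> UNIV}"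
    by auto
  then show ?case
    using emeasure_delay[of UNIV "E \<times> {0}" t p] E Nil prob_space.emeasure_space_1[OF prob_space_clocks_law, of p]
    by (simp add: card_cartesian_product)
next
  case (Cons x l)
  obtain e b where x: "x = (e, b)" by (cases x)
  let ?n = "length l"
  let ?c = "wt p b * word_wt p l * exp (- t * card E)"
  have c: "0 \<le> ?c" using p by (simp add: wt_nonneg word_wt_nonneg)
  have "emeasure (clocks_law p) {\<omega>. ring_word E \<omega> t (x # l)}
      = (\<integral>\<^sup>+s. ennreal (wt p b * exp (- s * card E)) * emeasure (clocks_law p) {\<omega>. ring_word E \<omega> (t - s) l}
        * indicator {0..t} s \<partial>lborel)"
    unfolding x by (rule emeasure_first_ring[OF p E]) (use Cons.prems x in auto)
  also have "\<dots> = (\<integral>\<^sup>+s. ennreal (?c * (t - s) ^ ?n / fact ?n) * indicator {0..t} s \<partial>lborel)"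
  proof (rule nn_integral_cong)
    fix s :: real
    show "ennreal (wt p b * exp (- s * card E)) * emeasure (clocks_law p) {\<omega>. ring_word E \<omega> (t - s) l}
        * indicator {0..t} s = ennreal (?c * (t - s) ^ ?n / fact ?n) * indicator {0..t} s"
    proof (cases "s \<in> {0..t}")
      case True
      have "exp (- s * card E) * exp (- (t - s) * card E) = exp (- t * card E)"
        by (simp add: algebra_simps flip: exp_add)
      moreover have "wt p b * exp (- s * card E) * (word_wt p l * exp (- (t - s) * card E) * (t - s) ^ ?n / fact ?n)
          = wt p b * word_wt p l * (exp (- s * card E) * exp (- (t - s) * card E)) * (t - s) ^ ?n / fact ?n"
        by (simp only: times_divide_eq_right mult_ac)
      ultimately have *: "wt p b * exp (- s * card E) * (word_wt p l * exp (- (t - s) * card E) * (t - s) ^ ?n / fact ?n)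
          = ?c * (t - s) ^ ?n / fact ?n"
        by (simp only:)
      have "emeasure (clocks_law p) {\<omega>. ring_word E \<omega> (t - s) l}
          = ennreal (word_wt p l * exp (- (t - s) * card E) * (t - s) ^ ?n / fact ?n)"
        by (rule Cons.IH) (use True Cons.prems in auto)
      moreover have "0 \<le> wt p b * exp (- s * card E)" using p by (simp add: wt_nonneg)
      ultimately show ?thesis by (simp only: ennreal_mult'[symmetric] *)
    qed simp
  qed
  also have "\<dots> = ennreal (- (?c * (t - t) ^ Suc ?n / fact (Suc ?n)) - - (?c * (t - 0) ^ Suc ?n / fact (Suc ?n)))"
  proof (rule nn_integral_FTC_Icc[where F = "\<lambda>s. - (?c * (t - s) ^ Suc ?n / fact (Suc ?n))"])
    fix s :: real assume s: "s \<in> {0..t}"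
    have "((\<lambda>s. - (?c * (t - s) ^ Suc ?n / fact (Suc ?n))) has_real_derivative
      - (?c * (real (Suc ?n) * (t - s) ^ ?n * (- 1)) / fact (Suc ?n))) (at s)"
      by (auto intro!: derivative_eq_intros simp del: power_Suc fact_Suc)
    moreover have "- (?c * (real (Suc ?n) * (t - s) ^ ?n * (- 1)) / fact (Suc ?n)) = ?c * (t - s) ^ ?n / fact ?n"
      by (simp add: field_simps del: of_nat_Suc)
    ultimately show "((\<lambda>s. - (?c * (t - s) ^ Suc ?n / fact (Suc ?n))) has_real_derivative
      ?c * (t - s) ^ ?n / fact ?n) (at s)" by (simp only:)
    show "0 \<le> ?c * (t - s) ^ ?n / fact ?n" using c s by (intro divide_nonneg_nonneg mult_nonneg_nonneg[OF c]) auto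
  qed (use Cons.prems in auto)
  finally show ?case by (simp add: x mult_ac)
qed

subsection \<open>The generator in finite volume\<close>

text \<open>Clocks without a word, because of ties or of infinitely many rings, get an unspecified
  value; for finite \<open>E\<close> and nonnegative \<open>t\<close> they form a null set.\<close>

definition word :: "int set \<Rightarrow> real \<Rightarrow> clocks \<Rightarrow> (int \<times> bool) list" where
  "word E t \<omega> = (THE l. ring_word E \<omega> t l)"

definition positions :: "int set \<Rightarrow> real \<Rightarrow> clocks \<Rightarrow> int \<Rightarrow> int" where
  "positions E t \<omega> = inv (fold act (word E t \<omega>) id)"

lemma word_eq: "ring_word E \<omega> t l \<Longrightarrow> word E t \<omega> = l"
  unfolding word_def by (blast intro: the_equality ring_word_unique)

lemma measurable_word:
  assumes "finite E"
  shows "word E t \<in> measurable clock_space (count_space UNIV)"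
  unfolding word_def
  by (rule measurable_THE[where I = UNIV])
    (use assms measurable_ring_word[of E "\<lambda>\<omega>. \<omega>" clock_space "\<lambda>_. t"] in \<open>auto intro: ring_word_unique\<close>)

lemma measurable_positions:
  "finite E \<Longrightarrow> positions E t \<in> measurable clock_space (count_space UNIV)"
  unfolding positions_def
  by (rule measurable_compose[OF measurable_word]) simp_all

lemma abs_step_op_le:
  assumes "0 \<le> p" "p \<le> 1" "\<And>\<pi>. \<bar>F \<pi>\<bar> \<le> B"
  shows "\<bar>step_op E p F \<pi>\<bar> \<le> real (card E) * B"
proof -
  have "\<bar>step_op E p F \<pi>\<bar> \<le> (\<Sum>n\<in>E. \<Sum>b\<in>UNIV. \<bar>wt p b * F (act (n, b) \<pi>)\<bar>)"
    unfolding step_op_def by (intro order_trans[OF sum_abs] sum_mono sum_abs)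
  also have "\<dots> \<le> (\<Sum>n\<in>E. \<Sum>b\<in>UNIV. wt p b * B)"
    by (intro sum_mono) (simp add: abs_mult wt_nonneg assms mult_left_mono)
  also have "\<dots> = real (card E) * B" by (simp add: sum_distrib_right[symmetric])
  finally show ?thesis .
qed

lemma abs_step_funpow_le:
  assumes "0 \<le> p" "p \<le> 1" "\<And>\<pi>. \<bar>F \<pi>\<bar> \<le> B"
  shows "\<bar>(step_op E p ^^ n) F \<pi>\<bar> \<le> real (card E) ^ n * B"
proof (induction n arbitrary: \<pi>)
  case (Suc n)
  show ?case using abs_step_op_le[OF assms(1,2) Suc] by (simp add: mult.assoc)
qed (simp add: assms)

lemma summable_power_fact: "summable (\<lambda>n. B * x ^ n / fact n)" for x B :: real
  using summable_mult[OF summable_exp[of x], of B] by (simp add: field_simps)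

lemma norm_power_series_term_le:
  fixes a N B x :: real
  assumes "\<bar>a\<bar> \<le> N ^ n * B"
  shows "norm (a / fact n * x ^ n) \<le> B * (N * \<bar>x\<bar>) ^ n / fact n"
proof -
  have "\<bar>a\<bar> * \<bar>x\<bar> ^ n \<le> (N ^ n * B) * \<bar>x\<bar> ^ n"
    by (intro mult_right_mono assms) simp
  then have "\<bar>a\<bar> * \<bar>x\<bar> ^ n / fact n \<le> (N ^ n * B) * \<bar>x\<bar> ^ n / fact n"
    by (rule divide_right_mono) simp
  then show ?thesis by (simp add: abs_mult power_abs power_mult_distrib mult_ac)
qed

lemma summable_step_funpow:
  assumes "0 \<le> p" "p \<le> 1" "\<And>\<pi>. \<bar>F \<pi>\<bar> \<le> B"
  shows "summable (\<lambda>n. (step_op E p ^^ n) F \<pi> / fact n * x ^ n)"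
proof (rule summable_comparison_test'[OF summable_power_fact[of B "real (card E) * \<bar>x\<bar>"]])
  show "norm ((step_op E p ^^ n) F \<pi> / fact n * x ^ n) \<le> B * (real (card E) * \<bar>x\<bar>) ^ n / fact n" for n
    by (intro norm_power_series_term_le abs_step_funpow_le assms)
qed

lemma measure_ring_word:
  assumes "0 \<le> p" "p \<le> 1" "finite E" "l \<in> words E n" "0 \<le> t"
  shows "measure (clocks_law p) {\<omega>. ring_word E \<omega> t l} = word_wt p l * (exp (- t * real (card E)) * t ^ n / fact n)"
  using emeasure_ring_word[of p E l t] assms
  by (simp add: measure_def words_def word_wt_nonneg mult.assoc)

text \<open>The words of length \<open>n\<close> together have the Poisson weight of
  \<open>n\<close>, and these weights add up to 1. Ties and accumulating rings are thus excluded by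
  counting mass.\<close>

lemma AE_ring_word:
  assumes p: "0 \<le> p" "p \<le> 1" and E: "finite E" and t: "0 \<le> t"
  shows "AE \<omega> in clocks_law p. \<exists>l. ring_word E \<omega> t l"
proof -
  interpret P: prob_space "clocks_law p" by (rule prob_space_clocks_law)
  let ?N = "real (card E)"
  let ?A = "\<lambda>n. \<Union>l\<in>words E n. {\<omega>. ring_word E \<omega> t l}"
  have A: "?A n \<in> P.events" for n
    unfolding sets_clocks_law by (intro sets.finite_UN finite_words E sets_ring_word)
  have "P.prob (?A n) = exp (- t * ?N) * ((t * ?N) ^ n / fact n)" for n
  proof -
    have "P.prob (?A n) = (\<Sum>l\<in>words E n. P.prob {\<omega>. ring_word E \<omega> t l})"
    proof (rule P.finite_measure_finite_Union)
      show "disjoint_family_on (\<lambda>l. {\<omega>. ring_word E \<omega> t l}) (words E n)"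
        using ring_word_unique unfolding disjoint_family_on_def by blast
    qed (use sets_ring_word[OF E] in \<open>auto simp: finite_words E sets_clocks_law\<close>)
    also have "\<dots> = (\<Sum>l\<in>words E n. word_wt p l) * (exp (- t * ?N) * t ^ n / fact n)"
      unfolding sum_distrib_right by (intro sum.cong refl measure_ring_word p E t)
    finally show ?thesis by (simp add: sum_word_wt E power_mult_distrib mult_ac)
  qed
  moreover have "(\<lambda>n. P.prob (?A n)) sums P.prob (\<Union>n. ?A n)"
  proof (rule P.finite_measure_UNION)
    show "disjoint_family ?A"
      using ring_word_unique unfolding disjoint_family_on_def words_def by blast
  qed (use A in auto)
  ultimately have "(\<lambda>n. exp (- t * ?N) * ((t * ?N) ^ n / fact n)) sums P.prob (\<Union>n. ?A n)" by simp
  moreover have "(\<lambda>n. exp (- t * ?N) * ((t * ?N) ^ n / fact n)) sums (exp (- t * ?N) * exp (t * ?N))"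
    using exp_converges[of "t * ?N"] by (intro sums_mult) (simp add: field_simps)
  ultimately have "P.prob (\<Union>n. ?A n) = exp (- t * ?N) * exp (t * ?N)" by (rule sums_unique2)
  also have "\<dots> = 1" by (simp add: exp_minus)
  finally have "P.prob (\<Union>n. ?A n) = 1" .
  then have "AE \<omega> in clocks_law p. \<omega> \<in> (\<Union>n. ?A n)"
    using A by (intro P.AE_prob_1) auto
  then show ?thesis by eventually_elim blast
qed

text \<open>The expectation is split by the length of the word: where a word exists, at most one of
  the functions \<open>f n\<close> is nonzero, and multiples of the Poisson weights dominate their
  integrals.\<close>

lemma expectation_word:
  assumes p: "0 \<le> p" "p \<le> 1" and E: "finite E" and t: "0 \<le> t" and h: "\<And>l. \<bar>h l\<bar> \<le> B"
  shows "(\<lambda>n. (\<Sum>l\<in>words E n. word_wt p l * h l) * (exp (- t * real (card E)) * t ^ n / fact n))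
    sums (\<integral>\<omega>. h (word E t \<omega>) \<partial>clocks_law p)"
proof -
  interpret P: prob_space "clocks_law p" by (rule prob_space_clocks_law)
  let ?N = "real (card E)" and ?R = "\<lambda>l. {\<omega>. ring_word E \<omega> t l}"
  define f where "f n \<omega> = (\<Sum>l\<in>words E n. h l * indicator (?R l) \<omega>)" for n \<omega>
  have R: "?R l \<in> P.events" for l using sets_ring_word[OF E] by (simp add: sets_clocks_law)
  have I: "integrable (clocks_law p) (\<lambda>\<omega>. c * indicat_real (?R l) \<omega>)" for l c
    by (intro integrable_mult_right integrable_real_indicator R) (simp add: P.emeasure_eq_measure)
  have B: "0 \<le> B" using h[of "[]"] by linarith
  have f: "f n \<omega> = (if n = length l then h l else 0)" if "ring_word E \<omega> t l" for n l \<omega>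
  proof -
    have "f n \<omega> = (\<Sum>k\<in>words E n. if k = l then h l else 0)"
      unfolding f_def
    proof (intro sum.cong refl)
      have "ring_word E \<omega> t k \<longleftrightarrow> k = l" for k using that ring_word_unique by blast
      then show "h k * indicator (?R k) \<omega> = (if k = l then h l else 0)" for k
        by (simp add: indicator_def)
    qed
    also have "\<dots> = (if n = length l then h l else 0)"
      using finite_words[OF E] ring_word_set[OF that] by (auto simp: words_def)
    finally show ?thesis .
  qed
  have int: "integrable (clocks_law p) (f n)" for n
    unfolding f_def by (intro Bochner_Integration.integrable_sum I)
  have "(\<lambda>n. \<integral>\<omega>. f n \<omega> \<partial>clocks_law p) sums (\<integral>\<omega>. (\<Sum>n. f n \<omega>) \<partial>clocks_law p)"
  proof (rule sums_integral)
    show "integrable (clocks_law p) (f n)" for n by (rule int)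
    show "AE \<omega> in clocks_law p. summable (\<lambda>n. norm (f n \<omega>))"
      using AE_ring_word[OF p E t]
    proof eventually_elim
      case (elim \<omega>)
      then obtain l where "ring_word E \<omega> t l" by blast
      then show ?case by (intro summable_finite[of "{length l}"]) (auto simp: f)
    qed
    show "summable (\<lambda>n. \<integral>\<omega>. norm (f n \<omega>) \<partial>clocks_law p)"
    proof (rule summable_comparison_test')
      show "summable (\<lambda>n. (B * exp (- t * ?N)) * (t * ?N) ^ n / fact n)" by (rule summable_power_fact)
      fix n
      have "(\<integral>\<omega>. norm (f n \<omega>) \<partial>clocks_law p) \<le> (\<integral>\<omega>. (\<Sum>l\<in>words E n. B * indicator (?R l) \<omega>) \<partial>clocks_law p)"
      proof (rule integral_mono)
        show "integrable (clocks_law p) (\<lambda>\<omega>. \<Sum>l\<in>words E n. B * indicator (?R l) \<omega>)"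
          by (intro Bochner_Integration.integrable_sum I)
        show "norm (f n \<omega>) \<le> (\<Sum>l\<in>words E n. B * indicator (?R l) \<omega>)" for \<omega>
          unfolding f_def real_norm_def
          by (intro order_trans[OF sum_abs] sum_mono) (auto simp: abs_mult indicator_def h B)
      qed (simp add: int)
      also have "\<dots> = (\<Sum>l\<in>words E n. B * measure (clocks_law p) (?R l))"
        by (subst Bochner_Integration.integral_sum) (rule I, simp)
      also have "\<dots> = (\<Sum>l\<in>words E n. word_wt p l) * (B * (exp (- t * ?N) * t ^ n / fact n))"
        unfolding sum_distrib_right
        by (intro sum.cong refl) (simp add: measure_ring_word[OF p E _ t] mult_ac)
      also have "\<dots> = (B * exp (- t * ?N)) * (t * ?N) ^ n / fact n"
        by (simp add: sum_word_wt E power_mult_distrib mult_ac)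
      finally show "norm (\<integral>\<omega>. norm (f n \<omega>) \<partial>clocks_law p) \<le> (B * exp (- t * ?N)) * (t * ?N) ^ n / fact n"
        by simp
    qed
  qed
  moreover have "(\<integral>\<omega>. f n \<omega> \<partial>clocks_law p)
      = (\<Sum>l\<in>words E n. word_wt p l * h l) * (exp (- t * real (card E)) * t ^ n / fact n)" for n
  proof -
    have "(\<integral>\<omega>. f n \<omega> \<partial>clocks_law p) = (\<Sum>l\<in>words E n. h l * measure (clocks_law p) (?R l))"
      unfolding f_def
      by (subst Bochner_Integration.integral_sum) (rule I, simp)
    also have "\<dots> = (\<Sum>l\<in>words E n. word_wt p l * h l) * (exp (- t * real (card E)) * t ^ n / fact n)"
      unfolding sum_distrib_right
      by (intro sum.cong refl) (simp add: measure_ring_word[OF p E _ t] mult_ac)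
    finally show ?thesis .
  qed
  moreover have "(\<integral>\<omega>. (\<Sum>n. f n \<omega>) \<partial>clocks_law p) = (\<integral>\<omega>. h (word E t \<omega>) \<partial>clocks_law p)"
  proof (rule integral_cong_AE)
    show "(\<lambda>\<omega>. \<Sum>n. f n \<omega>) \<in> borel_measurable (clocks_law p)"
      using int by (intro borel_measurable_suminf) (auto dest: borel_measurable_integrable)
    have "word E t \<in> measurable (clocks_law p) (count_space UNIV)"
      using measurable_word[OF E] by (simp cong: measurable_cong_sets add: sets_clocks_law)
    then show "(\<lambda>\<omega>. h (word E t \<omega>)) \<in> borel_measurable (clocks_law p)"
      by (rule measurable_compose) simp
    show "AE \<omega> in clocks_law p. (\<Sum>n. f n \<omega>) = h (word E t \<omega>)"
      using AE_ring_word[OF p E t]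
    proof eventually_elim
      case (elim \<omega>)
      then obtain l where l: "ring_word E \<omega> t l" by blast
      have "(\<Sum>n. f n \<omega>) = (\<Sum>n\<in>{length l}. f n \<omega>)"
        by (rule suminf_finite) (auto simp: f[OF l])
      then show ?case by (simp add: f[OF l] word_eq[OF l])
    qed
  qed
  ultimately show ?thesis by simp
qed

text \<open>\<open>positions\<close> is the inverse of the configuration, so the test function
  enters the operator powers as \<pi> \<mapsto> \<open>F (inv \<pi>)\<close>, evaluated at the
  identity. This is the form to which \<open>step_funpow_Suc_inv\<close> applies.\<close>

lemma expectation_positions:
  assumes p: "0 \<le> p" "p \<le> 1" and E: "finite E" and t: "0 \<le> t" and F: "\<And>\<pi>. \<bar>F \<pi>\<bar> \<le> B"
  shows "(\<integral>\<omega>. F (positions E t \<omega>) \<partial>clocks_law p)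
    = exp (- t * real (card E)) * (\<Sum>n. (step_op E p ^^ n) (\<lambda>\<pi>. F (inv \<pi>)) id / fact n * t ^ n)"
proof -
  let ?a = "\<lambda>n. (step_op E p ^^ n) (\<lambda>\<pi>. F (inv \<pi>)) id"
  have "(\<lambda>n. (\<Sum>l\<in>words E n. word_wt p l * F (inv (fold act l id))) * (exp (- t * real (card E)) * t ^ n / fact n))
      sums (\<integral>\<omega>. F (positions E t \<omega>) \<partial>clocks_law p)"
    unfolding positions_def by (rule expectation_word[OF p E t]) (rule F)
  then have "(\<lambda>n. exp (- t * real (card E)) * (?a n / fact n * t ^ n)) sums (\<integral>\<omega>. F (positions E t \<omega>) \<partial>clocks_law p)"
    unfolding sum_words[OF E, where F = "\<lambda>\<pi>. F (inv \<pi>)"] by (simp add: mult_ac)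
  moreover have "summable (\<lambda>n. ?a n / fact n * t ^ n)"
    by (rule summable_step_funpow[OF p F])
  then have "(\<lambda>n. exp (- t * real (card E)) * (?a n / fact n * t ^ n)) sums
      (exp (- t * real (card E)) * (\<Sum>n. ?a n / fact n * t ^ n))"
    by (intro sums_mult summable_sums)
  ultimately show ?thesis by (rule sums_unique2)
qed

definition gen :: "int set \<Rightarrow> real \<Rightarrow> ((int \<Rightarrow> int) \<Rightarrow> real) \<Rightarrow> (int \<Rightarrow> int) \<Rightarrow> real" where
  "gen E p F \<pi> = (\<Sum>n\<in>E. \<Sum>b\<in>UNIV. wt p b * (F (act (n, b) \<pi>) - F \<pi>))"

lemma gen_step_op: "gen E p F \<pi> = step_op E p F \<pi> - real (card E) * F \<pi>"
  by (simp add: gen_def step_op_def right_diff_distrib sum_subtractf sum_distrib_right[symmetric])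

lemma integrable_positions:
  assumes "finite E" "\<And>\<pi>. \<bar>F \<pi>\<bar> \<le> (B :: real)"
  shows "integrable (clocks_law p) (\<lambda>\<omega>. F (positions E t \<omega>))"
proof -
  interpret P: prob_space "clocks_law p" by (rule prob_space_clocks_law)
  have "positions E t \<in> measurable (clocks_law p) (count_space UNIV)"
    using measurable_positions[OF assms(1)] by (simp cong: measurable_cong_sets add: sets_clocks_law)
  then have "(\<lambda>\<omega>. F (positions E t \<omega>)) \<in> borel_measurable (clocks_law p)"
    by (rule measurable_compose) simp
  then show ?thesis using assms(2) by (intro P.integrable_const_bound[of _ B]) auto
qed

text \<open>Differentiating the power series shifts its coefficients by one. By
  \<open>step_funpow_Suc_inv\<close> the shifted coefficients belong to \<open>step_op E p F\<close>
  read at the inverse, and the exponential factor contributes \<open>- card E\<close>. So the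
  positions themselves evolve by \<open>gen E p\<close>, which exchanges the positions of
  neighbouring classes.\<close>

lemma mean_value_positions:
  assumes p: "0 \<le> p" "p \<le> 1" and E: "finite E" and st: "0 \<le> s" "s < t" and F: "\<And>\<pi>. \<bar>F \<pi>\<bar> \<le> B"
  obtains \<xi> where "s < \<xi>" "\<xi> < t"
    "(\<integral>\<omega>. F (positions E t \<omega>) \<partial>clocks_law p) - (\<integral>\<omega>. F (positions E s \<omega>) \<partial>clocks_law p)
      = (t - s) * (\<integral>\<omega>. gen E p F (positions E \<xi> \<omega>) \<partial>clocks_law p)"
proof -
  let ?N = "real (card E)"
  let ?a = "\<lambda>n. (step_op E p ^^ n) (\<lambda>\<pi>. F (inv \<pi>)) id"
  let ?S = "\<lambda>x. \<Sum>n. ?a n / fact n * x ^ n" and ?S' = "\<lambda>x. \<Sum>n. diffs (\<lambda>n. ?a n / fact n) n * x ^ n"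
  have summable: "summable (\<lambda>n. ?a n / fact n * x ^ n)" for x
    by (rule summable_step_funpow[OF p F])
  have D: "((\<lambda>x. exp (- x * ?N) * ?S x) has_real_derivative
      exp (- x * ?N) * ?S' x - ?N * (exp (- x * ?N) * ?S x)) (at x)" for x
  proof -
    have 1: "((\<lambda>x. exp (- x * ?N)) has_real_derivative exp (- x * ?N) * (- ?N)) (at x)"
      by (auto intro!: derivative_eq_intros)
    have 2: "(?S has_real_derivative ?S' x) (at x)"
      by (rule termdiffs_strong_converges_everywhere) (rule summable)
    have "exp (- x * ?N) * (- ?N) * S + S' * exp (- x * ?N)
      = exp (- x * ?N) * S' - ?N * (exp (- x * ?N) * S)" for S S' :: real
      by (simp add: algebra_simps)
    then show ?thesis using DERIV_mult[OF 1 2] by (simp only:)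
  qed
  have "diffs (\<lambda>n. ?a n / fact n) n = (step_op E p ^^ n) (\<lambda>\<pi>. step_op E p F (inv \<pi>)) id / fact n" for n
    unfolding diffs_def step_funpow_Suc_inv by (simp add: field_simps del: of_nat_Suc)
  then have S': "exp (- x * ?N) * ?S' x = (\<integral>\<omega>. step_op E p F (positions E x \<omega>) \<partial>clocks_law p)" if "0 \<le> x" for x
    using expectation_positions[OF p E that, where F = "step_op E p F", OF abs_step_op_le[OF p F]] by simp
  obtain \<xi> where \<xi>: "s < \<xi>" "\<xi> < t" "exp (- t * ?N) * ?S t - exp (- s * ?N) * ?S s
      = (t - s) * (exp (- \<xi> * ?N) * ?S' \<xi> - ?N * (exp (- \<xi> * ?N) * ?S \<xi>))"
    using MVT2[OF \<open>s < t\<close> D] by blast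
  have "0 \<le> \<xi>" "0 \<le> t" using \<xi> st by simp_all
  then have "(\<integral>\<omega>. F (positions E t \<omega>) \<partial>clocks_law p) - (\<integral>\<omega>. F (positions E s \<omega>) \<partial>clocks_law p)
      = (t - s) * ((\<integral>\<omega>. step_op E p F (positions E \<xi> \<omega>) \<partial>clocks_law p)
        - ?N * (\<integral>\<omega>. F (positions E \<xi> \<omega>) \<partial>clocks_law p))"
    using \<xi>(3) expectation_positions[where F = F, OF p E _ F] st S' by simp
  also have "(\<integral>\<omega>. step_op E p F (positions E \<xi> \<omega>) \<partial>clocks_law p)
        - ?N * (\<integral>\<omega>. F (positions E \<xi> \<omega>) \<partial>clocks_law p)
      = (\<integral>\<omega>. gen E p F (positions E \<xi> \<omega>) \<partial>clocks_law p)"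
    unfolding gen_step_op
    using integrable_positions[where F = F, OF E F] integrable_positions[OF E, where F = "step_op E p F", OF abs_step_op_le[OF p F]]
    by (subst Bochner_Integration.integral_diff) auto
  finally show thesis using that \<xi> by blast
qed

subsection \<open>Finite blocks of the graphical construction\<close>

definition ring_at :: "clocks \<Rightarrow> int \<Rightarrow> nat \<Rightarrow> real" where
  "ring_at \<omega> n k = (\<Sum>j\<le>k. fst (\<omega> (n, j)))"

lemma ring_at_ge:
  assumes "\<And>k. 0 < fst (\<omega> (n, k))"
  shows "fst (\<omega> (n, 0)) \<le> ring_at \<omega> n k"
  unfolding ring_at_def using assms by (intro member_le_sum) (auto intro: less_imp_le)

lemma ring_at_adv_other:
  assumes "f \<in> E" "f \<noteq> e"
  shows "ring_at (adv E e \<omega>) f k = ring_at \<omega> f k - fst (\<omega> (e, 0))"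
  unfolding ring_at_def using assms by (induction k) (auto simp: adv_def)

lemma ring_at_adv_same: "ring_at (adv E e \<omega>) e k = ring_at \<omega> e (Suc k) - fst (\<omega> (e, 0))"
  unfolding ring_at_def sum.atMost_Suc_shift by (simp add: adv_def)

definition sorted_at :: "bool \<Rightarrow> int \<Rightarrow> (int \<Rightarrow> real) \<Rightarrow> (int \<Rightarrow> real) \<Rightarrow> bool" where
  "sorted_at c n z x \<longleftrightarrow> (if c
     then x n = max (z n) (z (n + 1)) \<and> x (n + 1) = min (z n) (z (n + 1))
     else x n = min (z n) (z (n + 1)) \<and> x (n + 1) = max (z n) (z (n + 1)))"

text \<open>The edges \<open>a - 1\<close> and \<open>b\<close> do not count here: the block is used while they have not rung.\<close>

definition block_path ::
  "int \<Rightarrow> int \<Rightarrow> clocks \<Rightarrow> real \<Rightarrow> (int \<Rightarrow> int) \<Rightarrow> (real \<Rightarrow> int \<Rightarrow> real) \<Rightarrow> bool" where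
  "block_path a b \<omega> t \<zeta> y \<longleftrightarrow>
     (\<forall>n\<in>{a..b}. y 0 n = real_of_int (\<zeta> n)) \<and>
     (\<forall>n\<in>{a..b}. \<forall>u v. 0 \<le> u \<and> u \<le> v \<and> v \<le> t \<and>
        (\<forall>f\<in>{n - 1, n} \<inter> {a..<b}. \<forall>k. ring_at \<omega> f k \<notin> {u<..v}) \<longrightarrow> y v n = y u n) \<and>
     (\<forall>n\<in>{a..<b}. \<forall>k. ring_at \<omega> n k \<le> t \<longrightarrow>
        (\<forall>\<^sub>F s in at_left (ring_at \<omega> n k). sorted_at (snd (\<omega> (n, k))) n (y s) (y (ring_at \<omega> n k))))"

lemma block_path_start: "block_path a b \<omega> t \<zeta> y \<Longrightarrow> n \<in> {a..b} \<Longrightarrow> y 0 n = real_of_int (\<zeta> n)"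
  unfolding block_path_def by blast

lemma block_path_const:
  assumes "block_path a b \<omega> t \<zeta> y" "n \<in> {a..b}" "0 \<le> u" "u \<le> v" "v \<le> t"
    and "\<And>f k. f \<in> {n - 1, n} \<inter> {a..<b} \<Longrightarrow> ring_at \<omega> f k \<notin> {u<..v}"
  shows "y v n = y u n"
proof -
  have "0 \<le> u \<and> u \<le> v \<and> v \<le> t \<and> (\<forall>f\<in>{n - 1, n} \<inter> {a..<b}. \<forall>k. ring_at \<omega> f k \<notin> {u<..v})"
    using assms(3-) by blast
  then show ?thesis
    using assms(1,2) unfolding block_path_def by blast
qed

lemma block_path_ring:
  assumes "block_path a b \<omega> t \<zeta> y" "n \<in> {a..<b}" "ring_at \<omega> n k \<le> t"
  shows "\<forall>\<^sub>F s in at_left (ring_at \<omega> n k). sorted_at (snd (\<omega> (n, k))) n (y s) (y (ring_at \<omega> n k))"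
  using assms unfolding block_path_def by blast

lemma sorted_at_act:
  assumes "sorted_at c n z x" "z n = real_of_int (\<zeta> n)" "z (n + 1) = real_of_int (\<zeta> (n + 1))"
    and "\<zeta> n \<noteq> \<zeta> (n + 1)"
  shows "x n = real_of_int (act (n, c) \<zeta> n)" "x (n + 1) = real_of_int (act (n, c) \<zeta> (n + 1))"
  using assms by (auto simp: sorted_at_def act_def split: if_splits)

text \<open>Until the first ring of \<open>E\<close> every site of the block keeps its initial
  value, so the sorting at that ring acts on \<zeta>. An edge that touches the block without lying
  in it is \<open>a - 1\<close> or \<open>b\<close>; if it belongs to \<open>E\<close> it is silent
  up to \<open>t\<close>, hence a first ring that touches the block is at an inner edge.\<close>

lemma block_path_first_ring:
  assumes path: "block_path a b \<omega> t \<zeta> y" and "inj \<zeta>"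
    and E: "{a..<b} \<subseteq> E" "\<And>f. f \<in> {a - 1, b} \<inter> E \<Longrightarrow> t < fst (\<omega> (f, 0))"
    and pos: "\<And>f k. f \<in> E \<Longrightarrow> 0 < fst (\<omega> (f, k))"
    and e: "e \<in> E" "fst (\<omega> (e, 0)) \<le> t" "\<And>f. f \<in> E - {e} \<Longrightarrow> fst (\<omega> (e, 0)) < fst (\<omega> (f, 0))"
    and n: "n \<in> {a..b}"
  shows "y (fst (\<omega> (e, 0))) n = real_of_int (act (e, snd (\<omega> (e, 0))) \<zeta> n)"
proof -
  let ?s = "fst (\<omega> (e, 0))"
  have s: "0 < ?s" using pos e by simp
  have start: "y 0 m = real_of_int (\<zeta> m)" if "m \<in> {a..b}" for m
    by (rule block_path_start[OF path that])
  have const: "y u m = y 0 m" if "m \<in> {a..b}" "0 \<le> u" "u \<le> t"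
    "\<And>f k. f \<in> {m - 1, m} \<inter> {a..<b} \<Longrightarrow> u < ring_at \<omega> f k" for m u
    by (rule block_path_const[OF path that(1)]) (use that in \<open>auto simp: not_le\<close>)
  have first: "?s \<le> ring_at \<omega> f k" if "f \<in> E" for f k
  proof -
    have "?s \<le> fst (\<omega> (f, 0))" using e(3)[of f] that by (cases "f = e") auto
    also have "\<dots> \<le> ring_at \<omega> f k" by (rule ring_at_ge) (rule pos[OF that])
    finally show ?thesis .
  qed
  have first': "?s < ring_at \<omega> f k" if "f \<in> E" "f \<noteq> e" for f k
  proof -
    have "?s < fst (\<omega> (f, 0))" using e(3)[of f] that by auto
    also have "\<dots> \<le> ring_at \<omega> f k" by (rule ring_at_ge) (rule pos[OF that(1)])
    finally show ?thesis .
  qed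
  show ?thesis
  proof (cases "n = e \<or> n = e + 1")
    case True
    have "e \<in> {a..<b}"
    proof (rule ccontr)
      assume "e \<notin> {a..<b}"
      then have "e \<in> {a - 1, b}" using True n by auto
      then show False using E(2)[of e] e by auto
    qed
    have T: "ring_at \<omega> e 0 = ?s" by (simp add: ring_at_def)
    have "\<forall>\<^sub>F s in at_left ?s. sorted_at (snd (\<omega> (e, 0))) e (y s) (y ?s)"
      using block_path_ring[OF path \<open>e \<in> {a..<b}\<close>, of 0] e(2) T by simp
    moreover have "\<forall>\<^sub>F s in at_left ?s. s \<in> {0<..<?s}"
      using s by (rule eventually_at_leftI[rotated]) simp
    ultimately have "\<forall>\<^sub>F s in at_left ?s. sorted_at (snd (\<omega> (e, 0))) e (y s) (y ?s) \<and> s \<in> {0<..<?s}"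
      by (rule eventually_conj)
    \<comment> \<open>The sorting rule holds for all times shortly before the ring; one such time
      \<open>u\<close> is enough, because the values at \<open>e\<close> and \<open>e + 1\<close>
      are still the initial ones.\<close>
    then obtain u where u: "sorted_at (snd (\<omega> (e, 0))) e (y u) (y ?s)" "0 < u" "u < ?s"
      using eventually_happens[of _ "at_left ?s"] by auto
    have "y u m = real_of_int (\<zeta> m)" if "m \<in> {e, e + 1}" for m
    proof -
      have m: "m \<in> {a..b}" using that \<open>e \<in> {a..<b}\<close> by auto
      have "y u m = y 0 m"
      proof (rule const[OF m])
        fix f k assume "f \<in> {m - 1, m} \<inter> {a..<b}"
        then have "f \<in> E" using E(1) by blast
        then show "u < ring_at \<omega> f k" using first[of f k] u(3) by simp
      qed (use u e(2) in auto)
      then show ?thesis using start[OF m] by simp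
    qed
    then show ?thesis
      using sorted_at_act[OF u(1), of \<zeta>] True injD[OF \<open>inj \<zeta>\<close>, of e "e + 1"] by auto
  next
    case False
    have "y ?s n = y 0 n"
    proof (rule const[OF n])
      fix f k assume f: "f \<in> {n - 1, n} \<inter> {a..<b}"
      then have "f \<in> E" using E(1) by blast
      moreover have "f \<noteq> e" using f False by auto
      ultimately show "?s < ring_at \<omega> f k" by (rule first')
    qed (use s e(2) in auto)
    then show ?thesis using start[OF n] False by (simp add: act_other)
  qed
qed

text \<open>Restart after the first ring. The other rings of \<omega> are those of the advanced
  clocks, later by the time of the first ring. Both directions of this correspondence are used: from
  the advanced clocks to \<omega> for the sorting rule, and back for constancy between
  rings.\<close>

lemma block_path_adv:
  assumes path: "block_path a b \<omega> t \<zeta> y" and "inj \<zeta>"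
    and E: "{a..<b} \<subseteq> E" "\<And>f. f \<in> {a - 1, b} \<inter> E \<Longrightarrow> t < fst (\<omega> (f, 0))"
    and pos: "\<And>f k. f \<in> E \<Longrightarrow> 0 < fst (\<omega> (f, k))"
    and e: "e \<in> E" "fst (\<omega> (e, 0)) \<le> t" "\<And>f. f \<in> E - {e} \<Longrightarrow> fst (\<omega> (e, 0)) < fst (\<omega> (f, 0))"
  shows "block_path a b (adv E e \<omega>) (t - fst (\<omega> (e, 0))) (act (e, snd (\<omega> (e, 0))) \<zeta>)
    (\<lambda>u. y (fst (\<omega> (e, 0)) + u))"
proof -
  let ?s = "fst (\<omega> (e, 0))"
  have s: "0 < ?s" using pos e by simp
  have ring: "\<exists>k'. ring_at \<omega> f k' = ?s + ring_at (adv E e \<omega>) f k \<and> snd (\<omega> (f, k')) = snd (adv E e \<omega> (f, k))"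
    if "f \<in> E" for f k
  proof (cases "f = e")
    case True
    then show ?thesis
      by (intro exI[of _ "Suc k"]) (simp add: ring_at_adv_same, simp add: adv_def)
  next
    case False
    with that show ?thesis
      by (intro exI[of _ k]) (simp add: ring_at_adv_other, simp add: adv_def)
  qed
  have ring': "ring_at \<omega> f k = ?s \<or> (\<exists>k'. ring_at \<omega> f k = ?s + ring_at (adv E e \<omega>) f k')"
    if "f \<in> E" for f k
  proof (cases "f = e")
    case True
    then show ?thesis
      by (cases k) (auto simp: ring_at_adv_same ring_at_def[of \<omega> e 0])
  qed (use that in \<open>auto simp: ring_at_adv_other\<close>)
  show ?thesis
    unfolding block_path_def
  proof (intro conjI ballI allI impI)
    show "y (?s + 0) n = real_of_int (act (e, snd (\<omega> (e, 0))) \<zeta> n)" if "n \<in> {a..b}" for n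
      using block_path_first_ring[OF assms that] by simp
  next
    fix n u v
    assume n: "n \<in> {a..b}"
      and *: "0 \<le> u \<and> u \<le> v \<and> v \<le> t - ?s \<and>
        (\<forall>f\<in>{n - 1, n} \<inter> {a..<b}. \<forall>k. ring_at (adv E e \<omega>) f k \<notin> {u<..v})"
    have "ring_at \<omega> f k \<notin> {?s + u<..?s + v}" if "f \<in> {n - 1, n} \<inter> {a..<b}" for f k
    proof -
      have no: "ring_at (adv E e \<omega>) f k' \<notin> {u<..v}" for k' using * that by blast
      have "f \<in> E" using that E(1) by blast
      from ring'[OF this, of k] show ?thesis
      proof (elim disjE exE)
        fix k' assume "ring_at \<omega> f k = ?s + ring_at (adv E e \<omega>) f k'"
        then show ?thesis using no[of k'] by simp
      qed (use * in simp)
    qed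
    then show "y (?s + v) n = y (?s + u) n"
      by (intro block_path_const[OF path n]) (use * s in auto)
  next
    fix n k
    assume n: "n \<in> {a..<b}" and k: "ring_at (adv E e \<omega>) n k \<le> t - ?s"
    have "n \<in> E" using n E(1) by auto
    then obtain k' where k': "ring_at \<omega> n k' = ?s + ring_at (adv E e \<omega>) n k"
      "snd (\<omega> (n, k')) = snd (adv E e \<omega> (n, k))"
      using ring by blast
    have "\<forall>\<^sub>F s in at_left (ring_at \<omega> n k'). sorted_at (snd (\<omega> (n, k'))) n (y s) (y (ring_at \<omega> n k'))"
      using block_path_ring[OF path n, of k'] k k'(1) by simp
    then obtain c where c: "c < ring_at \<omega> n k'"
      "\<And>s. c < s \<Longrightarrow> s < ring_at \<omega> n k' \<Longrightarrow> sorted_at (snd (\<omega> (n, k'))) n (y s) (y (ring_at \<omega> n k'))"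
      unfolding eventually_at_left_field by blast
    show "\<forall>\<^sub>F s in at_left (ring_at (adv E e \<omega>) n k).
        sorted_at (snd (adv E e \<omega> (n, k))) n (y (?s + s)) (y (?s + ring_at (adv E e \<omega>) n k))"
      unfolding eventually_at_left_field
      using c(1) k' by (intro exI[of _ "c - ?s"]) (auto intro!: c(2)[unfolded k'])
  qed
qed

text \<open>Induction along the ring word, restarting the path at each ring. \<open>E\<close> may be
  larger than the block: rings outside leave the block alone, so the word of a whole window computes
  every block in it that is bounded by silent edges.\<close>

lemma block_path_word:
  assumes "ring_word E \<omega> t l" "0 \<le> t" "block_path a b \<omega> t \<zeta> y" "bij \<zeta>"
    and "{a..<b} \<subseteq> E" "\<And>f. f \<in> {a - 1, b} \<inter> E \<Longrightarrow> t < fst (\<omega> (f, 0))"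
    and "\<And>f k. f \<in> E \<Longrightarrow> 0 < fst (\<omega> (f, k))"
    and "n \<in> {a..b}"
  shows "y t n = real_of_int (fold act l \<zeta> n)"
  using assms
proof (induction l arbitrary: \<omega> t \<zeta> y)
  case Nil
  have "ring_at \<omega> f k \<notin> {0<..t}" if "f \<in> E" for f k
  proof -
    have "t < fst (\<omega> (f, 0))" using Nil.prems(1) that by simp
    also have "\<dots> \<le> ring_at \<omega> f k" by (rule ring_at_ge) (rule Nil.prems(7)[OF that])
    finally show ?thesis by simp
  qed
  then have "y t n = y 0 n"
    using Nil.prems(2,5) by (intro block_path_const[OF Nil.prems(3,8)]) (simp, simp, simp, blast)
  then show ?case using block_path_start[OF Nil.prems(3,8)] by simp
next
  case (Cons x l)
  obtain e c where x: "x = (e, c)" by (cases x)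
  let ?s = "fst (\<omega> (e, 0))"
  note w = Cons.prems(1)[unfolded x ring_word.simps fst_conv snd_conv]
  have "(\<lambda>u. y (?s + u)) (t - ?s) n = real_of_int (fold act l (act (e, c) \<zeta>) n)"
  proof (rule Cons.IH[where \<omega> = "adv E e \<omega>" and t = "t - ?s" and y = "\<lambda>u. y (?s + u)"])
    show "block_path a b (adv E e \<omega>) (t - ?s) (act (e, c) \<zeta>) (\<lambda>u. y (?s + u))"
      using block_path_adv[OF Cons.prems(3) bij_is_inj[OF Cons.prems(4)] Cons.prems(5-7), of e] w by auto
    show "t - ?s < fst (adv E e \<omega> (f, 0))" if "f \<in> {a - 1, b} \<inter> E" for f
      using Cons.prems(6)[OF that] w that by (auto simp: adv_def)
    show "0 < fst (adv E e \<omega> (f, k))" if "f \<in> E" for f k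
      using Cons.prems(7)[of f] Cons.prems(7)[of e] w that by (auto simp: adv_def)
    show "bij (act (e, c) \<zeta>)" by (rule bij_act) (rule Cons.prems(4))
  qed (use w Cons.prems in auto)
  then show ?case by (simp add: x)
qed

lemma ring_word_silent:
  "ring_word E \<omega> t l \<Longrightarrow> t < fst (\<omega> (f, 0)) \<Longrightarrow> f \<notin> fst ` set l"
proof (induction l arbitrary: \<omega> t)
  case (Cons x l)
  have "f \<noteq> fst x" using Cons.prems by auto
  moreover have "f \<notin> fst ` set l"
  proof (cases "f \<in> E")
    case True
    have "t - fst (\<omega> (fst x, 0)) < fst (adv E (fst x) \<omega> (f, 0))"
      using Cons.prems True \<open>f \<noteq> fst x\<close> by (simp add: adv_def)
    moreover have "ring_word E (adv E (fst x) \<omega>) (t - fst (\<omega> (fst x, 0))) l"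
      using Cons.prems by simp
    ultimately show ?thesis by (rule Cons.IH[rotated])
  next
    case False
    then show ?thesis using ring_word_set[OF Cons.prems(1)] by (auto simp: subset_iff)
  qed
  ultimately show ?case by simp
qed simp

text \<open>Without the two boundary edges every transposition exchanges two sites of the block or
  two sites outside it.\<close>

lemma image_fold_act:
  "a - 1 \<notin> fst ` set l \<Longrightarrow> b \<notin> fst ` set l \<Longrightarrow> fold act l \<pi> ` {a..b} = \<pi> ` {a..b}"
proof (induction l arbitrary: \<pi>)
  case (Cons x l)
  have "Transposition.transpose (fst x) (fst x + 1) ` {a..b} = {a..b}"
  proof (cases "fst x \<in> {a..b}")
    case True
    then have "fst x + 1 \<in> {a..b}" using Cons.prems by auto
    with True show ?thesis by (intro transpose_image_eq) simp
  next
    case False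
    then have "fst x + 1 \<notin> {a..b}" using Cons.prems by auto
    with False show ?thesis by (intro transpose_image_eq) blast
  qed
  then have "(\<pi> \<circ> Transposition.transpose (fst x) (fst x + 1)) ` {a..b} = \<pi> ` {a..b}"
    by (metis image_comp)
  then have "act x \<pi> ` {a..b} = \<pi> ` {a..b}" unfolding act_def by (simp only: split: if_split) simp
  then show ?case using Cons by simp
qed simp

abbreviation window :: "nat \<Rightarrow> int set" where
  "window L \<equiv> {- int L..<int L}"

text \<open>A countable conjunction, so that it can hold almost surely. Integer horizons are enough:
  a word for a longer horizon yields words for all shorter ones, and a gap beyond an integer is
  beyond all earlier times.\<close>

definition good_clocks :: "clocks \<Rightarrow> bool" where
  "good_clocks \<omega> \<longleftrightarrow> (\<forall>i. 0 < fst (\<omega> i)) \<and> (\<forall>N L. \<exists>l. ring_word (window L) \<omega> (real N) l) \<and>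
     (\<forall>N B. (\<exists>n\<ge>int B. real N < fst (\<omega> (n, 0))) \<and> (\<exists>n\<le>- int B. real N < fst (\<omega> (n, 0))))"

text \<open>The block between the two silent edges contains \<open>{-k..k}\<close>, so up to time
  \<open>t\<close> the labels there are not influenced by what happens outside the window. The left
  bound is strict because the block starts one site to the right of its left silent edge.\<close>

definition separated :: "nat \<Rightarrow> nat \<Rightarrow> real \<Rightarrow> clocks \<Rightarrow> bool" where
  "separated L k t \<omega> \<longleftrightarrow> (\<exists>n\<in>{- int L..<- int k}. t < fst (\<omega> (n, 0))) \<and> (\<exists>n\<in>{int k..<int L}. t < fst (\<omega> (n, 0)))"

lemma separated_mono: "separated L k t \<omega> \<Longrightarrow> s \<le> t \<Longrightarrow> separated L k s \<omega>"
  unfolding separated_def by (meson le_less_trans)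

lemma good_clocks_word:
  assumes "good_clocks \<omega>"
  shows "\<exists>l. ring_word (window L) \<omega> t l"
proof -
  obtain N where "t \<le> real N" using real_arch_simple by blast
  moreover obtain l where "ring_word (window L) \<omega> (real N) l" using assms unfolding good_clocks_def by blast
  ultimately show ?thesis using ring_word_prefix by blast
qed

lemma good_clocks_separated:
  assumes "good_clocks \<omega>"
  shows "\<exists>L0. \<forall>L\<ge>L0. separated L k t \<omega>"
proof -
  obtain N where N: "t \<le> real N" using real_arch_simple by blast
  obtain b where b: "b \<ge> int k" "real N < fst (\<omega> (b, 0))" using assms unfolding good_clocks_def by blast
  obtain a where a: "a \<le> - int (Suc k)" "real N < fst (\<omega> (a, 0))" using assms unfolding good_clocks_def by blast
  have "separated L k t \<omega>" if "nat (max (b + 1) (- a)) \<le> L" for L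
    unfolding separated_def using a b N that by (intro conjI bexI[of _ a] bexI[of _ b]) auto
  then show ?thesis by blast
qed

definition label_path :: "clocks \<Rightarrow> (real \<Rightarrow> int \<Rightarrow> real) \<Rightarrow> bool" where
  "label_path \<omega> y \<longleftrightarrow> asep_path (ring_at \<omega>) (\<lambda>n k. snd (\<omega> (n, k))) real_of_int y"

lemma label_path_block:
  assumes y: "label_path \<omega> y" and pos: "\<And>i. 0 < fst (\<omega> i)"
    and silent: "t < fst (\<omega> (a - 1, 0))" "t < fst (\<omega> (b, 0))"
  shows "block_path a b \<omega> t id y"
proof -
  have no_ring: "t < ring_at \<omega> f k" if "f = a - 1 \<or> f = b" for f k
  proof -
    have "t < fst (\<omega> (f, 0))" using silent that by blast
    also have "\<dots> \<le> ring_at \<omega> f k" by (rule ring_at_ge) (rule pos)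
    finally show ?thesis .
  qed
  have y0: "y 0 = real_of_int"
    and const: "\<And>n s t. 0 \<le> s \<and> s \<le> t \<and> (\<forall>k. ring_at \<omega> (n - 1) k \<notin> {s<..t} \<and> ring_at \<omega> n k \<notin> {s<..t})
        \<Longrightarrow> y t n = y s n"
    and ring: "\<And>n k. \<forall>\<^sub>F s in at_left (ring_at \<omega> n k). sorted_at (snd (\<omega> (n, k))) n (y s) (y (ring_at \<omega> n k))"
    using y unfolding label_path_def asep_path_def sorted_at_def by blast+
  show ?thesis
    unfolding block_path_def
  proof (intro conjI ballI allI impI)
    fix n u v
    assume n: "n \<in> {a..b}"
      and *: "0 \<le> u \<and> u \<le> v \<and> v \<le> t \<and> (\<forall>f\<in>{n - 1, n} \<inter> {a..<b}. \<forall>k. ring_at \<omega> f k \<notin> {u<..v})"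
    have "ring_at \<omega> f k \<notin> {u<..v}" if "f \<in> {n - 1, n}" for f k
    proof (cases "f \<in> {a..<b}")
      case False
      then have "f = a - 1 \<or> f = b" using that n by auto
      then show ?thesis using no_ring[of f k] * by auto
    qed (use * that in blast)
    then show "y v n = y u n" using * by (intro const) auto
  qed (use y0 ring in auto)
qed

context
  fixes \<omega> y
  assumes good: "good_clocks \<omega>" and path: "label_path \<omega> y"
begin

lemma gap_pos: "0 < fst (\<omega> i)"
  using good unfolding good_clocks_def by blast

text \<open>The invariance of the block is recorded together with the values on it: it shows that a
  class of the block stays in the block, so that positions can be read off there as well.\<close>

lemma label_path_word:
  assumes "0 \<le> t" "separated L k t \<omega>"
  defines "\<pi> \<equiv> fold act (word (window L) t \<omega>) id"
  obtains a b where "a \<le> - int k" "int k \<le> b" "\<And>n. n \<in> {a..b} \<Longrightarrow> y t n = real_of_int (\<pi> n)" "\<pi> ` {a..b} = {a..b}"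
proof -
  obtain a' b where a: "a' \<in> {- int L..<- int k}" "t < fst (\<omega> (a', 0))"
    and b: "b \<in> {int k..<int L}" "t < fst (\<omega> (b, 0))"
    using assms(2) unfolding separated_def by blast
  obtain l where l: "ring_word (window L) \<omega> t l" using good_clocks_word[OF good] by blast
  have \<pi>: "\<pi> = fold act l id" by (simp add: \<pi>_def word_eq[OF l])
  show thesis
  proof (rule that[of "a' + 1" b])
    have "block_path (a' + 1) b \<omega> t id y"
      by (rule label_path_block[OF path gap_pos]) (use a b in simp_all)
    then show "y t n = real_of_int (\<pi> n)" if "n \<in> {a' + 1..b}" for n
      unfolding \<pi> by (rule block_path_word[OF l assms(1)]) (use that a b gap_pos in auto)
    show "\<pi> ` {a' + 1..b} = {a' + 1..b}"
      unfolding \<pi> by (subst image_fold_act) (use ring_word_silent[OF l] a b in auto)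
  qed (use a b in auto)
qed

text \<open>Any two sites lie in a common silent block, on which the path is the restriction of a
  permutation.\<close>

lemma label_path_inj:
  assumes "0 \<le> t" "y t i = y t j"
  shows "i = j"
proof -
  let ?k = "nat (max \<bar>i\<bar> \<bar>j\<bar>)"
  obtain L where "separated L ?k t \<omega>" using good_clocks_separated[OF good] by blast
  from label_path_word[OF assms(1) this] obtain a b where "a \<le> - int ?k" "int ?k \<le> b"
    "\<And>n. n \<in> {a..b} \<Longrightarrow> y t n = real_of_int (fold act (word (window L) t \<omega>) id n)" by metis
  then have "fold act (word (window L) t \<omega>) id i = fold act (word (window L) t \<omega>) id j"
    using assms(2) by (smt (verit) atLeastAtMost_iff of_int_eq_iff nat_0_le)
  then show ?thesis using bij_is_inj[OF bij_fold_act[OF bij_id]] by (simp add: inj_eq)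
qed

text \<open>The block is mapped onto itself, so class \<open>m\<close> is found inside it, where
  line and window agree; a second site with the same value is excluded by injectivity on the whole
  line.\<close>

lemma label_path_positions:
  assumes "0 \<le> t" "separated L k t \<omega>" "\<bar>m\<bar> \<le> int k"
  shows "y t j = real_of_int m \<longleftrightarrow> j = positions (window L) t \<omega> m"
proof -
  let ?\<pi> = "fold act (word (window L) t \<omega>) id"
  obtain a b where ab: "a \<le> - int k" "int k \<le> b" "\<And>n. n \<in> {a..b} \<Longrightarrow> y t n = real_of_int (?\<pi> n)"
    "?\<pi> ` {a..b} = {a..b}"
    using label_path_word[OF assms(1,2)] by metis
  have "m \<in> ?\<pi> ` {a..b}" using ab assms(3) by auto
  then obtain i where i: "i \<in> {a..b}" "m = ?\<pi> i" by blast
  have "positions (window L) t \<omega> m = i"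
    unfolding positions_def i(2) using bij_fold_act[OF bij_id] by (simp add: bij_is_inj inv_f_f)
  moreover have "y t i = real_of_int m" using ab(3) i by simp
  ultimately show ?thesis using label_path_inj[OF assms(1)] by metis
qed

lemma label_path_the:
  assumes "0 \<le> t" "separated L k t \<omega>" "\<bar>m\<bar> \<le> int k"
  shows "(THE j. y t j = real_of_int m) = positions (window L) t \<omega> m"
  using label_path_positions[OF assms] by simp

lemma label_path_ex1:
  assumes "0 \<le> t"
  shows "\<exists>!j. y t j = real_of_int m"
proof -
  obtain L where "separated L (nat \<bar>m\<bar>) t \<omega>" using good_clocks_separated[OF good] by blast
  then show ?thesis using label_path_positions[OF assms] by simp
qed

text \<open>Needed to pass from rational to real times in the convergence of
  \<open>X t \<omega> m / t\<close>.\<close>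

lemma label_path_right_cont:
  assumes "0 \<le> t"
  shows "\<exists>\<epsilon>>0. \<forall>t'\<in>{t..<t + \<epsilon>}. (THE j. y t' j = real_of_int m) = (THE j. y t j = real_of_int m)"
proof -
  let ?k = "nat \<bar>m\<bar>"
  \<comment> \<open>The silent edges are taken for time \<open>t + 1\<close>, so that one window
    serves all times up to \<open>t + 1\<close>.\<close>
  obtain L where L: "separated L ?k (t + 1) \<omega>" using good_clocks_separated[OF good] by blast
  obtain l where l: "ring_word (window L) \<omega> t l" using good_clocks_word[OF good] by blast
  obtain \<epsilon> where \<epsilon>: "\<epsilon> > 0" "\<And>t'. t' \<in> {t..<t + \<epsilon>} \<Longrightarrow> ring_word (window L) \<omega> t' l"
    using ring_word_right_cont[OF _ l] by auto
  have "(THE j. y t' j = real_of_int m) = (THE j. y t j = real_of_int m)" if "t' \<in> {t..<t + min \<epsilon> 1}" for t'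
  proof -
    have sep: "separated L ?k t' \<omega>" "separated L ?k t \<omega>"
      using separated_mono[OF L] that by auto
    have "word (window L) t' \<omega> = word (window L) t \<omega>"
      using \<epsilon>(2)[of t'] that word_eq l by auto
    then show ?thesis
      using label_path_the[OF _ sep(1), of m] label_path_the[OF _ sep(2), of m] assms that
      by (simp add: positions_def)
  qed
  moreover have "0 < min \<epsilon> 1" using \<epsilon>(1) by simp
  ultimately show ?thesis by blast
qed

end

section \<open>Translation of the clocks\<close>

definition shift_clocks :: "int \<Rightarrow> clocks \<Rightarrow> clocks" where
  "shift_clocks n \<omega> i = \<omega> (fst i + n, snd i)"

text \<open>Sites and classes are shifted together, so that the path again starts at the identity;
  sorting is not affected by subtracting a constant from all classes.\<close>

lemma label_path_shift:
  assumes "label_path \<omega> y"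
  shows "label_path (shift_clocks n \<omega>) (\<lambda>t j. y t (j + n) - real_of_int n)"
proof -
  have r: "ring_at (shift_clocks n \<omega>) j k = ring_at \<omega> (j + n) k" for j k by (simp add: ring_at_def shift_clocks_def)
  have y0: "y 0 = real_of_int"
    and const: "\<And>n s t. 0 \<le> s \<and> s \<le> t \<and> (\<forall>k. ring_at \<omega> (n - 1) k \<notin> {s<..t} \<and> ring_at \<omega> n k \<notin> {s<..t})
        \<Longrightarrow> y t n = y s n"
    and ring: "\<And>n k. \<forall>\<^sub>F s in at_left (ring_at \<omega> n k). sorted_at (snd (\<omega> (n, k))) n (y s) (y (ring_at \<omega> n k))"
    using assms unfolding label_path_def asep_path_def sorted_at_def by blast+
  have sorted: "sorted_at c (j + n) z x \<Longrightarrow> sorted_at c j (\<lambda>j. z (j + n) - real_of_int n) (\<lambda>j. x (j + n) - real_of_int n)"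
    for c j z x by (auto simp: sorted_at_def algebra_simps max_def min_def split: if_splits)
  show ?thesis
    unfolding label_path_def asep_path_def
  proof (intro conjI allI impI)
    show "(\<lambda>j. y 0 (j + n) - real_of_int n) = real_of_int" by (simp add: y0)
    fix j s t
    assume "0 \<le> s \<and> s \<le> t \<and> (\<forall>k. ring_at (shift_clocks n \<omega>) (j - 1) k \<notin> {s<..t} \<and> ring_at (shift_clocks n \<omega>) j k \<notin> {s<..t})"
    then show "y t (j + n) - real_of_int n = y s (j + n) - real_of_int n"
      using const[of s t "j + n"] by (simp add: r algebra_simps)
  next
    fix j k
    have "\<forall>\<^sub>F s in at_left (ring_at \<omega> (j + n) k). sorted_at (snd (\<omega> (j + n, k))) j
        (\<lambda>i. y s (i + n) - real_of_int n) (\<lambda>i. y (ring_at \<omega> (j + n) k) (i + n) - real_of_int n)"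
      using ring[where n = "j + n" and k = k] by eventually_elim (rule sorted)
    then show "\<forall>\<^sub>F s in at_left (ring_at (shift_clocks n \<omega>) j k).
        if snd (shift_clocks n \<omega> (j, k))
        then y (ring_at (shift_clocks n \<omega>) j k) (j + n) - real_of_int n
            = max (y s (j + n) - real_of_int n) (y s (j + 1 + n) - real_of_int n)
          \<and> y (ring_at (shift_clocks n \<omega>) j k) (j + 1 + n) - real_of_int n
            = min (y s (j + n) - real_of_int n) (y s (j + 1 + n) - real_of_int n)
        else y (ring_at (shift_clocks n \<omega>) j k) (j + n) - real_of_int n
            = min (y s (j + n) - real_of_int n) (y s (j + 1 + n) - real_of_int n)
          \<and> y (ring_at (shift_clocks n \<omega>) j k) (j + 1 + n) - real_of_int n
            = max (y s (j + n) - real_of_int n) (y s (j + 1 + n) - real_of_int n)"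
      unfolding r sorted_at_def by (simp add: shift_clocks_def)
  qed
qed

lemma label_path_shift_the:
  assumes "good_clocks \<omega>" "label_path \<omega> y" "0 \<le> t"
  shows "(THE j. y t (j + n) - real_of_int n = real_of_int m) = (THE j. y t j = real_of_int (m + n)) - n"
proof -
  obtain i where i: "\<And>j. y t j = real_of_int (m + n) \<longleftrightarrow> j = i"
    using label_path_ex1[OF assms, of "m + n"] by metis
  have "y t (j + n) - real_of_int n = real_of_int m \<longleftrightarrow> j = i - n" for j
    using i[of "j + n"] by (auto simp: algebra_simps)
  then show ?thesis by (simp only: i the_eq_trivial)
qed

subsection \<open>Mixing of the clocks\<close>

lemma measurable_shift_clocks [measurable]: "shift_clocks n \<in> measurable clock_space clock_space"
  by (rule measurable_PiM_single') (auto simp: shift_clocks_def space_pair_measure)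

lemma measurable_clocks_law_cong: "measurable (clocks_law p) (clocks_law p') = measurable clock_space clock_space"
  by (rule measurable_cong_sets) (simp_all add: sets_clocks_law)

lemma distr_shift_clocks: "distr (clocks_law p) (clocks_law p) (shift_clocks n) = clocks_law p"
proof -
  have "distr (\<Pi>\<^sub>M i\<in>UNIV. mark_law p) (\<Pi>\<^sub>M i\<in>UNIV. mark_law p)
      (\<lambda>\<omega>. \<lambda>i\<in>UNIV. \<omega> ((\<lambda>i. (fst i + n, snd i)) i)) = (\<Pi>\<^sub>M i\<in>UNIV. mark_law p)"
    by (rule distr_PiM_reindex) (auto simp: prob_space_mark_law inj_on_def prod_eq_iff)
  then show ?thesis by (simp add: clocks_law_def shift_clocks_def[abs_def] restrict_def)
qed

lemma shift_clocks_add: "shift_clocks m (shift_clocks n \<omega>) = shift_clocks (m + n) \<omega>"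
  by (simp add: fun_eq_iff shift_clocks_def add.assoc)

lemma shift_clocks_0 [simp]: "shift_clocks 0 \<omega> = \<omega>"
  by (simp add: fun_eq_iff shift_clocks_def)

lemma AE_clocks_law_pos:
  "AE \<omega> in clocks_law p. 0 < fst (\<omega> i)"
proof -
  interpret P: prob_space "clocks_law p" by (rule prob_space_clocks_law)
  have "emeasure (clocks_law p) {\<omega>. (\<forall>j\<in>{i}. 0 < fst (\<omega> j)) \<and> delay {i} 0 \<omega> \<in> UNIV} = 1"
    using P.emeasure_space_1 by (subst emeasure_delay) simp_all
  then have "P.prob {\<omega>. 0 < fst (\<omega> i)} = 1" by (simp add: measure_def)
  then have "AE \<omega> in clocks_law p. \<omega> \<in> {\<omega>. 0 < fst (\<omega> i)}"
    by (rule P.AE_prob_1)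
  then show ?thesis by simp
qed

text \<open>The first gaps along distinct edges are independent, and each is at most
  \<open>t\<close> with the same probability below 1; that the first \<open>k\<close> of them are at
  most \<open>t\<close> has the \<open>k\<close>-th power of it as probability.\<close>

lemma AE_clocks_law_silent:
  assumes f: "inj (f :: nat \<Rightarrow> int)" and t: "0 \<le> t"
  shows "AE \<omega> in clocks_law p. \<exists>n. t < fst (\<omega> (f n, 0))"
proof -
  interpret P: prob_space "clocks_law p" by (rule prob_space_clocks_law)
  interpret m: prob_space "mark_law p" by (rule prob_space_mark_law)
  let ?A = "{z :: real \<times> bool. fst z \<le> t}"
  let ?N = "borel \<Otimes>\<^sub>M count_space UNIV :: (real \<times> bool) measure"
  have "{z \<in> space ?N. fst z \<le> t} \<in> sets ?N" by measurable
  then have A: "?A \<in> sets ?N" by (simp add: space_pair_measure)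
  have UN: "UNIV \<in> sets ?N" using sets.top[of ?N] by (simp add: space_pair_measure)
  have "emeasure (mark_law p) {z. t < fst z \<and> (fst z - t, snd z) \<in> UNIV} = ennreal (exp (- t))"
    using m.emeasure_space_1 by (subst emeasure_mark_law_shift[OF UN t]) simp
  then have "m.prob {z. t < fst z} = exp (- t)" by (simp add: measure_def)
  moreover have "m.prob {z. t < fst z} = 1 - m.prob ?A"
    using m.prob_compl[of ?A] A by (simp add: sets_mark_law Compl_eq_Diff_UNIV[symmetric] Collect_neg_eq[symmetric] not_le)
  ultimately have lt: "m.prob ?A < 1" by simp (metis exp_gt_zero diff_gt_0_iff_gt)
  define Z where "Z = {\<omega> \<in> space (clocks_law p). \<forall>n. fst (\<omega> (f n, 0)) \<le> t}"
  have Z: "Z \<in> P.events"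
    unfolding Z_def by measurable
  have le: "P.prob Z \<le> m.prob ?A ^ k" for k
  proof -
    let ?K = "(\<lambda>n. (f n, 0 :: nat)) ` {..<k}"
    have card: "card ?K = k"
      using f by (subst card_image) (auto simp: inj_on_def)
    have "emeasure (clocks_law p) {\<omega>. \<forall>i\<in>?K. \<omega> i \<in> ?A} = (\<Prod>i\<in>?K. emeasure (mark_law p) ?A)"
      by (rule emeasure_clocks_law_box) (use A in auto)
    then have "emeasure (clocks_law p) {\<omega>. \<forall>i\<in>?K. \<omega> i \<in> ?A} = ennreal (m.prob ?A ^ k)"
      by (simp add: card m.emeasure_eq_measure ennreal_power)
    then have "P.prob {\<omega>. \<forall>i\<in>?K. \<omega> i \<in> ?A} = m.prob ?A ^ k" by (simp add: measure_def)
    moreover have "{\<omega> \<in> space (clocks_law p). \<forall>i\<in>?K. fst (\<omega> i) \<le> t} \<in> P.events"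
      by measurable
    then have "P.prob Z \<le> P.prob {\<omega>. \<forall>i\<in>?K. \<omega> i \<in> ?A}"
      by (intro P.finite_measure_mono) (auto simp: Z_def)
    ultimately show ?thesis by simp
  qed
  have "(\<lambda>k. m.prob ?A ^ k) \<longlonglongrightarrow> 0"
    using lt by (intro LIMSEQ_power_zero) simp
  then have "P.prob Z \<le> 0"
    by (rule LIMSEQ_le_const) (use le in auto)
  then have "P.prob Z = 0" using measure_nonneg[of "clocks_law p" Z] by simp
  then have "Z \<in> null_sets (clocks_law p)" using Z by (simp add: null_sets_def P.emeasure_eq_measure)
  then have "AE \<omega> in clocks_law p. \<omega> \<notin> Z" by (rule AE_not_in)
  then show ?thesis by eventually_elim (auto simp: Z_def not_le)
qed

lemma AE_good_clocks:
  assumes p: "0 \<le> p" "p \<le> 1"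
  shows "AE \<omega> in clocks_law p. good_clocks \<omega>"
proof -
  have "AE \<omega> in clocks_law p. \<forall>i. 0 < fst (\<omega> i)"
    unfolding AE_all_countable by (rule allI) (rule AE_clocks_law_pos)
  moreover have "AE \<omega> in clocks_law p. \<forall>N L. \<exists>l. ring_word (window L) \<omega> (real N) l"
    unfolding AE_all_countable by (intro allI AE_ring_word p) simp_all
  moreover have "AE \<omega> in clocks_law p. \<forall>N B. \<exists>k. real N < fst (\<omega> (int B + int k, 0))"
    unfolding AE_all_countable by (intro allI AE_clocks_law_silent) (auto simp: inj_def)
  moreover have "AE \<omega> in clocks_law p. \<forall>N B. \<exists>k. real N < fst (\<omega> (- int B - int k, 0))"
    unfolding AE_all_countable by (intro allI AE_clocks_law_silent) (auto simp: inj_def)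
  ultimately show ?thesis
  proof eventually_elim
    case (elim \<omega>)
    have "\<exists>n\<ge>int B. real N < fst (\<omega> (n, 0))" for N B
      using elim(3)[rule_format, of N B] by (metis le_add_same_cancel1 of_nat_0_le_iff)
    moreover have "\<exists>n\<le>- int B. real N < fst (\<omega> (n, 0))" for N B
    proof -
      obtain k where "real N < fst (\<omega> (- int B - int k, 0))" using elim(4) by blast
      then show ?thesis by (intro exI[of _ "- int B - int k"]) simp
    qed
    ultimately show ?case unfolding good_clocks_def using elim(1,2) by blast
  qed
qed

text \<open>The sets \<open>A\<close> with this limit form a Dynkin class: complements use the
  convergence of \<open>prob (T k)\<close>, and for disjoint unions limit and series are exchanged
  by Tannery's theorem with majorant \<open>prob (A i)\<close>. As \<open>T\<close> is an arbitrary
  sequence of events, either factor of a shifted intersection can take its place.\<close>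

lemma (in prob_space) tendsto_prob_Int_sigma_sets:
  assumes G: "Int_stable G" "G \<subseteq> Pow (space M)" "sigma_sets (space M) G = events"
    and T: "\<And>k. T k \<in> events" "(\<lambda>k. prob (T k)) \<longlonglongrightarrow> c"
    and basic: "\<And>A. A \<in> G \<Longrightarrow> (\<lambda>k. prob (A \<inter> T k)) \<longlonglongrightarrow> prob A * c"
    and A: "A \<in> events"
  shows "(\<lambda>k. prob (A \<inter> T k)) \<longlonglongrightarrow> prob A * c"
proof -
  have "A \<in> sigma_sets (space M) G" using A G(3) by simp
  with G(1,2) show ?thesis
  proof (induction rule: sigma_sets_induct_disjoint)
    case (basic A)
    then show ?case by (rule assms(6))
  next
    case empty
    then show ?case by simp
  next
    case (compl A)
    then have [measurable]: "A \<in> events" using G(3) by simp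
    have "prob ((space M - A) \<inter> T k) = prob (T k) - prob (A \<inter> T k)" for k
    proof -
      have "(space M - A) \<inter> T k = T k - A \<inter> T k" using sets.sets_into_space[OF T(1)] by auto
      then show ?thesis using T(1) by (simp add: finite_measure_Diff)
    qed
    moreover have "prob (space M - A) * c = c - prob A * c" by (simp add: prob_compl left_diff_distrib)
    ultimately show ?case using tendsto_diff[OF T(2) compl(2)] by simp
  next
    case (union A)
    then have A: "A i \<in> events" for i using G(3) by auto
    have sums: "(\<lambda>i. prob (A i)) sums prob (\<Union>i. A i)"
      using A union(1) by (intro finite_measure_UNION) auto
    have sums': "(\<lambda>i. prob (A i \<inter> T k)) sums prob ((\<Union>i. A i) \<inter> T k)" for k
    proof -
      have "(\<lambda>i. prob (A i \<inter> T k)) sums prob (\<Union>i. A i \<inter> T k)"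
      proof (rule finite_measure_UNION)
        show "range (\<lambda>i. A i \<inter> T k) \<subseteq> events" using A T(1) by auto
        show "disjoint_family (\<lambda>i. A i \<inter> T k)"
          using union(1) unfolding disjoint_family_on_def by blast
      qed
      also have "(\<Union>i. A i \<inter> T k) = (\<Union>i. A i) \<inter> T k" by blast
      finally show ?thesis .
    qed
    have "(\<lambda>k. \<Sum>i. prob (A i \<inter> T k)) \<longlonglongrightarrow> (\<Sum>i. prob (A i) * c)"
    proof (rule tannerys_theorem[THEN conjunct2, THEN conjunct2])
      show "\<And>i. (\<lambda>k. prob (A i \<inter> T k)) \<longlonglongrightarrow> prob (A i) * c" by (rule union(3))
      show "summable (\<lambda>i. prob (A i))" using sums by (rule sums_summable)
      show "\<forall>\<^sub>F (i, k) in at_top \<times>\<^sub>F sequentially. norm (prob (A i \<inter> T k)) \<le> prob (A i)"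
        using A by (intro always_eventually) (auto intro!: finite_measure_mono)
    qed simp
    then show ?case
      using sums' sums sums_mult2[OF sums, of c] by (simp add: sums_iff)
  qed
qed

text \<open>For two cylinders the coordinates involved are disjoint once \<open>k\<close> is large,
  and then the product formula is exact. General sets are reached in one factor at a time.\<close>

lemma clocks_mixing:
  assumes A: "A \<in> sets clock_space" and B: "B \<in> sets clock_space"
  shows "(\<lambda>k. measure (clocks_law p) (A \<inter> shift_clocks (int k) -` B))
    \<longlonglongrightarrow> measure (clocks_law p) A * measure (clocks_law p) B"
proof -
  let ?P = "clocks_law p"
  interpret P: prob_space ?P by (rule prob_space_clocks_law)
  let ?N = "borel \<Otimes>\<^sub>M count_space UNIV :: (real \<times> bool) measure"
  let ?G = "prod_algebra UNIV (\<lambda>_ :: int \<times> nat. ?N)"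
  have G: "Int_stable ?G" "?G \<subseteq> Pow (space ?P)" "sigma_sets (space ?P) ?G = P.events"
    using sets_PiM[of UNIV "\<lambda>_ :: int \<times> nat. ?N"]
    by (auto simp: Int_stable_prod_algebra sets_clocks_law space_pair_measure)
  have sh_sets: "shift_clocks n -` X \<in> P.events" if "X \<in> sets clock_space" for n X
  proof -
    have "shift_clocks n -` X \<inter> space clock_space \<in> sets clock_space"
      using that by measurable
    then show ?thesis by (simp add: sets_clocks_law)
  qed
  have sh_prob: "P.prob (shift_clocks n -` X) = P.prob X" if "X \<in> sets clock_space" for n X
  proof -
    have "P.prob X = measure (distr ?P ?P (shift_clocks n)) X" by (simp add: distr_shift_clocks)
    also have "\<dots> = P.prob (shift_clocks n -` X)"
      using that by (subst measure_distr) (simp_all add: measurable_clocks_law_cong sets_clocks_law)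
    finally show ?thesis by simp
  qed
  have cyl: "\<exists>J E. finite J \<and> (\<forall>i\<in>J. E i \<in> sets ?N) \<and> X = {\<omega>. \<forall>i\<in>J. \<omega> i \<in> E i}" if X: "X \<in> ?G" for X
  proof -
    obtain J E where J: "X = prod_emb UNIV (\<lambda>_. ?N) J (Pi\<^sub>E J E)" "finite J" "\<And>i. i \<in> J \<Longrightarrow> E i \<in> sets ?N"
      using X by (rule prod_algebraE) blast
    have "X = {\<omega>. \<forall>i\<in>J. \<omega> i \<in> E i}"
      unfolding J(1) by (auto simp: prod_emb_def PiE_iff space_pair_measure)
    then show ?thesis using J(2,3) by blast
  qed
  have cyl_prob: "P.prob {\<omega>. \<forall>i\<in>J. \<omega> i \<in> E i} = (\<Prod>i\<in>J. measure (mark_law p) (E i))"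
    if "finite J" "\<And>i. i \<in> J \<Longrightarrow> E i \<in> sets ?N" for J E
  proof -
    interpret m: prob_space "mark_law p" by (rule prob_space_mark_law)
    show ?thesis
      using emeasure_clocks_law_box[OF that, where p = p]
      by (simp add: m.emeasure_eq_measure prod_ennreal measure_def[of ?P] prod_nonneg)
  qed
  have basic: "(\<lambda>k. P.prob (X \<inter> shift_clocks (int k) -` Y)) \<longlonglongrightarrow> P.prob X * P.prob Y"
    if X: "X \<in> ?G" and Y: "Y \<in> ?G" for X Y
  proof -
    obtain J E where J: "finite J" "\<And>i. i \<in> J \<Longrightarrow> E i \<in> sets ?N" "X = {\<omega>. \<forall>i\<in>J. \<omega> i \<in> E i}"
      using cyl[OF X] by blast
    obtain K F where K: "finite K" "\<And>i. i \<in> K \<Longrightarrow> F i \<in> sets ?N" "Y = {\<omega>. \<forall>i\<in>K. \<omega> i \<in> F i}"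
      using cyl[OF Y] by blast
    have "\<forall>\<^sub>F k in sequentially. int k \<noteq> fst i - fst j" for i j :: "int \<times> nat"
      using eventually_gt_at_top[of "nat \<bar>fst i - fst j\<bar>"] by eventually_elim auto
    then have "\<forall>\<^sub>F k in sequentially. \<forall>i\<in>J. \<forall>j\<in>K. int k \<noteq> fst i - fst j"
      using J(1) K(1) by (simp add: eventually_ball_finite_distrib)
    then have "\<forall>\<^sub>F k in sequentially. P.prob (X \<inter> shift_clocks (int k) -` Y) = P.prob X * P.prob Y"
    proof eventually_elim
      case (elim k)
      let ?s = "\<lambda>j :: int \<times> nat. (fst j + int k, snd j)" and ?r = "\<lambda>j :: int \<times> nat. (fst j - int k, snd j)"
      have inj: "inj_on ?s K" by (auto simp: inj_on_def prod_eq_iff)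
      have disj: "J \<inter> ?s ` K = {}" using elim by force
      define H where "H i = (if i \<in> J then E i else F (?r i))" for i
      have H: "H (?s j) = F j" if "j \<in> K" for j using disj that by (auto simp: H_def)
      have HJ: "H i = E i" if "i \<in> J" for i using that by (simp add: H_def)
      have "(\<forall>i\<in>J \<union> ?s ` K. \<omega> i \<in> H i) \<longleftrightarrow> (\<forall>i\<in>J. \<omega> i \<in> E i) \<and> (\<forall>j\<in>K. \<omega> (?s j) \<in> F j)" for \<omega>
      proof -
        have "(\<forall>i\<in>?s ` K. \<omega> i \<in> H i) \<longleftrightarrow> (\<forall>j\<in>K. \<omega> (?s j) \<in> F j)" using H by fast
        moreover have "(\<forall>i\<in>J. \<omega> i \<in> H i) \<longleftrightarrow> (\<forall>i\<in>J. \<omega> i \<in> E i)" using HJ by fast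
        ultimately show ?thesis unfolding ball_Un by (simp only:)
      qed
      then have "X \<inter> shift_clocks (int k) -` Y = {\<omega>. \<forall>i\<in>J \<union> ?s ` K. \<omega> i \<in> H i}"
        unfolding J(3) K(3) by (auto simp: shift_clocks_def)
      then have "P.prob (X \<inter> shift_clocks (int k) -` Y) = (\<Prod>i\<in>J \<union> ?s ` K. measure (mark_law p) (H i))"
        using J K H by (simp only:) (rule cyl_prob, auto simp: H_def)
      also have "\<dots> = (\<Prod>i\<in>J. measure (mark_law p) (H i)) * (\<Prod>i\<in>?s ` K. measure (mark_law p) (H i))"
        using J(1) K(1) disj by (intro prod.union_disjoint) auto
      also have "(\<Prod>i\<in>J. measure (mark_law p) (H i)) = P.prob X"
        using J by (simp add: cyl_prob H_def)
      also have "(\<Prod>i\<in>?s ` K. measure (mark_law p) (H i)) = P.prob Y"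
        using K H by (subst prod.reindex[OF inj]) (simp add: cyl_prob)
      finally show ?case .
    qed
    then show ?thesis by (rule tendsto_eventually)
  qed
  have Gsets: "X \<in> sets clock_space" if "X \<in> ?G" for X
    using that G(3) by (metis sets_clocks_law sigma_sets.Basic)
  have half: "(\<lambda>k. P.prob (A \<inter> shift_clocks (int k) -` Y)) \<longlonglongrightarrow> P.prob A * P.prob Y"
    if A: "A \<in> sets clock_space" and Y: "Y \<in> ?G" for A Y
  proof (rule P.tendsto_prob_Int_sigma_sets[OF G])
    show "shift_clocks (int k) -` Y \<in> P.events" for k by (rule sh_sets[OF Gsets[OF Y]])
    show "(\<lambda>k. P.prob (shift_clocks (int k) -` Y)) \<longlonglongrightarrow> P.prob Y" by (simp add: sh_prob[OF Gsets[OF Y]])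
  qed (use A basic[OF _ Y] in \<open>simp_all add: sets_clocks_law\<close>)
  \<comment> \<open>By invariance of the law the shift moves to the other set with opposite sign;
    the extension already made in the first factor then serves as the basic case for the
    second.\<close>
  have swap: "P.prob (shift_clocks (- int k) -` A \<inter> Y) = P.prob (A \<inter> shift_clocks (int k) -` Y)"
    if Y: "Y \<in> sets clock_space" for k Y
  proof -
    have "shift_clocks (- int k) -` A \<inter> Y \<in> sets clock_space"
      using sh_sets[OF A] Y by (auto simp: sets_clocks_law)
    note sh_prob[OF this, of "int k"]
    moreover have "shift_clocks (int k) -` (shift_clocks (- int k) -` A \<inter> Y) = A \<inter> shift_clocks (int k) -` Y"
      by (auto simp: shift_clocks_add)
    ultimately show ?thesis by (simp only:)
  qed
  have "(\<lambda>k. P.prob (B \<inter> shift_clocks (- int k) -` A)) \<longlonglongrightarrow> P.prob B * P.prob A"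
  proof (rule P.tendsto_prob_Int_sigma_sets[OF G])
    show "shift_clocks (- int k) -` A \<in> P.events" for k by (rule sh_sets[OF A])
    show "(\<lambda>k. P.prob (shift_clocks (- int k) -` A)) \<longlonglongrightarrow> P.prob A" by (simp add: sh_prob[OF A])
    show "(\<lambda>k. P.prob (Y \<inter> shift_clocks (- int k) -` A)) \<longlonglongrightarrow> P.prob Y * P.prob A" if "Y \<in> ?G" for Y
      using half[OF A that] swap[OF Gsets[OF that]] by (simp add: Int_commute mult.commute)
  qed (use B in \<open>simp add: sets_clocks_law\<close>)
  then show ?thesis using swap[OF B] by (simp add: Int_commute mult.commute)
qed

subsection \<open>Particle positions in infinite volume\<close>

text \<open>Defined from the clocks alone, so that it is measurable and can be composed with shifts.
  For the clocks that matter the sequence is eventually constant; limit and floor only extract its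
  final value by measurable operations.\<close>

definition pos :: "real \<Rightarrow> clocks \<Rightarrow> int \<Rightarrow> int" where
  "pos t \<omega> m = \<lfloor>lim (\<lambda>L. real_of_int (positions (window L) t \<omega> m))\<rfloor>"

lemma measurable_pos: "(\<lambda>\<omega>. pos t \<omega> m) \<in> measurable clock_space (count_space UNIV)"
proof -
  have "(\<lambda>\<omega>. real_of_int (positions (window L) t \<omega> m)) \<in> borel_measurable clock_space" for L
    by (rule measurable_compose[OF measurable_positions]) simp_all
  then have "(\<lambda>\<omega>. lim (\<lambda>L. real_of_int (positions (window L) t \<omega> m))) \<in> borel_measurable clock_space"
    by (rule borel_measurable_lim_metric)
  then show ?thesis unfolding pos_def by (rule measurable_compose) (rule measurable_real_floor)
qed

lemma pos_eqI:
  assumes "\<And>L. L0 \<le> L \<Longrightarrow> positions (window L) t \<omega> m = j"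
  shows "pos t \<omega> m = j"
proof -
  have "\<forall>\<^sub>F L in sequentially. real_of_int (positions (window L) t \<omega> m) = real_of_int j"
    using eventually_ge_at_top[of L0] by eventually_elim (simp add: assms)
  then have "(\<lambda>L. real_of_int (positions (window L) t \<omega> m)) \<longlonglongrightarrow> real_of_int j"
    by (rule tendsto_eventually)
  then show ?thesis unfolding pos_def by (simp add: limI)
qed

lemma pos_label_path:
  assumes "good_clocks \<omega>" "label_path \<omega> y" "0 \<le> t"
  shows "pos t \<omega> m = (THE j. y t j = real_of_int m)"
proof -
  obtain L0 where "\<And>L. L0 \<le> L \<Longrightarrow> separated L (nat \<bar>m\<bar>) t \<omega>"
    using good_clocks_separated[OF assms(1)] by blast
  then show ?thesis
    by (intro pos_eqI[of L0] label_path_the[OF assms, of _ "nat \<bar>m\<bar>" m, symmetric]) simp_all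
qed

definition local_on :: "nat \<Rightarrow> ((int \<Rightarrow> int) \<Rightarrow> real) \<Rightarrow> bool" where
  "local_on k F \<longleftrightarrow> (\<forall>\<pi> \<pi>'. (\<forall>m. \<bar>m\<bar> \<le> int k \<longrightarrow> \<pi> m = \<pi>' m) \<longrightarrow> F \<pi> = F \<pi>')"

lemma local_onD: "local_on k F \<Longrightarrow> (\<And>m. \<bar>m\<bar> \<le> int k \<Longrightarrow> \<pi> m = \<pi>' m) \<Longrightarrow> F \<pi> = F \<pi>'"
  unfolding local_on_def by blast

text \<open>A local function reads finitely many positions, collected here in a list. Lists of
  integers form a countable type, on which every function is measurable.\<close>

lemma measurable_local_on:
  assumes "local_on k F"
  shows "(\<lambda>\<omega>. F (pos t \<omega>)) \<in> borel_measurable clock_space"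
proof -
  let ?I = "[- int k..int k]"
  define G where "G l = F (\<lambda>m. l ! nat (m + int k))" for l
  have "(\<lambda>\<omega>. map (pos t \<omega>) xs) \<in> measurable clock_space (count_space UNIV)" for xs
  proof (induction xs)
    case (Cons x xs)
    have "(\<lambda>\<omega>. (pos t \<omega> x, map (pos t \<omega>) xs)) \<in> measurable clock_space (count_space UNIV \<Otimes>\<^sub>M count_space UNIV)"
      by (rule measurable_Pair[OF measurable_pos Cons])
    then have "(\<lambda>\<omega>. (pos t \<omega> x, map (pos t \<omega>) xs)) \<in> measurable clock_space (count_space UNIV)"
      by (simp add: pair_measure_countable)
    then have "(\<lambda>\<omega>. (\<lambda>(a, l). a # l) (pos t \<omega> x, map (pos t \<omega>) xs)) \<in> measurable clock_space (count_space UNIV)"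
      by (rule measurable_compose) simp
    then show ?case by simp
  qed simp
  then have "(\<lambda>\<omega>. G (map (pos t \<omega>) ?I)) \<in> borel_measurable clock_space"
    by (rule measurable_compose) simp
  moreover have "G (map (pos t \<omega>) ?I) = F (pos t \<omega>)" for \<omega>
    unfolding G_def by (rule local_onD[OF assms]) (simp add: nth_upto abs_le_iff)
  ultimately show ?thesis by simp
qed

lemma act_outside_window:
  assumes "local_on k F" "n \<notin> window (Suc k)"
  shows "F (act (n, b) \<pi>) = F \<pi>"
  using assms(2) by (intro local_onD[OF assms(1)] act_other) auto

text \<open>Only edges with an end point in \<open>{-k..k}\<close>, that is \<open>-k - 1\<close> to
  \<open>k\<close>, can change the observed values; larger windows add zero terms.\<close>

lemma gen_window:
  assumes "local_on k F" "Suc k \<le> L"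
  shows "gen (window L) p F = gen (window (Suc k)) p F"
  unfolding gen_def using assms(2)
  by (intro ext sum.mono_neutral_right) (auto simp: act_outside_window[OF assms(1)])

lemma local_on_gen:
  assumes "local_on k F"
  shows "local_on (Suc k) (gen (window (Suc k)) p F)"
  unfolding local_on_def
proof (intro allI impI)
  fix \<pi> \<pi>' :: "int \<Rightarrow> int"
  assume eq: "\<forall>m. \<bar>m\<bar> \<le> int (Suc k) \<longrightarrow> \<pi> m = \<pi>' m"
  have "F (act (n, b) \<pi>) = F (act (n, b) \<pi>')" if "n \<in> window (Suc k)" for n b
    using eq that by (intro local_onD[OF assms]) (auto simp: act_def Transposition.transpose_def)
  moreover have "F \<pi> = F \<pi>'" using eq by (intro local_onD[OF assms]) auto
  ultimately show "gen (window (Suc k)) p F \<pi> = gen (window (Suc k)) p F \<pi>'"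
    unfolding gen_def by simp
qed

lemma abs_gen_le:
  assumes "0 \<le> p" "p \<le> 1" "\<And>\<pi>. \<bar>F \<pi>\<bar> \<le> B"
  shows "\<bar>gen E p F \<pi>\<bar> \<le> 2 * real (card E) * B"
proof -
  have "\<bar>gen E p F \<pi>\<bar> \<le> \<bar>step_op E p F \<pi>\<bar> + real (card E) * \<bar>F \<pi>\<bar>"
    unfolding gen_step_op by (rule order_trans[OF abs_triangle_ineq4]) (simp add: abs_mult)
  also have "\<dots> \<le> real (card E) * B + real (card E) * B"
    by (intro add_mono abs_step_op_le mult_left_mono assms) simp
  also have "\<dots> = 2 * real (card E) * B" by simp
  finally show ?thesis .
qed

text \<open>Replaces a function defined through unguarded limits by a measurable version: in the
  completion, a change on a null set affects neither measurability nor law.\<close>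

lemma (in prob_space) distr_completion_AE:
  assumes X: "X \<in> measurable M borel" and eq: "AE \<omega> in M. Y \<omega> = X \<omega>"
  shows "distr (completion M) borel Y = distr M borel X"
proof -
  have eq': "AE \<omega> in completion M. Y \<omega> = X \<omega>" using eq by (rule AE_completion)
  have X': "X \<in> measurable (completion M) borel" using X by (rule measurable_completion)
  have vimage: "Y -` S \<inter> space M \<in> sets (completion M)" if "S \<in> sets borel" for S
  proof (rule completion.in_sets_AE)
    show "AE \<omega> in completion M. \<omega> \<in> X -` S \<inter> space M \<longleftrightarrow> \<omega> \<in> Y -` S \<inter> space M"
      using eq' by eventually_elim auto
    show "X -` S \<inter> space M \<in> sets (completion M)"
      using measurable_sets[OF X' that] by simp
  qed auto
  then have Y': "Y \<in> measurable (completion M) borel" by (intro measurableI) (simp_all add: vimage)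
  have "distr (completion M) borel Y = distr (completion M) borel X"
    by (rule distr_cong_AE[OF refl refl eq' Y' X'])
  also have "\<dots> = distr M borel X" using X by (rule distr_completion)
  finally show ?thesis .
qed

section \<open>Comparison of the line with its windows\<close>

locale labelled_asep = multi_type_asep M p gap coin real_of_int Y
  for M :: "'w measure" and p :: real
    and gap :: "int \<Rightarrow> nat \<Rightarrow> 'w \<Rightarrow> real" and coin :: "int \<Rightarrow> nat \<Rightarrow> 'w \<Rightarrow> bool"
    and Y :: "real \<Rightarrow> 'w \<Rightarrow> int \<Rightarrow> real" +
  assumes p01: "0 \<le> p" "p \<le> 1"
begin

definition clk :: "'w \<Rightarrow> clocks" where
  "clk \<omega> i = (gap (fst i) (snd i) \<omega>, coin (fst i) (snd i) \<omega>)"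

lemma clk_props: "clk \<in> measurable M clock_space" "distr M clock_space clk = clocks_law p"
proof -
  let ?N = "borel \<Otimes>\<^sub>M count_space UNIV :: (real \<times> bool) measure"
  let ?X = "\<lambda>(n, k) \<omega>. (gap n k \<omega>, coin n k \<omega>)"
  have rv: "random_variable ?N (?X i)" for i
    using clock_indep unfolding indep_vars_def by blast
  have clk: "clk = (\<lambda>\<omega>. \<lambda>i\<in>UNIV. ?X i \<omega>)" by (simp add: fun_eq_iff clk_def split_def)
  show "clk \<in> measurable M clock_space"
    unfolding clk by (rule measurable_restrict) (rule rv)
  have "distr M clock_space clk = (\<Pi>\<^sub>M i\<in>UNIV. distr M ?N (?X i))"
    unfolding clk using clock_indep indep_vars_iff_distr_eq_PiM[where I = UNIV and M' = "\<lambda>_. ?N" and X = ?X] rv by simp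
  also have "\<dots> = clocks_law p"
    using clock_law unfolding clocks_law_def mark_law_def by (intro PiM_cong) auto
  finally show "distr M clock_space clk = clocks_law p" .
qed

lemma measurable_clk [measurable]: "clk \<in> measurable M clock_space"
  by (rule clk_props)

lemma distr_shift_clk: "distr M clock_space (\<lambda>\<omega>. shift_clocks n (clk \<omega>)) = clocks_law p"
proof -
  have "distr M clock_space (\<lambda>\<omega>. shift_clocks n (clk \<omega>)) = distr (distr M clock_space clk) clock_space (shift_clocks n)"
    by (subst distr_distr) (simp_all add: comp_def)
  also have "\<dots> = distr (clocks_law p) (clocks_law p) (shift_clocks n)"
    unfolding clk_props by (rule distr_cong) (simp_all add: sets_clocks_law)
  finally show ?thesis by (simp add: distr_shift_clocks)
qed

lemma AE_shift_clk: "AE \<omega> in clocks_law p. P \<omega> \<Longrightarrow> AE \<omega> in M. P (shift_clocks n (clk \<omega>))"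
proof -
  assume "AE \<omega> in clocks_law p. P \<omega>"
  then have "AE \<omega> in distr M clock_space (\<lambda>\<omega>. shift_clocks n (clk \<omega>)). P \<omega>"
    by (simp only: distr_shift_clk)
  moreover have "(\<lambda>\<omega>. shift_clocks n (clk \<omega>)) \<in> measurable M clock_space" by measurable
  ultimately show ?thesis by (rule AE_distrD[rotated])
qed

lemma expectation_shift_clk:
  fixes g :: "_ \<Rightarrow> real"
  assumes "g \<in> borel_measurable clock_space"
  shows "expectation (\<lambda>\<omega>. g (shift_clocks n (clk \<omega>))) = (\<integral>\<omega>. g \<omega> \<partial>clocks_law p)"
proof -
  have "(\<lambda>\<omega>. shift_clocks n (clk \<omega>)) \<in> measurable M clock_space" by measurable
  from integral_distr[OF this assms] show ?thesis by (simp only: distr_shift_clk)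
qed

lemma expectation_clk:
  fixes g :: "_ \<Rightarrow> real"
  assumes "g \<in> borel_measurable clock_space"
  shows "expectation (\<lambda>\<omega>. g (clk \<omega>)) = (\<integral>\<omega>. g \<omega> \<partial>clocks_law p)"
  using expectation_shift_clk[OF assms, of 0] by simp

abbreviation X :: "real \<Rightarrow> 'w \<Rightarrow> int \<Rightarrow> int" where
  "X t \<omega> \<equiv> pos t (clk \<omega>)"

text \<open>Every translate of the clocks is required to be good, at the price of countably many
  null sets, so that \<open>regular_shift\<close> holds for all \<open>n\<close> at once.\<close>

definition regular :: "'w \<Rightarrow> bool" where
  "regular \<omega> \<longleftrightarrow> (\<forall>n. good_clocks (shift_clocks n (clk \<omega>))) \<and> label_path (clk \<omega>) (\<lambda>t. Y t \<omega>)"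

lemma AE_regular: "AE \<omega> in M. regular \<omega>"
proof -
  have "AE \<omega> in M. \<forall>n. good_clocks (shift_clocks n (clk \<omega>))"
    unfolding AE_all_countable by (intro allI AE_shift_clk AE_good_clocks p01)
  moreover have "ring_at (clk \<omega>) = ring_time gap \<omega>" for \<omega>
    by (simp add: fun_eq_iff ring_at_def ring_time_def clk_def)
  then have "AE \<omega> in M. label_path (clk \<omega>) (\<lambda>t. Y t \<omega>)"
    using Y_path by (simp add: label_path_def clk_def)
  ultimately show ?thesis unfolding regular_def by eventually_elim blast
qed

lemma regular_good: "regular \<omega> \<Longrightarrow> good_clocks (clk \<omega>)"
  unfolding regular_def by (metis shift_clocks_0)

lemma regular_position:
  "regular \<omega> \<Longrightarrow> 0 \<le> t \<Longrightarrow> asep_position Y m t \<omega> = X t \<omega> m"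
  unfolding asep_position_def
  by (subst pos_label_path[OF regular_good, of \<omega> "\<lambda>t. Y t \<omega>"]) (simp_all add: regular_def)

text \<open>Equivariance under translation: by this identity the speed of particle \<open>n\<close>
  is the speed of particle 0 for the shifted clocks.\<close>

lemma regular_shift:
  assumes "regular \<omega>" "0 \<le> t"
  shows "pos t (shift_clocks n (clk \<omega>)) m = X t \<omega> (m + n) - n"
proof -
  have path: "label_path (clk \<omega>) (\<lambda>t. Y t \<omega>)" using assms by (simp add: regular_def)
  have "pos t (shift_clocks n (clk \<omega>)) m = (THE j. Y t \<omega> (j + n) - real_of_int n = real_of_int m)"
    using assms by (intro pos_label_path label_path_shift[OF path]) (simp_all add: regular_def)
  also have "\<dots> = (THE j. Y t \<omega> j = real_of_int (m + n)) - n"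
    by (rule label_path_shift_the[OF regular_good[OF assms(1)] path assms(2)])
  also have "(THE j. Y t \<omega> j = real_of_int (m + n)) = X t \<omega> (m + n)"
    by (rule pos_label_path[OF regular_good[OF assms(1)] path assms(2), symmetric])
  finally show ?thesis .
qed

lemma regular_separated:
  assumes "regular \<omega>" "0 \<le> t" "separated L k t (clk \<omega>)" "\<bar>m\<bar> \<le> int k"
  shows "positions (window L) t (clk \<omega>) m = X t \<omega> m"
proof -
  have path: "label_path (clk \<omega>) (\<lambda>t. Y t \<omega>)" using assms by (simp add: regular_def)
  show ?thesis
    unfolding pos_label_path[OF regular_good[OF assms(1)] path assms(2)]
    by (rule label_path_the[OF regular_good[OF assms(1)] path assms(2-4), symmetric])
qed

lemma regular_right_cont:
  assumes "regular \<omega>" "0 \<le> t"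
  shows "\<exists>\<epsilon>>0. \<forall>t'\<in>{t..<t + \<epsilon>}. pos t' (clk \<omega>) m = X t \<omega> m"
proof -
  have path: "label_path (clk \<omega>) (\<lambda>t. Y t \<omega>)" using assms by (simp add: regular_def)
  note the = pos_label_path[OF regular_good[OF assms(1)] path]
  obtain \<epsilon> where \<epsilon>: "\<epsilon> > 0" "\<And>t'. t' \<in> {t..<t + \<epsilon>} \<Longrightarrow> (THE j. Y t' \<omega> j = real_of_int m) = (THE j. Y t \<omega> j = real_of_int m)"
    using label_path_right_cont[OF regular_good[OF assms(1)] path assms(2)] by blast
  have "pos t' (clk \<omega>) m = X t \<omega> m" if "t' \<in> {t..<t + \<epsilon>}" for t'
  proof -
    have "0 \<le> t'" using that assms(2) by simp
    show ?thesis unfolding the[OF \<open>0 \<le> t'\<close>] the[OF assms(2)] by (rule \<epsilon>(2)[OF that])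
  qed
  then show ?thesis using \<epsilon>(1) by blast
qed

definition escape :: "nat \<Rightarrow> nat \<Rightarrow> real \<Rightarrow> real" where
  "escape L k t = expectation (\<lambda>\<omega>. of_bool (\<not> separated L k t (clk \<omega>)))"

lemma measurable_separated [measurable]: "Measurable.pred clock_space (separated L k t)"
  unfolding separated_def by measurable

lemma escape_tendsto: "(\<lambda>L. escape L k t) \<longlonglongrightarrow> 0"
proof -
  have "(\<lambda>L. expectation (\<lambda>\<omega>. of_bool (\<not> separated L k t (clk \<omega>)) :: real)) \<longlonglongrightarrow> expectation (\<lambda>\<omega>. 0)"
  proof (rule integral_dominated_convergence[where w = "\<lambda>_. 1"])
    show "AE \<omega> in M. (\<lambda>L. of_bool (\<not> separated L k t (clk \<omega>)) :: real) \<longlonglongrightarrow> 0"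
      using AE_regular
    proof eventually_elim
      case (elim \<omega>)
      obtain L0 where L0: "\<And>L. L0 \<le> L \<Longrightarrow> separated L k t (clk \<omega>)"
        using good_clocks_separated[OF regular_good[OF elim]] by blast
      have "\<forall>\<^sub>F L in sequentially. (of_bool (\<not> separated L k t (clk \<omega>)) :: real) = 0"
        using eventually_ge_at_top[of L0] by eventually_elim (simp add: L0)
      then show ?case by (rule tendsto_eventually)
    qed
  qed auto
  then show ?thesis by (simp add: escape_def)
qed

text \<open>Window and line can differ only if the silent edges fail, and then by at most
  \<open>2 * B\<close>. Separation until \<open>t\<close> implies separation until every earlier
  \<open>s\<close>, so the bound is uniform in \<open>s\<close>; this matters because the
  intermediate time of the mean value depends on the window.\<close>

lemma expectation_truncate:
  assumes F: "local_on k F" "\<And>\<pi>. \<bar>F \<pi>\<bar> \<le> B" and st: "0 \<le> s" "s \<le> t"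
  shows "\<bar>expectation (\<lambda>\<omega>. F (X s \<omega>)) - (\<integral>\<omega>. F (positions (window L) s \<omega>) \<partial>clocks_law p)\<bar>
    \<le> 2 * B * escape L k t"
proof -
  let ?f = "\<lambda>\<omega>. F (X s \<omega>)" and ?g = "\<lambda>\<omega>. F (positions (window L) s (clk \<omega>))"
  have g': "(\<lambda>\<omega>. F (positions (window L) s \<omega>)) \<in> borel_measurable clock_space"
    by (rule measurable_compose[OF measurable_positions]) simp_all
  have f: "integrable M ?f"
    using F(2) measurable_compose[OF measurable_clk measurable_local_on[OF F(1)]]
    by (intro integrable_const_bound[of _ B]) auto
  have g: "integrable M ?g"
    using F(2) measurable_compose[OF measurable_clk g']
    by (intro integrable_const_bound[of _ B]) auto
  have B: "0 \<le> B" using F(2)[of id] by linarith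
  have "\<bar>expectation ?f - expectation ?g\<bar> = \<bar>expectation (\<lambda>\<omega>. ?f \<omega> - ?g \<omega>)\<bar>"
    using f g by (simp add: Bochner_Integration.integral_diff)
  also have "\<dots> \<le> expectation (\<lambda>\<omega>. \<bar>?f \<omega> - ?g \<omega>\<bar>)" by (rule integral_abs_bound)
  also have "\<dots> \<le> expectation (\<lambda>\<omega>. 2 * B * of_bool (\<not> separated L k t (clk \<omega>)))"
  proof (rule integral_mono_AE)
    show "integrable M (\<lambda>\<omega>. \<bar>?f \<omega> - ?g \<omega>\<bar>)" using f g by auto
    show "integrable M (\<lambda>\<omega>. 2 * B * of_bool (\<not> separated L k t (clk \<omega>)))"
      using B by (intro integrable_const_bound[of _ "2 * B"]) auto
    show "AE \<omega> in M. \<bar>?f \<omega> - ?g \<omega>\<bar> \<le> 2 * B * of_bool (\<not> separated L k t (clk \<omega>))"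
      using AE_regular
    proof eventually_elim
      case (elim \<omega>)
      show ?case
      proof (cases "separated L k t (clk \<omega>)")
        case True
        then have "?f \<omega> = ?g \<omega>"
          using regular_separated[OF elim st(1) separated_mono[OF True st(2)]]
          by (intro local_onD[OF F(1)]) simp
        then show ?thesis using B by simp
      next
        case False
        then show ?thesis using F(2)[of "X s \<omega>"] F(2)[of "positions (window L) s (clk \<omega>)"] by simp
      qed
    qed
  qed
  also have "\<dots> = 2 * B * escape L k t" by (simp add: escape_def)
  finally show ?thesis unfolding expectation_clk[OF g'] .
qed

text \<open>The window is fixed from \<epsilon> before the intermediate time is known, which is
  possible because the truncation errors at all times up to \<open>t\<close> are bounded through
  \<open>escape\<close> at \<open>t\<close>. The term with \<open>4 * B\<close> collects two errors
  of the test function, the term with \<open>2 * C\<close> the error of its generator.\<close>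

lemma mean_value:
  assumes F: "local_on k F" "\<And>\<pi>. \<bar>F \<pi>\<bar> \<le> B" and st: "0 \<le> s" "s < t" and "0 < \<epsilon>"
  obtains \<xi> where "s < \<xi>" "\<xi> < t"
    "\<bar>expectation (\<lambda>\<omega>. F (X t \<omega>)) - expectation (\<lambda>\<omega>. F (X s \<omega>))
      - (t - s) * expectation (\<lambda>\<omega>. gen (window (Suc k)) p F (X \<xi> \<omega>))\<bar> \<le> \<epsilon>"
proof -
  define C where "C = 2 * real (card (window (Suc k))) * B"
  have bd: "\<bar>gen (window (Suc k)) p F \<pi>\<bar> \<le> C" for \<pi>
    unfolding C_def by (rule abs_gen_le[OF p01 F(2)])
  have "(\<lambda>L. 4 * B * escape L k t + (t - s) * (2 * C * escape L (Suc k) t)) \<longlonglongrightarrow> 4 * B * 0 + (t - s) * (2 * C * 0)"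
    by (intro tendsto_intros escape_tendsto)
  then have "\<forall>\<^sub>F L in sequentially. 4 * B * escape L k t + (t - s) * (2 * C * escape L (Suc k) t) < \<epsilon>"
    using \<open>0 < \<epsilon>\<close> by (auto dest: order_tendstoD(2))
  then have "\<forall>\<^sub>F L in sequentially. 4 * B * escape L k t + (t - s) * (2 * C * escape L (Suc k) t) < \<epsilon> \<and> Suc k \<le> L"
    using eventually_ge_at_top[of "Suc k"] by (rule eventually_conj)
  then obtain L where L: "4 * B * escape L k t + (t - s) * (2 * C * escape L (Suc k) t) < \<epsilon>" "Suc k \<le> L"
    by (auto dest: eventually_happens)
  let ?E = "\<lambda>F s. \<integral>\<omega>. F (positions (window L) s \<omega>) \<partial>clocks_law p"
  obtain \<xi> where \<xi>: "s < \<xi>" "\<xi> < t" "?E F t - ?E F s = (t - s) * ?E (gen (window L) p F) \<xi>"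
    using mean_value_positions[where F = F and E = "window L", OF p01 _ st F(2)] by blast
  have *: "?E F t - ?E F s = (t - s) * ?E (gen (window (Suc k)) p F) \<xi>"
    using \<xi>(3) unfolding gen_window[OF F(1) L(2)] .
  have 1: "\<bar>expectation (\<lambda>\<omega>. F (X t \<omega>)) - ?E F t\<bar> \<le> 2 * B * escape L k t"
    using st by (intro expectation_truncate F) auto
  have 2: "\<bar>expectation (\<lambda>\<omega>. F (X s \<omega>)) - ?E F s\<bar> \<le> 2 * B * escape L k t"
    using st by (intro expectation_truncate F) auto
  have 3: "\<bar>expectation (\<lambda>\<omega>. gen (window (Suc k)) p F (X \<xi> \<omega>)) - ?E (gen (window (Suc k)) p F) \<xi>\<bar>
      \<le> 2 * C * escape L (Suc k) t"
    using st \<xi> by (intro expectation_truncate local_on_gen F bd) auto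
  have 4: "\<bar>(t - s) * expectation (\<lambda>\<omega>. gen (window (Suc k)) p F (X \<xi> \<omega>)) - (t - s) * ?E (gen (window (Suc k)) p F) \<xi>\<bar>
      \<le> (t - s) * (2 * C * escape L (Suc k) t)"
    unfolding right_diff_distrib[symmetric] abs_mult using mult_left_mono[OF 3, of "t - s"] st by simp
  have lin: "\<bar>x - y - z\<bar> \<le> \<epsilon>"
    if "\<bar>x - x'\<bar> \<le> u" "\<bar>y - y'\<bar> \<le> u" "x' - y' = z'" "\<bar>z - z'\<bar> \<le> w" "2 * u + w < \<epsilon>"
    for x y z x' y' z' u w :: real using that by linarith
  show thesis
    by (rule that[OF \<xi>(1,2)], rule lin[OF 1 2 * 4]) (use L(1) in simp)
qed

end

subsection \<open>The speed process\<close>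

text \<open>Only integer times enter, which makes this measurable on all clocks; that it is also the
  limit along real times is a separate almost sure statement.\<close>

definition speed :: "clocks \<Rightarrow> real" where
  "speed \<omega> = lim (\<lambda>n. real_of_int (pos (real n) \<omega> 0) / real n)"

text \<open>
  Convergence to \<open>speed\<close> along the rationals; unlike convergence along the reals this is visibly a
  measurable event.
\<close>

definition has_speed :: "clocks \<Rightarrow> bool" where
  "has_speed \<omega> \<longleftrightarrow> (\<forall>j::nat. \<exists>N::nat. \<forall>q::rat. real N \<le> of_rat q \<longrightarrow>
     \<bar>real_of_int (pos (of_rat q) \<omega> 0) / of_rat q - speed \<omega>\<bar> < 1 / real (Suc j))"

lemma measurable_pos_real [measurable]:
  "(\<lambda>\<omega>. real_of_int (pos t \<omega> m)) \<in> borel_measurable clock_space"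
  by (rule measurable_compose[OF measurable_pos]) simp

lemma measurable_speed [measurable]: "speed \<in> borel_measurable clock_space"
  unfolding speed_def by measurable

lemma measurable_has_speed [measurable]: "Measurable.pred clock_space has_speed"
  unfolding has_speed_def by measurable

locale asep_speeds = labelled_asep M p gap coin Y
  for M :: "'w measure" and p :: real
    and gap :: "int \<Rightarrow> nat \<Rightarrow> 'w \<Rightarrow> real" and coin :: "int \<Rightarrow> nat \<Rightarrow> 'w \<Rightarrow> bool"
    and Y :: "real \<Rightarrow> 'w \<Rightarrow> int \<Rightarrow> real" +
  fixes \<rho> :: real
  assumes rho: "0 < \<rho>" "\<rho> \<le> 1"
    and speed_exists:
      "AE \<omega> in M. \<exists>u. ((\<lambda>t. real_of_int (asep_position Y 0 t \<omega>) / t) \<longlongrightarrow> u) at_top"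
    and speed_uniform: "speed_law M Y 0 = uniform_measure lborel {-\<rho>..\<rho>}"
begin

definition U :: "int \<Rightarrow> 'w \<Rightarrow> real" where
  "U m \<omega> = speed (shift_clocks m (clk \<omega>))"

lemma measurable_U [measurable]: "U m \<in> borel_measurable M"
  unfolding U_def by measurable

text \<open>The hypothesis concerns particle 0 on \<open>M\<close>. Expressed as a measurable event
  of the clocks it passes to their law, and from there, by shift invariance, to every other
  particle.\<close>

lemma AE_has_speed: "AE \<omega> in clocks_law p. has_speed \<omega>"
proof -
  have "AE \<omega> in M. has_speed (clk \<omega>)"
    using AE_regular speed_exists
  proof eventually_elim
    case (elim \<omega>)
    then obtain u where "((\<lambda>t. real_of_int (asep_position Y 0 t \<omega>) / t) \<longlongrightarrow> u) at_top" by blast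
    moreover have "\<forall>\<^sub>F t in at_top. real_of_int (asep_position Y 0 t \<omega>) / t = real_of_int (X t \<omega> 0) / t"
      using eventually_ge_at_top[of "0::real"]
      by eventually_elim (simp add: regular_position[OF elim(1)])
    ultimately have u: "((\<lambda>t. real_of_int (X t \<omega> 0) / t) \<longlongrightarrow> u) at_top"
      by (rule Lim_transform_eventually)
    have "(\<lambda>n. real_of_int (X (real n) \<omega> 0) / real n) \<longlonglongrightarrow> u"
      by (rule filterlim_compose[OF u filterlim_real_sequentially])
    then have speed: "speed (clk \<omega>) = u" unfolding speed_def by (rule limI)
    show ?case
      unfolding has_speed_def speed
    proof
      fix j :: nat
      have "\<forall>\<^sub>F t in at_top. dist (real_of_int (X t \<omega> 0) / t) u < 1 / real (Suc j)"
        by (rule tendstoD[OF u]) simp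
      then obtain b where b: "\<And>t. b \<le> t \<Longrightarrow> dist (real_of_int (X t \<omega> 0) / t) u < 1 / real (Suc j)"
        unfolding eventually_at_top_linorder by blast
      obtain N where "b \<le> real N" using real_arch_simple by blast
      then show "\<exists>N::nat. \<forall>q::rat. real N \<le> of_rat q \<longrightarrow>
          \<bar>real_of_int (X (of_rat q) \<omega> 0) / of_rat q - u\<bar> < 1 / real (Suc j)"
        using b by (intro exI[of _ N]) (auto simp: dist_real_def)
    qed
  qed
  moreover have "{\<omega> \<in> space clock_space. has_speed \<omega>} \<in> sets clock_space" by measurable
  ultimately have "AE \<omega> in distr M clock_space clk. has_speed \<omega>"
    by (subst AE_distr_iff) simp_all
  then show ?thesis by (simp only: clk_props(2))
qed

text \<open>A violation of the bound at a real time persists on a short interval to the right, as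
  \<open>X\<close> is constant there and division by the time is continuous, and this interval
  contains a rational time. The bound is taken with a weak inequality so that its violation is an
  open condition.\<close>

lemma tendsto_speed:
  assumes \<omega>: "regular \<omega>" and speed: "has_speed (shift_clocks m (clk \<omega>))"
  shows "((\<lambda>t. real_of_int (X t \<omega> m - m) / t) \<longlongrightarrow> U m \<omega>) at_top"
proof (rule tendstoI)
  fix \<epsilon> :: real assume "0 < \<epsilon>"
  then obtain j where j: "1 / real (Suc j) < \<epsilon>" using reals_Archimedean[of \<epsilon>] by (auto simp: inverse_eq_divide)
  let ?x = "\<lambda>t. real_of_int (X t \<omega> m - m)"
  obtain N where N: "\<And>q::rat. real N \<le> of_rat q \<Longrightarrow>
      \<bar>real_of_int (pos (of_rat q) (shift_clocks m (clk \<omega>)) 0) / of_rat q - U m \<omega>\<bar> < 1 / real (Suc j)"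
    using speed unfolding has_speed_def U_def by blast
  have "\<bar>?x t / t - U m \<omega>\<bar> \<le> 1 / real (Suc j)" if t: "max (real N) 1 \<le> t" for t
  proof (rule ccontr)
    assume "\<not> ?thesis"
    then have gt: "1 / real (Suc j) < \<bar>?x t / t - U m \<omega>\<bar>" by simp
    have "((\<lambda>s. \<bar>?x t / s - U m \<omega>\<bar>) \<longlongrightarrow> \<bar>?x t / t - U m \<omega>\<bar>) (at_right t)"
      using t by (intro tendsto_intros) auto
    then have "\<forall>\<^sub>F s in at_right t. 1 / real (Suc j) < \<bar>?x t / s - U m \<omega>\<bar>"
      using gt by (rule order_tendstoD)
    then obtain b where b: "t < b" "\<And>s. t < s \<Longrightarrow> s < b \<Longrightarrow> 1 / real (Suc j) < \<bar>?x t / s - U m \<omega>\<bar>"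
      unfolding eventually_at_right_field by blast
    obtain \<delta> where \<delta>: "\<delta> > 0" "\<And>s. s \<in> {t..<t + \<delta>} \<Longrightarrow> X s \<omega> m = X t \<omega> m"
      using regular_right_cont[OF \<omega> _, of t m] t by (metis le_max_iff_disj max.bounded_iff order_trans zero_le_one)
    obtain q where q: "t < of_rat q" "of_rat q < min b (t + \<delta>)"
      using of_rat_dense[of t "min b (t + \<delta>)"] b(1) \<delta>(1) by auto
    have "0 \<le> (of_rat q :: real)" using q t by linarith
    from regular_shift[OF \<omega> this, of m 0]
    have "pos (of_rat q) (shift_clocks m (clk \<omega>)) 0 = X (of_rat q) \<omega> m - m" by simp
    also have "\<dots> = X t \<omega> m - m" using \<delta>(2)[of "of_rat q"] q by simp
    finally show False using N[of q] b(2)[of "of_rat q"] q t by simp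
  qed
  then have "\<forall>t\<ge>max (real N) 1. dist (?x t / t) (U m \<omega>) < \<epsilon>"
    using j by (auto simp: dist_real_def intro: le_less_trans)
  then show "\<forall>\<^sub>F t in at_top. dist (?x t / t) (U m \<omega>) < \<epsilon>"
    unfolding eventually_at_top_linorder by blast
qed

lemma AE_tendsto_speed:
  "AE \<omega> in M. \<forall>m. ((\<lambda>t. real_of_int (X t \<omega> m) / t) \<longlongrightarrow> U m \<omega>) at_top"
proof -
  have "AE \<omega> in M. \<forall>m. has_speed (shift_clocks m (clk \<omega>))"
    unfolding AE_all_countable by (intro allI AE_shift_clk AE_has_speed)
  with AE_regular show ?thesis
  proof eventually_elim
    case (elim \<omega>)
    show ?case
    proof
      fix m
      have "((\<lambda>t. real_of_int (X t \<omega> m - m) / t + real_of_int m / t) \<longlongrightarrow> U m \<omega> + 0) at_top"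
        using elim by (intro tendsto_add tendsto_speed tendsto_divide_0[OF tendsto_const]
            filterlim_at_top_imp_at_infinity filterlim_ident) auto
      then show "((\<lambda>t. real_of_int (X t \<omega> m) / t) \<longlongrightarrow> U m \<omega>) at_top"
        by (simp add: diff_divide_distrib)
    qed
  qed
qed

lemma AE_asep_speed: "AE \<omega> in M. asep_speed Y m \<omega> = U m \<omega>"
proof -
  have "AE \<omega> in M. has_speed (shift_clocks m (clk \<omega>))"
    by (intro AE_shift_clk AE_has_speed)
  with AE_regular show ?thesis
  proof eventually_elim
    case (elim \<omega>)
    have "\<forall>\<^sub>F t in at_top. real_of_int (X t \<omega> m - m) / t
        = (real_of_int (asep_position Y m t \<omega>) - real_of_int m) / t"
      using eventually_ge_at_top[of "0::real"]
      by eventually_elim (simp add: regular_position[OF elim(1)])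
    with tendsto_speed[OF elim]
    have "((\<lambda>t. (real_of_int (asep_position Y m t \<omega>) - real_of_int m) / t) \<longlongrightarrow> U m \<omega>) at_top"
      by (rule Lim_transform_eventually)
    then show ?case unfolding asep_speed_def by (intro tendsto_Lim) simp_all
  qed
qed

lemma speed_law2_eq: "speed_law2 M Y = distr M borel (\<lambda>\<omega>. (U 0 \<omega>, U 1 \<omega>))"
  unfolding speed_law2_def
proof (rule distr_completion_AE)
  show "(\<lambda>\<omega>. (U 0 \<omega>, U 1 \<omega>)) \<in> borel_measurable M" by measurable
  show "AE \<omega> in M. (asep_speed Y 0 \<omega>, asep_speed Y 1 \<omega>) = (U 0 \<omega>, U 1 \<omega>)"
    using AE_asep_speed[of 0] AE_asep_speed[of 1] by eventually_elim simp
qed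

lemma distr_U: "distr M borel (U m) = uniform_measure lborel {-\<rho>..\<rho>}"
proof -
  have *: "distr M borel (U n) = distr (clocks_law p) borel speed" for n
  proof -
    have "distr M borel (U n) = distr (distr M clock_space (\<lambda>\<omega>. shift_clocks n (clk \<omega>))) borel speed"
      unfolding U_def[abs_def] by (subst distr_distr) (simp_all add: comp_def)
    then show ?thesis by (simp only: distr_shift_clk)
  qed
  have "distr M borel (U 0) = uniform_measure lborel {-\<rho>..\<rho>}"
    unfolding speed_uniform[symmetric] speed_law_def
    by (rule distr_completion_AE[symmetric]) (simp_all add: AE_asep_speed)
  then show ?thesis using *[of 0] *[of m] by simp
qed

lemma prob_U_le:
  assumes "-\<rho> \<le> x" "x \<le> \<rho>"
  shows "expectation (\<lambda>\<omega>. of_bool (U m \<omega> \<le> x)) = (x + \<rho>) / (2 * \<rho>)"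
proof -
  have "expectation (\<lambda>\<omega>. of_bool (U m \<omega> \<le> x)) = expectation (\<lambda>\<omega>. indicat_real {..x} (U m \<omega>))"
    by (simp add: indicator_def)
  also have "\<dots> = (\<integral>u. indicat_real {..x} u \<partial>distr M borel (U m))"
    by (rule integral_distr[symmetric]) simp_all
  also have "\<dots> = measure (uniform_measure lborel {-\<rho>..\<rho>}) {..x}"
    unfolding distr_U by simp
  also have "\<dots> = measure lborel ({-\<rho>..\<rho>} \<inter> {..x}) / measure lborel {-\<rho>..\<rho>}"
    using rho by (intro measure_uniform_measure) (simp_all add: ennreal_eq_0_iff)
  also have "{-\<rho>..\<rho>} \<inter> {..x} = {-\<rho>..x}" using assms by auto
  finally show ?thesis using assms rho by simp
qed

text \<open>The uniform law has no atoms. This is what lets indicators of thresholds pass to the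
  limit.\<close>

lemma AE_U_ne: "AE \<omega> in M. U m \<omega> \<noteq> x"
proof -
  have "AE u in uniform_measure lborel {-\<rho>..\<rho>}. u \<noteq> x"
    by (rule AE_uniform_measureI) (use AE_lborel_singleton[of x] in auto)
  then show ?thesis unfolding distr_U[of m, symmetric] by (rule AE_distrD[rotated]) measurable
qed

lemma AE_U_bounds: "AE \<omega> in M. -\<rho> \<le> U m \<omega> \<and> U m \<omega> \<le> \<rho>"
proof -
  have "AE u in uniform_measure lborel {-\<rho>..\<rho>}. -\<rho> \<le> u \<and> u \<le> \<rho>"
    by (rule AE_uniform_measureI) auto
  then show ?thesis unfolding distr_U[of m, symmetric] by (rule AE_distrD[rotated]) measurable
qed

lemma U_add: "U (m + n) \<omega> = speed (shift_clocks m (shift_clocks n (clk \<omega>)))"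
  by (simp add: U_def shift_clocks_add)

lemma expectation_translate:
  fixes g :: "real \<Rightarrow> real \<Rightarrow> real \<Rightarrow> real"
  assumes [measurable]: "(\<lambda>x. g (fst x) (fst (snd x)) (snd (snd x))) \<in> borel_measurable (borel \<Otimes>\<^sub>M borel \<Otimes>\<^sub>M borel)"
  shows "expectation (\<lambda>\<omega>. g (U (i + n) \<omega>) (U (j + n) \<omega>) (U (k + n) \<omega>))
    = expectation (\<lambda>\<omega>. g (U i \<omega>) (U j \<omega>) (U k \<omega>))"
proof -
  let ?g = "\<lambda>\<omega>. g (speed (shift_clocks i \<omega>)) (speed (shift_clocks j \<omega>)) (speed (shift_clocks k \<omega>))"
  have "(\<lambda>\<omega>. (speed (shift_clocks i \<omega>), speed (shift_clocks j \<omega>), speed (shift_clocks k \<omega>)))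
      \<in> measurable clock_space (borel \<Otimes>\<^sub>M borel \<Otimes>\<^sub>M borel)" by measurable
  from measurable_compose[OF this assms] have g: "?g \<in> borel_measurable clock_space" by simp
  show ?thesis
    using expectation_shift_clk[OF g, of n] expectation_clk[OF g] unfolding U_add by (simp add: U_def)
qed

lemma mixing:
  assumes [measurable]: "Measurable.pred clock_space S" "Measurable.pred clock_space T"
  shows "(\<lambda>k. expectation (\<lambda>\<omega>. of_bool (S (clk \<omega>)) * of_bool (T (shift_clocks (int k) (clk \<omega>))) :: real))
    \<longlonglongrightarrow> expectation (\<lambda>\<omega>. of_bool (S (clk \<omega>))) * expectation (\<lambda>\<omega>. of_bool (T (clk \<omega>)))"
proof -
  let ?S = "{\<omega>. S \<omega>}" and ?T = "{\<omega>. T \<omega>}"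
  have ST: "?S \<in> sets clock_space" "?T \<in> sets clock_space"
    using assms by (simp_all add: pred_def)
  have ev: "expectation (\<lambda>\<omega>. of_bool (Q (clk \<omega>))) = measure (clocks_law p) {\<omega>. Q \<omega>}"
    if [measurable]: "Measurable.pred clock_space Q" for Q
  proof -
    have Q: "{\<omega>. Q \<omega>} \<in> sets clock_space" using that by (simp add: pred_def)
    have "expectation (\<lambda>\<omega>. of_bool (Q (clk \<omega>))) = expectation (\<lambda>\<omega>. indicat_real {\<omega>. Q \<omega>} (clk \<omega>))"
      by (simp add: indicator_def)
    also have "\<dots> = (\<integral>\<omega>. indicat_real {\<omega>. Q \<omega>} \<omega> \<partial>clocks_law p)"
      by (rule expectation_clk) (use Q in simp)
    finally show ?thesis by simp
  qed
  have "expectation (\<lambda>\<omega>. of_bool (S (clk \<omega>)) * of_bool (T (shift_clocks (int k) (clk \<omega>))) :: real)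
      = measure (clocks_law p) (?S \<inter> shift_clocks (int k) -` ?T)" for k
    using ev[of "\<lambda>\<omega>. S \<omega> \<and> T (shift_clocks (int k) \<omega>)"]
    by (simp add: of_bool_conj Collect_conj_eq vimage_def)
  then show ?thesis
    using clocks_mixing[OF ST, of p] ev[OF assms(1)] ev[OF assms(2)] by simp
qed

text \<open>\<open>c n\<close> is the length scale and \<tau> the asymptotic ratio of time to it:
  \<tau> = 1 serves for stationarity, other values for the current. The indicator could oscillate
  only if \<open>U m \<omega> = x / \<tau>\<close>, a null event.\<close>

lemma AE_tendsto_indicator:
  assumes c: "\<And>n. 0 < c n" and \<tau>: "(\<lambda>n. \<xi> n / c n) \<longlonglongrightarrow> \<tau>" "0 < \<tau>" and \<xi>: "filterlim \<xi> at_top sequentially"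
  shows "AE \<omega> in M. (\<lambda>n. real_of_int (X (\<xi> n) \<omega> m) / c n) \<longlonglongrightarrow> \<tau> * U m \<omega>"
    and "AE \<omega> in M. (\<lambda>n. of_bool (real_of_int (X (\<xi> n) \<omega> m) \<le> x * c n) :: real)
      \<longlonglongrightarrow> of_bool (\<tau> * U m \<omega> \<le> x)"
proof -
  show 1: "AE \<omega> in M. (\<lambda>n. real_of_int (X (\<xi> n) \<omega> m) / c n) \<longlonglongrightarrow> \<tau> * U m \<omega>"
    using AE_tendsto_speed
  proof eventually_elim
    case (elim \<omega>)
    have "(\<lambda>n. real_of_int (X (\<xi> n) \<omega> m) / \<xi> n) \<longlonglongrightarrow> U m \<omega>"
      using elim \<xi> filterlim_compose[of "\<lambda>t. real_of_int (X t \<omega> m) / t"] by blast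
    from tendsto_mult[OF \<tau>(1) this]
    have "(\<lambda>n. \<xi> n / c n * (real_of_int (X (\<xi> n) \<omega> m) / \<xi> n)) \<longlonglongrightarrow> \<tau> * U m \<omega>" .
    moreover have "\<forall>\<^sub>F n in sequentially. 0 < \<xi> n"
      using \<xi> by (simp add: filterlim_at_top_dense)
    then have "\<forall>\<^sub>F n in sequentially. \<xi> n / c n * (real_of_int (X (\<xi> n) \<omega> m) / \<xi> n)
        = real_of_int (X (\<xi> n) \<omega> m) / c n"
      by eventually_elim simp
    ultimately show ?case by (rule Lim_transform_eventually)
  qed
  show "AE \<omega> in M. (\<lambda>n. of_bool (real_of_int (X (\<xi> n) \<omega> m) \<le> x * c n) :: real)
      \<longlonglongrightarrow> of_bool (\<tau> * U m \<omega> \<le> x)"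
    using 1 AE_U_ne[of m "x / \<tau>"]
  proof eventually_elim
    case (elim \<omega>)
    let ?r = "\<lambda>n. real_of_int (X (\<xi> n) \<omega> m) / c n"
    have le: "real_of_int (X (\<xi> n) \<omega> m) \<le> x * c n \<longleftrightarrow> ?r n \<le> x" for n
      using c[of n] by (simp add: pos_divide_le_eq)
    have "\<tau> * U m \<omega> \<noteq> x" using elim(2) \<tau>(2) by (auto simp: field_simps)
    then consider "\<tau> * U m \<omega> < x" | "x < \<tau> * U m \<omega>" by linarith
    then have "\<forall>\<^sub>F n in sequentially. (?r n \<le> x) = (\<tau> * U m \<omega> \<le> x)"
    proof cases
      case 1
      then show ?thesis using order_tendstoD(2)[OF elim(1) 1] by (auto elim: eventually_mono)
    next
      case 2
      then show ?thesis using order_tendstoD(1)[OF elim(1) 2] by (auto elim: eventually_mono)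
    qed
    then show ?case
      unfolding le by (intro tendsto_eventually) (auto elim: eventually_mono)
  qed
qed

end

subsection \<open>Stationarity of the speed process\<close>

definition swap_at :: "int \<Rightarrow> (int \<Rightarrow> int) \<Rightarrow> int \<Rightarrow> int" where
  "swap_at n \<pi> = \<pi> \<circ> Transposition.transpose n (n + 1)"

definition rate :: "real \<Rightarrow> (int \<Rightarrow> int) \<Rightarrow> int \<Rightarrow> real" where
  "rate p \<pi> n = (if \<pi> n < \<pi> (n + 1) then p else 1 - p)"

text \<open>Exactly one of the two coins leads to an exchange; its weight is the rate.\<close>

lemma gen_rate: "gen E p F \<pi> = (\<Sum>n\<in>E. rate p \<pi> n * (F (swap_at n \<pi>) - F \<pi>))"
  unfolding gen_def by (intro sum.cong refl) (auto simp: UNIV_bool wt_def rate_def act_def swap_at_def)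

lemma swap_at_apply:
  "swap_at n \<pi> n = \<pi> (n + 1)" "swap_at n \<pi> (n + 1) = \<pi> n"
  "m \<noteq> n \<Longrightarrow> m \<noteq> n + 1 \<Longrightarrow> swap_at n \<pi> m = \<pi> m"
  by (simp_all add: swap_at_def)

text \<open>
  The current of particles through an edge whose end points have occupation numbers \<open>a\<close> and \<open>b\<close>.
\<close>

definition jump :: "real \<Rightarrow> real \<Rightarrow> real \<Rightarrow> real" where
  "jump p a b = p * a * (1 - b) - (1 - p) * (1 - a) * b"

text \<open>Labels play the role of sites: label \<open>m\<close> is occupied if its particle is at
  \<open>c\<close> or to the left of it. This projects the dynamics of \<open>X\<close> to a
  single-type exclusion process.\<close>

definition below :: "real \<Rightarrow> (int \<Rightarrow> int) \<Rightarrow> int \<Rightarrow> real" where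
  "below c \<pi> m = of_bool (real_of_int (\<pi> m) \<le> c)"

lemma below_swap_at:
  "below c (swap_at n \<pi>) m = below c \<pi> (if m = n then n + 1 else if m = n + 1 then n else m)"
  by (simp add: below_def swap_at_def Transposition.transpose_def)

text \<open>If exactly one of the two labels is occupied, its particle is the left one of the two,
  and this decides the rate: \<open>p\<close> if the occupied label is \<open>n\<close>,
  \<open>1 - p\<close> if it is \<open>n + 1\<close>.\<close>

lemma jump_rate:
  "jump p (below c \<pi> n) (below c \<pi> (n + 1)) = rate p \<pi> n * (below c \<pi> n - below c \<pi> (n + 1))"
  by (auto simp: rate_def jump_def below_def)

definition pair_test :: "real \<Rightarrow> real \<Rightarrow> nat \<Rightarrow> (int \<Rightarrow> int) \<Rightarrow> real" where
  "pair_test x y k \<pi> = below x \<pi> 0 * (1 - below y \<pi> (int k))"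

lemma local_on_pair_test: "local_on k (pair_test x y k)"
  by (auto simp: local_on_def pair_test_def below_def)

lemma abs_pair_test_le: "\<bar>pair_test x y k \<pi>\<bar> \<le> 1"
  by (simp add: pair_test_def below_def)

text \<open>The test function reads the labels 0 and \<open>k\<close>, so only four edges
  contribute, and \<open>2 \<le> k\<close> keeps the edges 0 and \<open>k - 1\<close> apart. Each
  contribution is a current; at both labels the inflow minus the outflow appears.\<close>

lemma gen_pair_test_far:
  assumes k: "2 \<le> k"
  shows "gen (window (Suc k)) p (pair_test x y k) \<pi>
    = jump p (below x \<pi> (- 1)) (below x \<pi> 0) * (1 - below y \<pi> (int k))
      - jump p (below x \<pi> 0) (below x \<pi> 1) * (1 - below y \<pi> (int k))
      - below x \<pi> 0 * jump p (below y \<pi> (int k - 1)) (below y \<pi> (int k))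
      + below x \<pi> 0 * jump p (below y \<pi> (int k)) (below y \<pi> (int k + 1))"
proof -
  let ?t = "\<lambda>n. rate p \<pi> n * (pair_test x y k (swap_at n \<pi>) - pair_test x y k \<pi>)"
  have "gen (window (Suc k)) p (pair_test x y k) \<pi> = (\<Sum>n\<in>{-1, 0, int k - 1, int k}. ?t n)"
    unfolding gen_rate using k
    by (intro sum.mono_neutral_right) (auto simp: pair_test_def below_def swap_at_apply)
  also have "\<dots> = ?t (- 1) + ?t 0 + ?t (int k - 1) + ?t (int k)" using k by simp
  also have "?t (- 1) = jump p (below x \<pi> (- 1)) (below x \<pi> 0) * (1 - below y \<pi> (int k))"
    using k by (simp add: jump_rate[of p x \<pi> "-1", simplified] pair_test_def below_swap_at algebra_simps)
  also have "?t 0 = - (jump p (below x \<pi> 0) (below x \<pi> 1) * (1 - below y \<pi> (int k)))"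
    using k by (simp add: jump_rate[of p x \<pi> 0, simplified] pair_test_def below_swap_at algebra_simps)
  also have "?t (int k - 1) = - (below x \<pi> 0 * jump p (below y \<pi> (int k - 1)) (below y \<pi> (int k)))"
    using k by (simp add: jump_rate[of p y \<pi> "int k - 1", simplified] pair_test_def below_swap_at algebra_simps)
  also have "?t (int k) = below x \<pi> 0 * jump p (below y \<pi> (int k)) (below y \<pi> (int k + 1))"
    unfolding jump_rate using k by (simp add: pair_test_def below_swap_at algebra_simps)
  finally show ?thesis by simp
qed

text \<open>For neighbouring labels the edge 0 changes both factors at once. Because
  \<open>x \<le> y\<close>, a pair with one position at most \<open>x\<close> and the other beyond
  \<open>y\<close> has a definite order and hence a definite rate, and it cannot pass the test both
  before and after the exchange. Loss and gain at this edge are therefore pure pair terms.\<close>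

lemma gen_pair_test_near:
  assumes xy: "x \<le> y"
  shows "gen (window (Suc 1)) p (pair_test x y 1) \<pi>
    = jump p (below x \<pi> (- 1)) (below x \<pi> 0) * (1 - below y \<pi> 1)
      + ((1 - p) * below x \<pi> 1 * (1 - below y \<pi> 0) - p * below x \<pi> 0 * (1 - below y \<pi> 1))
      + below x \<pi> 0 * jump p (below y \<pi> 1) (below y \<pi> 2)"
proof -
  let ?t = "\<lambda>n. rate p \<pi> n * (pair_test x y 1 (swap_at n \<pi>) - pair_test x y 1 \<pi>)"
  have "gen (window (Suc 1)) p (pair_test x y 1) \<pi> = (\<Sum>n\<in>{-1, 0, 1}. ?t n)"
    unfolding gen_rate
    by (intro sum.mono_neutral_right) (auto simp: pair_test_def below_def swap_at_apply)
  also have "\<dots> = ?t (- 1) + ?t 0 + ?t 1" by simp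
  also have "?t (- 1) = jump p (below x \<pi> (- 1)) (below x \<pi> 0) * (1 - below y \<pi> 1)"
    by (simp add: jump_rate[of p x \<pi> "-1", simplified] pair_test_def below_swap_at algebra_simps)
  also have "?t 0 = (1 - p) * below x \<pi> 1 * (1 - below y \<pi> 0) - p * below x \<pi> 0 * (1 - below y \<pi> 1)"
    using xy swap_at_apply(1,2)[of 0 \<pi>]
    by (auto simp: pair_test_def below_def rate_def)
  also have "?t 1 = below x \<pi> 0 * jump p (below y \<pi> 1) (below y \<pi> 2)"
    by (simp add: jump_rate[of p y \<pi> 1, simplified] pair_test_def below_swap_at algebra_simps)
  finally show ?thesis by simp
qed

lemma abs_jump_le:
  assumes "0 \<le> p" "p \<le> 1" "a \<in> {0, 1}" "b \<in> {0, 1}"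
  shows "\<bar>jump p a b\<bar> \<le> 1"
  using assms by (auto simp: jump_def)

text \<open>
  A bounded stand-in for the positive part of \<open>z - u\<close>.  With integer break points its difference
  quotient is exactly a difference of two indicators, so that the generator produces currents.
\<close>

definition ramp :: "int \<Rightarrow> int \<Rightarrow> int \<Rightarrow> real" where
  "ramp z w u = real_of_int (min (max (z - u) 0) w)"

lemma ramp_diff:
  assumes "0 \<le> w"
  shows "ramp z w (u - 1) - ramp z w u
    = of_bool (real_of_int u \<le> real_of_int z) - of_bool (real_of_int u \<le> real_of_int (z - w))"
  using assms unfolding ramp_def of_int_le_iff by (auto simp: min_def max_def)

lemma gen_ramp:
  "gen (window (Suc 0)) p (\<lambda>\<pi>. ramp z w (\<pi> 0)) \<pi>
    = rate p \<pi> (- 1) * (ramp z w (\<pi> (- 1)) - ramp z w (\<pi> 0)) + rate p \<pi> 0 * (ramp z w (\<pi> 1) - ramp z w (\<pi> 0))"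
proof -
  have "window (Suc 0) = {-1, 0}" by auto
  then show ?thesis
    unfolding gen_rate using swap_at_apply(2)[of "-1" \<pi>] swap_at_apply(1)[of 0 \<pi>] by simp
qed

context asep_speeds
begin

definition occ :: "real \<Rightarrow> int \<Rightarrow> 'w \<Rightarrow> real" where
  "occ x m \<omega> = of_bool (U m \<omega> \<le> x)"

lemma measurable_occ [measurable]: "occ x m \<in> borel_measurable M"
  unfolding occ_def by measurable

lemma measurable_below [measurable]: "(\<lambda>\<omega>. below c (X t \<omega>) m) \<in> borel_measurable M"
proof -
  have "(\<lambda>\<omega>. of_bool (real_of_int (pos t \<omega> m) \<le> c) :: real) \<in> borel_measurable clock_space" by measurable
  then show ?thesis unfolding below_def by (rule measurable_compose[OF measurable_clk])
qed

lemma measurable_local [measurable]: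
  assumes "local_on k F"
  shows "(\<lambda>\<omega>. F (X t \<omega>)) \<in> borel_measurable M"
  by (rule measurable_compose[OF measurable_clk measurable_local_on[OF assms]])

text \<open>The thresholds stay fixed while time runs from \<open>c\<close> to \<open>c + 1\<close>,
  and for large \<open>c\<close> both end points have the same scaling limit, so the increment of
  the mean vanishes. By the mean value form the mean of the generator at the intermediate time
  vanishes too. \<Psi> expresses this generator through occupation numbers, which converge almost
  surely.\<close>

lemma stationary:
  fixes \<Psi> :: "(int \<Rightarrow> real) \<Rightarrow> (int \<Rightarrow> real) \<Rightarrow> real"
  assumes gen: "\<And>c \<pi>. 0 < c \<Longrightarrow> gen (window (Suc k)) p (pair_test (x * c) (y * c) k) \<pi>
      = \<Psi> (below (x * c) \<pi>) (below (y * c) \<pi>)"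
    and cont: "\<And>a b a' b'. (\<And>m. (\<lambda>n. a n m) \<longlonglongrightarrow> a' m) \<Longrightarrow> (\<And>m. (\<lambda>n. b n m) \<longlonglongrightarrow> b' m)
      \<Longrightarrow> (\<lambda>n. \<Psi> (a n) (b n)) \<longlonglongrightarrow> \<Psi> a' b'"
    and meas: "(\<lambda>\<omega>. \<Psi> (\<lambda>m. occ x m \<omega>) (\<lambda>m. occ y m \<omega>)) \<in> borel_measurable M"
  shows "expectation (\<lambda>\<omega>. \<Psi> (\<lambda>m. occ x m \<omega>) (\<lambda>m. occ y m \<omega>)) = 0"
proof -
  define c where "c n = real (Suc n)" for n
  let ?F = "\<lambda>n. pair_test (x * c n) (y * c n) k"
  have c: "0 < c n" for n by (simp add: c_def)
  \<comment> \<open>The interval has length 1, so the factor \<open>t - s\<close> disappears, and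
    the tolerance \<open>1 / c n\<close> vanishes in the limit.\<close>
  have "\<exists>\<xi>. c n < \<xi> \<and> \<xi> < c n + 1 \<and>
    \<bar>expectation (\<lambda>\<omega>. ?F n (X (c n + 1) \<omega>)) - expectation (\<lambda>\<omega>. ?F n (X (c n) \<omega>))
      - expectation (\<lambda>\<omega>. gen (window (Suc k)) p (?F n) (X \<xi> \<omega>))\<bar> \<le> 1 / c n" for n
    using mean_value[OF local_on_pair_test[of k "x * c n" "y * c n"] abs_pair_test_le, of "c n" "c n + 1" "1 / c n"] c[of n]
    by (auto simp: less_imp_le)
  then obtain \<xi> where \<xi>: "\<And>n. c n < \<xi> n" "\<And>n. \<xi> n < c n + 1"
    "\<And>n. \<bar>expectation (\<lambda>\<omega>. ?F n (X (c n + 1) \<omega>)) - expectation (\<lambda>\<omega>. ?F n (X (c n) \<omega>))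
      - expectation (\<lambda>\<omega>. gen (window (Suc k)) p (?F n) (X (\<xi> n) \<omega>))\<bar> \<le> 1 / c n"
    by metis
  have c_top: "filterlim c at_top sequentially"
    unfolding c_def by (rule filterlim_compose[OF filterlim_real_sequentially filterlim_Suc])
  have inv_c: "(\<lambda>n. 1 / c n) \<longlonglongrightarrow> 0"
    unfolding c_def using LIMSEQ_inverse_real_of_nat by (simp add: inverse_eq_divide)
  \<comment> \<open>Stated for arbitrary times in \<open>[c n, c n + 1]\<close>, to cover the end
    points as well as the unknown intermediate times.\<close>
  have ratio: "(\<lambda>n. s n / c n) \<longlonglongrightarrow> 1" "filterlim s at_top sequentially"
    if s: "\<And>n. c n \<le> s n" "\<And>n. s n \<le> c n + 1" for s
  proof -
    show "(\<lambda>n. s n / c n) \<longlonglongrightarrow> 1"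
    proof (rule tendsto_sandwich)
      show "\<forall>\<^sub>F n in sequentially. 1 \<le> s n / c n" using s(1) c by (simp add: pos_le_divide_eq)
      show "\<forall>\<^sub>F n in sequentially. s n / c n \<le> 1 + 1 / c n"
      proof (intro always_eventually allI)
        fix n show "s n / c n \<le> 1 + 1 / c n" using s(2)[of n] c[of n] by (simp add: field_simps)
      qed
      show "(\<lambda>n. 1 + 1 / c n) \<longlonglongrightarrow> 1" using tendsto_add[OF tendsto_const inv_c, of 1] by simp
    qed simp
    show "filterlim s at_top sequentially"
      by (rule filterlim_at_top_mono[OF c_top]) (simp add: s(1))
  qed
  have ind: "AE \<omega> in M. \<forall>m. (\<lambda>n. below (z * c n) (X (s n) \<omega>) m) \<longlonglongrightarrow> occ z m \<omega>"
    if "\<And>n. c n \<le> s n" "\<And>n. s n \<le> c n + 1" for s z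
    unfolding AE_all_countable below_def occ_def
    using AE_tendsto_indicator(2)[OF c ratio(1)[OF that] _ ratio(2)[OF that], of _ z] by simp
  have lim: "(\<lambda>n. expectation (\<lambda>\<omega>. ?F n (X (s n) \<omega>))) \<longlonglongrightarrow> expectation (\<lambda>\<omega>. occ x 0 \<omega> * (1 - occ y (int k) \<omega>))"
    if s: "\<And>n. c n \<le> s n" "\<And>n. s n \<le> c n + 1" for s
  proof (rule integral_dominated_convergence[where w = "\<lambda>_. 1"])
    show "AE \<omega> in M. (\<lambda>n. ?F n (X (s n) \<omega>)) \<longlonglongrightarrow> occ x 0 \<omega> * (1 - occ y (int k) \<omega>)"
      using ind[OF s, of x] ind[OF s, of y]
    proof eventually_elim
      case (elim \<omega>)
      then show ?case unfolding pair_test_def by (intro tendsto_intros) auto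
    qed
  qed (use abs_pair_test_le measurable_local[OF local_on_pair_test] in auto)
  have "(\<lambda>n. expectation (\<lambda>\<omega>. ?F n (X (c n + 1) \<omega>)) - expectation (\<lambda>\<omega>. ?F n (X (c n) \<omega>))) \<longlonglongrightarrow> 0"
    using tendsto_diff[OF lim[of "\<lambda>n. c n + 1"] lim[of c]] by simp
  moreover have "(\<lambda>n. expectation (\<lambda>\<omega>. ?F n (X (c n + 1) \<omega>)) - expectation (\<lambda>\<omega>. ?F n (X (c n) \<omega>))
      - expectation (\<lambda>\<omega>. gen (window (Suc k)) p (?F n) (X (\<xi> n) \<omega>))) \<longlonglongrightarrow> 0"
    by (rule Lim_null_comparison[OF _ inv_c], unfold real_norm_def, intro always_eventually allI \<xi>(3))
  ultimately have 0: "(\<lambda>n. expectation (\<lambda>\<omega>. gen (window (Suc k)) p (?F n) (X (\<xi> n) \<omega>))) \<longlonglongrightarrow> 0"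
    using tendsto_diff by fastforce
  have "(\<lambda>n. expectation (\<lambda>\<omega>. gen (window (Suc k)) p (?F n) (X (\<xi> n) \<omega>)))
      \<longlonglongrightarrow> expectation (\<lambda>\<omega>. \<Psi> (\<lambda>m. occ x m \<omega>) (\<lambda>m. occ y m \<omega>))"
  proof (rule integral_dominated_convergence[where w = "\<lambda>_. 2 * real (card (window (Suc k)))"])
    show "AE \<omega> in M. (\<lambda>n. gen (window (Suc k)) p (?F n) (X (\<xi> n) \<omega>))
        \<longlonglongrightarrow> \<Psi> (\<lambda>m. occ x m \<omega>) (\<lambda>m. occ y m \<omega>)"
      using ind[OF less_imp_le[OF \<xi>(1)] less_imp_le[OF \<xi>(2)], of x] ind[OF less_imp_le[OF \<xi>(1)] less_imp_le[OF \<xi>(2)], of y]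
    proof eventually_elim
      case (elim \<omega>)
      show ?case unfolding gen[OF c] by (rule cont) (use elim in auto)
    qed
    show "AE \<omega> in M. norm (gen (window (Suc k)) p (?F n) (X (\<xi> n) \<omega>)) \<le> 2 * real (card (window (Suc k)))" for n
      using abs_gen_le[OF p01 abs_pair_test_le, of "window (Suc k)"] by (intro AE_I2) simp
  qed (use meas measurable_local[OF local_on_gen[OF local_on_pair_test]] in auto)
  with 0 show ?thesis by (simp add: LIMSEQ_unique)
qed

subsection \<open>Currents\<close>

definition current :: "real \<Rightarrow> real" where
  "current x = expectation (\<lambda>\<omega>. jump p (occ x 0 \<omega>) (occ x 1 \<omega>))"

lemma occ_cases: "occ x m \<omega> \<in> {0, 1}"
  by (simp add: occ_def)

lemma below_cases: "below c \<pi> m \<in> {0, 1}"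
  by (simp add: below_def)

text \<open>The edges -1 and 0 contribute. Translation by one label moves the first contribution to
  the edge 0 with all positions reduced by 1; the sum then contains differences of
  \<open>ramp\<close> at neighbouring integers, which are differences of occupation numbers.\<close>

lemma expectation_gen_ramp:
  assumes t: "0 \<le> t" and w: "0 \<le> w"
  shows "expectation (\<lambda>\<omega>. gen (window (Suc 0)) p (\<lambda>\<pi>. ramp z w (\<pi> 0)) (X t \<omega>))
    = expectation (\<lambda>\<omega>. jump p (below (real_of_int z) (X t \<omega>) 0) (below (real_of_int z) (X t \<omega>) 1)
      - jump p (below (real_of_int (z - w)) (X t \<omega>) 0) (below (real_of_int (z - w)) (X t \<omega>) 1))"
proof -
  \<comment> \<open>The \<open>- 1\<close> in the arguments undoes the translation: for the clocks
    shifted by -1, the labels 0 and 1 sit one site to the right of the original labels -1 and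
    0.\<close>
  define h1 where "h1 \<pi> = rate p \<pi> 0 * (ramp z w (\<pi> 0 - 1) - ramp z w (\<pi> 1 - 1))" for \<pi>
  define h2 where "h2 \<pi> = rate p \<pi> 0 * (ramp z w (\<pi> 1) - ramp z w (\<pi> 0))" for \<pi>
  have loc: "local_on 1 h1" "local_on 1 h2"
    by (auto simp: local_on_def h1_def h2_def rate_def)
  have ramp: "0 \<le> ramp z w u" "ramp z w u \<le> real_of_int w" for u
    using w by (auto simp: ramp_def)
  have rate: "0 \<le> rate p \<pi> n" "rate p \<pi> n \<le> 1" for \<pi> n
    using p01 by (auto simp: rate_def)
  have bd: "\<bar>rate p \<pi> n * (ramp z w u - ramp z w v)\<bar> \<le> real_of_int w" for \<pi> n u v
  proof -
    have "\<bar>rate p \<pi> n * (ramp z w u - ramp z w v)\<bar> \<le> 1 * real_of_int w"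
      unfolding abs_mult using ramp[of u] ramp[of v] rate[of \<pi> n] by (intro mult_mono) auto
    then show ?thesis by simp
  qed
  have h1': "(\<lambda>\<omega>. h1 (pos t \<omega>)) \<in> borel_measurable clock_space" by (rule measurable_local_on[OF loc(1)])
  have int: "integrable M (\<lambda>\<omega>. h1 (X t \<omega>))" "integrable M (\<lambda>\<omega>. h2 (X t \<omega>))"
  proof -
    have ae: "AE \<omega> in M. norm (h1 (X t \<omega>)) \<le> real_of_int w" "AE \<omega> in M. norm (h2 (X t \<omega>)) \<le> real_of_int w"
      unfolding h1_def h2_def real_norm_def by (intro AE_I2 bd)+
    show "integrable M (\<lambda>\<omega>. h1 (X t \<omega>))"
      by (rule integrable_const_bound[OF ae(1) measurable_local[OF loc(1)]])
    show "integrable M (\<lambda>\<omega>. h2 (X t \<omega>))"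
      by (rule integrable_const_bound[OF ae(2) measurable_local[OF loc(2)]])
  qed
  have int_shift: "integrable M (\<lambda>\<omega>. h1 (pos t (shift_clocks (- 1) (clk \<omega>))))"
  proof (rule integrable_const_bound[of _ "real_of_int w"])
    show "(\<lambda>\<omega>. h1 (pos t (shift_clocks (- 1) (clk \<omega>)))) \<in> borel_measurable M"
      by (rule measurable_compose[OF _ h1']) measurable
  qed (use bd in \<open>auto simp: h1_def\<close>)
  have "expectation (\<lambda>\<omega>. gen (window (Suc 0)) p (\<lambda>\<pi>. ramp z w (\<pi> 0)) (X t \<omega>))
      = expectation (\<lambda>\<omega>. h1 (pos t (shift_clocks (- 1) (clk \<omega>))) + h2 (X t \<omega>))"
  proof (rule integral_cong_AE)
    have "local_on 1 (gen (window (Suc 0)) p (\<lambda>\<pi>. ramp z w (\<pi> 0)))"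
      using local_on_gen[of 0 "\<lambda>\<pi>. ramp z w (\<pi> 0)"] by (simp add: local_on_def)
    then show "(\<lambda>\<omega>. gen (window (Suc 0)) p (\<lambda>\<pi>. ramp z w (\<pi> 0)) (X t \<omega>)) \<in> borel_measurable M"
      by (rule measurable_local)
    show "(\<lambda>\<omega>. h1 (pos t (shift_clocks (- 1) (clk \<omega>))) + h2 (X t \<omega>)) \<in> borel_measurable M"
      using int int_shift by auto
    show "AE \<omega> in M. gen (window (Suc 0)) p (\<lambda>\<pi>. ramp z w (\<pi> 0)) (X t \<omega>)
        = h1 (pos t (shift_clocks (- 1) (clk \<omega>))) + h2 (X t \<omega>)"
      using AE_regular
    proof eventually_elim
      case (elim \<omega>)
      show ?case
        unfolding gen_ramp h1_def h2_def
        using regular_shift[OF elim t, of "-1" 0] regular_shift[OF elim t, of "-1" 1] by (simp add: rate_def)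
    qed
  qed
  also have "\<dots> = expectation (\<lambda>\<omega>. h1 (pos t (shift_clocks (- 1) (clk \<omega>)))) + expectation (\<lambda>\<omega>. h2 (X t \<omega>))"
    using int int_shift by simp
  also have "expectation (\<lambda>\<omega>. h1 (pos t (shift_clocks (- 1) (clk \<omega>)))) = expectation (\<lambda>\<omega>. h1 (X t \<omega>))"
    by (simp only: expectation_shift_clk[OF h1'] expectation_clk[OF h1'])
  also have "\<dots> + expectation (\<lambda>\<omega>. h2 (X t \<omega>)) = expectation (\<lambda>\<omega>. h1 (X t \<omega>) + h2 (X t \<omega>))"
    using int by simp
  also have "expectation (\<lambda>\<omega>. h1 (X t \<omega>) + h2 (X t \<omega>)) = expectation (\<lambda>\<omega>. jump p (below (real_of_int z) (X t \<omega>) 0) (below (real_of_int z) (X t \<omega>) 1)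
      - jump p (below (real_of_int (z - w)) (X t \<omega>) 0) (below (real_of_int (z - w)) (X t \<omega>) 1))"
  proof -
    have "h1 \<pi> + h2 \<pi> = jump p (below (real_of_int z) \<pi> 0) (below (real_of_int z) \<pi> 1)
      - jump p (below (real_of_int (z - w)) \<pi> 0) (below (real_of_int (z - w)) \<pi> 1)" for \<pi>
    proof -
      have "h1 \<pi> + h2 \<pi> = rate p \<pi> 0 * ((ramp z w (\<pi> 0 - 1) - ramp z w (\<pi> 0)) - (ramp z w (\<pi> 1 - 1) - ramp z w (\<pi> 1)))"
        by (simp add: h1_def h2_def algebra_simps)
      also have "\<dots> = rate p \<pi> 0 * (below (real_of_int z) \<pi> 0 - below (real_of_int z) \<pi> (0 + 1))
          - rate p \<pi> 0 * (below (real_of_int (z - w)) \<pi> 0 - below (real_of_int (z - w)) \<pi> (0 + 1))"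
        unfolding ramp_diff[OF w] below_def by (simp add: algebra_simps)
      finally show ?thesis by (simp only: jump_rate[symmetric]) simp
    qed
    then show ?thesis by (simp only:)
  qed
  finally show ?thesis .
qed

text \<open>The scaling limit of the mean positive part of \<open>x * c - X t 0\<close> at time
  \<open>t = \<theta> * c\<close>, divided by \<open>c\<close>.\<close>

definition ramp_mean :: "real \<Rightarrow> real \<Rightarrow> real" where
  "ramp_mean x \<theta> = expectation (\<lambda>\<omega>. max (x - \<theta> * U 0 \<omega>) 0)"

text \<open>The mean of the ramp is compared at times \<open>c\<close> and
  \<open>(1 + \<delta>) * c\<close>. The intermediate time divided by \<open>c\<close> stays in a
  compact interval, so along a subsequence it tends to some \<tau>; the threshold
  \<open>x * c\<close> at time \<open>\<tau> * c\<close> corresponds to the speed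
  \<open>x / \<tau>\<close>.\<close>

lemma current_mean_value:
  assumes x: "-1 \<le> x" and \<delta>: "0 < \<delta>" "\<delta> \<le> 1"
  shows "\<exists>\<tau>\<in>{1..1 + \<delta>}. (ramp_mean x (1 + \<delta>) - ramp_mean x 1) / \<delta> = current (x / \<tau>)"
proof -
  define c where "c n = real (Suc n)" for n
  \<comment> \<open>Positions are integers, so rounding the threshold down does not change the
    occupation numbers.\<close>
  define z where "z n = \<lfloor>x * c n\<rfloor>" for n
  \<comment> \<open>The cut-off lies at \<open>z n - w n = - 3 * c n\<close>. Up to time
    \<open>2 * c n\<close> the rescaled positions have limits not below -2, so the cut-off has no
    effect in the limit; \<open>-1 \<le> x\<close> ensures \<open>0 \<le> w n\<close>.\<close>
  define w where "w n = z n + 3 * int (Suc n)" for n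
  have c: "0 < c n" "c n \<noteq> 0" for n by (simp_all add: c_def)
  have w: "0 \<le> w n" for n
  proof -
    have "- c n \<le> x * c n" using mult_right_mono[OF x, of "c n"] c(1)[of n] by simp
    then have "- int (Suc n) \<le> z n" unfolding z_def c_def by (simp add: le_floor_iff)
    then show ?thesis by (simp add: w_def)
  qed
  have zw: "real_of_int (z n - w n) = - 3 * c n" for n by (simp add: w_def c_def)
  have below_z: "below (real_of_int (z n)) \<pi> m = below (x * c n) \<pi> m" for n \<pi> m
    by (simp add: below_def z_def le_floor_iff)
  have c_top: "filterlim c at_top sequentially"
    unfolding c_def by (rule filterlim_compose[OF filterlim_real_sequentially filterlim_Suc])
  have inv_c: "(\<lambda>n. 1 / c n) \<longlonglongrightarrow> 0"
    unfolding c_def using LIMSEQ_inverse_real_of_nat by (simp add: inverse_eq_divide)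
  have z_lim: "(\<lambda>n. real_of_int (z n) / c n) \<longlonglongrightarrow> x"
  proof (rule tendsto_sandwich)
    show "\<forall>\<^sub>F n in sequentially. x - 1 / c n \<le> real_of_int (z n) / c n"
    proof (intro always_eventually allI)
      fix n
      have "x * c n - 1 \<le> real_of_int (z n)" unfolding z_def by linarith
      then have "(x * c n - 1) / c n \<le> real_of_int (z n) / c n" using c(1)[of n] by (intro divide_right_mono) auto
      then show "x - 1 / c n \<le> real_of_int (z n) / c n" using c(2)[of n] by (simp add: diff_divide_distrib)
    qed
    show "\<forall>\<^sub>F n in sequentially. real_of_int (z n) / c n \<le> x"
    proof (intro always_eventually allI)
      fix n
      have "real_of_int (z n) \<le> x * c n" unfolding z_def by linarith
      then show "real_of_int (z n) / c n \<le> x" using c(1)[of n] by (simp add: pos_divide_le_eq)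
    qed
    show "(\<lambda>n. x - 1 / c n) \<longlonglongrightarrow> x" using tendsto_diff[OF tendsto_const inv_c, of x] by simp
  qed simp
  have w_lim: "(\<lambda>n. real_of_int (w n) / c n) \<longlonglongrightarrow> x + 3"
  proof -
    have "real_of_int (w n) / c n = real_of_int (z n) / c n + 3" for n
    proof -
      have "real_of_int (w n) = real_of_int (z n) + 3 * c n" by (simp add: w_def c_def)
      then show ?thesis using c(2)[of n] by (simp add: add_divide_distrib)
    qed
    then show ?thesis using tendsto_add[OF z_lim tendsto_const, of 3] by simp
  qed
  let ?F = "\<lambda>n \<pi>. ramp (z n) (w n) (\<pi> 0)"
  have loc: "local_on 0 (?F n)" for n by (simp add: local_on_def)
  have ramp_le: "\<bar>?F n \<pi>\<bar> \<le> real_of_int (w n)" for n \<pi>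
    using w[of n] by (auto simp: ramp_def)
  \<comment> \<open>A fixed tolerance suffices here, since everything is divided by
    \<open>c n\<close> later.\<close>
  have "\<exists>\<xi>. c n < \<xi> \<and> \<xi> < (1 + \<delta>) * c n \<and>
    \<bar>expectation (\<lambda>\<omega>. ?F n (pos ((1 + \<delta>) * c n) (clk \<omega>))) - expectation (\<lambda>\<omega>. ?F n (X (c n) \<omega>))
      - ((1 + \<delta>) * c n - c n) * expectation (\<lambda>\<omega>. gen (window (Suc 0)) p (?F n) (X \<xi> \<omega>))\<bar> \<le> 1" for n
  proof -
    have "0 \<le> c n" "c n < (1 + \<delta>) * c n" using c(1)[of n] \<delta> by (simp_all add: distrib_right)
    show ?thesis
    proof (rule mean_value[where F = "?F n" and k = 0 and B = "real_of_int (w n)" and s = "c n"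
          and t = "(1 + \<delta>) * c n" and \<epsilon> = 1])
      show "local_on 0 (?F n)" by (rule loc)
      show "\<bar>?F n \<pi>\<bar> \<le> real_of_int (w n)" for \<pi> by (rule ramp_le)
    qed (fact, fact, simp, blast)
  qed
  then obtain \<xi> where \<xi>: "\<And>n. c n < \<xi> n" "\<And>n. \<xi> n < (1 + \<delta>) * c n"
    "\<And>n. \<bar>expectation (\<lambda>\<omega>. ?F n (pos ((1 + \<delta>) * c n) (clk \<omega>))) - expectation (\<lambda>\<omega>. ?F n (X (c n) \<omega>))
      - ((1 + \<delta>) * c n - c n) * expectation (\<lambda>\<omega>. gen (window (Suc 0)) p (?F n) (X (\<xi> n) \<omega>))\<bar> \<le> 1"
    by metis
  define e where "e n = expectation (\<lambda>\<omega>. gen (window (Suc 0)) p (?F n) (X (\<xi> n) \<omega>))" for n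
  have ramp_lim: "(\<lambda>n. expectation (\<lambda>\<omega>. ?F n (X (\<theta> * c n) \<omega>) / c n)) \<longlonglongrightarrow> ramp_mean x \<theta>"
    if \<theta>: "1 \<le> \<theta>" "\<theta> \<le> 2" for \<theta>
    unfolding ramp_mean_def
  proof (rule integral_dominated_convergence[where w = "\<lambda>_. \<bar>x\<bar> + 3"])
    have top: "filterlim (\<lambda>n. \<theta> * c n) at_top sequentially"
      by (rule filterlim_at_top_mono[OF c_top]) (use \<theta> c(1) in \<open>simp add: less_imp_le\<close>)
    have "(\<lambda>n. \<theta> * c n / c n) \<longlonglongrightarrow> \<theta>" using c(2) by simp
    note lim = AE_tendsto_indicator(1)[OF c(1) this _ top, of 0]
    show "AE \<omega> in M. (\<lambda>n. ?F n (X (\<theta> * c n) \<omega>) / c n) \<longlonglongrightarrow> max (x - \<theta> * U 0 \<omega>) 0"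
      using lim[OF less_le_trans[OF zero_less_one \<theta>(1)]] AE_U_bounds[of 0]
    proof eventually_elim
      case (elim \<omega>)
      have "(\<lambda>n. min (max (real_of_int (z n) / c n - real_of_int (X (\<theta> * c n) \<omega> 0) / c n) 0) (real_of_int (w n) / c n))
          \<longlonglongrightarrow> min (max (x - \<theta> * U 0 \<omega>) 0) (x + 3)"
        by (intro tendsto_intros z_lim w_lim elim(1))
      moreover have "?F n (X (\<theta> * c n) \<omega>) / c n
          = min (max (real_of_int (z n) / c n - real_of_int (X (\<theta> * c n) \<omega> 0) / c n) 0) (real_of_int (w n) / c n)" for n
      proof -
        have div: "min a b / c n = min (a / c n) (b / c n)" "max a b / c n = max (a / c n) (b / c n)" for a b
          using c(1)[of n] by (simp_all add: min_def max_def divide_le_cancel)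
        show ?thesis unfolding ramp_def of_int_min of_int_max of_int_diff div diff_divide_distrib by simp
      qed
      moreover have "min (max (x - \<theta> * U 0 \<omega>) 0) (x + 3) = max (x - \<theta> * U 0 \<omega>) 0"
      proof -
        have "- 1 \<le> U 0 \<omega>" using elim(2) rho by simp
        then have "- 2 \<le> \<theta> * U 0 \<omega>" using \<theta>
          by (smt (verit, best) mult_le_cancel_left mult_minus_right mult_cancel_left1)
        then show ?thesis using x by simp
      qed
      ultimately show ?case by simp
    qed
    show "AE \<omega> in M. norm (?F n (X (\<theta> * c n) \<omega>) / c n) \<le> \<bar>x\<bar> + 3" for n
    proof (rule AE_I2)
      fix \<omega>
      have "norm (?F n (X (\<theta> * c n) \<omega>) / c n) \<le> real_of_int (w n) / c n"
        using ramp_le[of n "X (\<theta> * c n) \<omega>"] c(1)[of n] by (simp add: divide_right_mono)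
      also have "\<dots> \<le> \<bar>x\<bar> + 3"
      proof -
        have "real_of_int (z n) \<le> x * c n" unfolding z_def by linarith
        also have "\<dots> \<le> \<bar>x\<bar> * c n" using c(1)[of n] by (intro mult_right_mono) auto
        finally have "real_of_int (w n) \<le> (\<bar>x\<bar> + 3) * c n" by (simp add: w_def c_def algebra_simps)
        then show ?thesis using c(1)[of n] by (simp add: pos_divide_le_eq)
      qed
      finally show "norm (?F n (X (\<theta> * c n) \<omega>) / c n) \<le> \<bar>x\<bar> + 3" .
    qed
    show "(\<lambda>\<omega>. ?F n (X (\<theta> * c n) \<omega>) / c n) \<in> borel_measurable M" for n
      using measurable_local[OF loc] by (rule borel_measurable_divide) simp
  qed simp_all
  define q where "q n = (expectation (\<lambda>\<omega>. ?F n (pos ((1 + \<delta>) * c n) (clk \<omega>)) / c n)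
      - expectation (\<lambda>\<omega>. ?F n (X (1 * c n) \<omega>) / c n)) / \<delta>" for n
  have q: "q \<longlonglongrightarrow> (ramp_mean x (1 + \<delta>) - ramp_mean x 1) / \<delta>"
    unfolding q_def using \<delta> by (intro tendsto_intros ramp_lim) auto
  have qe: "\<bar>q n - e n\<bar> \<le> 1 / \<delta> * (1 / c n)" for n
  proof -
    let ?a = "expectation (\<lambda>\<omega>. ?F n (pos ((1 + \<delta>) * c n) (clk \<omega>)))" and ?b = "expectation (\<lambda>\<omega>. ?F n (X (c n) \<omega>))"
    have "q n - e n = (?a - ?b - ((1 + \<delta>) * c n - c n) * e n) / (\<delta> * c n)"
      unfolding q_def using c(2)[of n] \<delta>(1) by (simp add: field_simps)
    then have "\<bar>q n - e n\<bar> = \<bar>?a - ?b - ((1 + \<delta>) * c n - c n) * e n\<bar> / (\<delta> * c n)"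
      using c(1)[of n] \<delta>(1) by (simp add: abs_mult)
    also have "\<dots> \<le> 1 / (\<delta> * c n)"
      using \<xi>(3)[of n] c(1)[of n] \<delta>(1) unfolding e_def by (intro divide_right_mono) auto
    finally show ?thesis by simp
  qed
  have "(\<lambda>n. q n - e n) \<longlonglongrightarrow> 0"
  proof (rule Lim_null_comparison)
    show "\<forall>\<^sub>F n in sequentially. norm (q n - e n) \<le> 1 / \<delta> * (1 / c n)"
      unfolding real_norm_def by (intro always_eventually allI qe)
    show "(\<lambda>n. 1 / \<delta> * (1 / c n)) \<longlonglongrightarrow> 0"
      using tendsto_mult[OF tendsto_const inv_c, of "1 / \<delta>"] by simp
  qed
  from tendsto_diff[OF q this]
  have e: "e \<longlonglongrightarrow> (ramp_mean x (1 + \<delta>) - ramp_mean x 1) / \<delta>" by simp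
  have "\<xi> n / c n \<in> {1..1 + \<delta>}" for n
    using \<xi>(1,2)[of n] c(1)[of n] by (auto simp: pos_le_divide_eq pos_divide_le_eq)
  then obtain \<tau> r where \<tau>: "\<tau> \<in> {1..1 + \<delta>}" and r: "strict_mono r" "((\<lambda>n. \<xi> n / c n) \<circ> r) \<longlonglongrightarrow> \<tau>"
    using seq_compactE[OF compact_imp_seq_compact[OF compact_Icc[of 1 "1 + \<delta>"]], of "\<lambda>n. \<xi> n / c n"] by metis
  have \<xi>r: "(\<lambda>n. \<xi> (r n) / c (r n)) \<longlonglongrightarrow> \<tau>" using r(2) by (simp add: comp_def)
  have top: "filterlim (\<lambda>n. \<xi> (r n)) at_top sequentially"
  proof (rule filterlim_at_top_mono)
    show "filterlim (\<lambda>n. c (r n)) at_top sequentially"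
      by (rule filterlim_compose[OF c_top filterlim_subseq[OF r(1)]])
  qed (simp add: less_imp_le \<xi>(1))
  have ind: "AE \<omega> in M. (\<lambda>n. below (y * c (r n)) (X (\<xi> (r n)) \<omega>) m) \<longlonglongrightarrow> occ (y / \<tau>) m \<omega>" for y m
    using AE_tendsto_indicator(2)[OF c(1) \<xi>r _ top, of m y] \<tau>
    by (simp add: below_def occ_def pos_le_divide_eq mult.commute)
  have e_eq: "e n = expectation (\<lambda>\<omega>. jump p (below (x * c n) (X (\<xi> n) \<omega>) 0) (below (x * c n) (X (\<xi> n) \<omega>) 1)
      - jump p (below (- 3 * c n) (X (\<xi> n) \<omega>) 0) (below (- 3 * c n) (X (\<xi> n) \<omega>) 1))" for n
    unfolding e_def below_z[symmetric] zw[symmetric]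
    by (rule expectation_gen_ramp) (use w \<xi>(1)[of n] c(1)[of n] in auto)
  have "(\<lambda>n. e (r n)) \<longlonglongrightarrow> current (x / \<tau>)"
    unfolding e_eq current_def
  proof (rule integral_dominated_convergence[where w = "\<lambda>_. 2"])
    show "AE \<omega> in M. (\<lambda>n. jump p (below (x * c (r n)) (X (\<xi> (r n)) \<omega>) 0) (below (x * c (r n)) (X (\<xi> (r n)) \<omega>) 1)
      - jump p (below (- 3 * c (r n)) (X (\<xi> (r n)) \<omega>) 0) (below (- 3 * c (r n)) (X (\<xi> (r n)) \<omega>) 1))
      \<longlonglongrightarrow> jump p (occ (x / \<tau>) 0 \<omega>) (occ (x / \<tau>) 1 \<omega>)"
      using ind[of x 0] ind[of x 1] ind[of "-3" 0] ind[of "-3" 1] AE_U_bounds[of 0] AE_U_bounds[of 1]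
    proof eventually_elim
      case (elim \<omega>)
      \<comment> \<open>Almost surely no speed is below -1, and \<tau> is at most 2; so the current
        at the lower threshold vanishes.\<close>
      have "- 3 / \<tau> < - 1" using \<tau> \<delta> by (simp add: divide_less_eq)
      then have 0: "occ (- 3 / \<tau>) 0 \<omega> = 0" "occ (- 3 / \<tau>) 1 \<omega> = 0"
        using elim(5,6) rho by (auto simp: occ_def)
      have "(\<lambda>n. jump p (below (x * c (r n)) (X (\<xi> (r n)) \<omega>) 0) (below (x * c (r n)) (X (\<xi> (r n)) \<omega>) 1)
        - jump p (below (- 3 * c (r n)) (X (\<xi> (r n)) \<omega>) 0) (below (- 3 * c (r n)) (X (\<xi> (r n)) \<omega>) 1))
        \<longlonglongrightarrow> jump p (occ (x / \<tau>) 0 \<omega>) (occ (x / \<tau>) 1 \<omega>) - jump p (occ (- 3 / \<tau>) 0 \<omega>) (occ (- 3 / \<tau>) 1 \<omega>)"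
        unfolding jump_def by (intro tendsto_intros elim)
      then show ?case unfolding 0 by (simp add: jump_def)
    qed
    show "AE \<omega> in M. norm (jump p (below (x * c (r n)) (X (\<xi> (r n)) \<omega>) 0) (below (x * c (r n)) (X (\<xi> (r n)) \<omega>) 1)
      - jump p (below (- 3 * c (r n)) (X (\<xi> (r n)) \<omega>) 0) (below (- 3 * c (r n)) (X (\<xi> (r n)) \<omega>) 1)) \<le> 2" for n
    proof (rule AE_I2)
      have "\<bar>a - b\<bar> \<le> 2" if "\<bar>a\<bar> \<le> 1" "\<bar>b\<bar> \<le> 1" for a b :: real using that by linarith
      then show "norm (jump p (below (x * c (r n)) (X (\<xi> (r n)) \<omega>) 0) (below (x * c (r n)) (X (\<xi> (r n)) \<omega>) 1)
      - jump p (below (- 3 * c (r n)) (X (\<xi> (r n)) \<omega>) 0) (below (- 3 * c (r n)) (X (\<xi> (r n)) \<omega>) 1)) \<le> 2" for \<omega>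
        unfolding real_norm_def by (blast intro: abs_jump_le[OF p01 below_cases below_cases])
    qed
  qed (simp_all add: jump_def)
  moreover have "(\<lambda>n. e (r n)) \<longlonglongrightarrow> (ramp_mean x (1 + \<delta>) - ramp_mean x 1) / \<delta>"
    using LIMSEQ_subseq_LIMSEQ[OF e r(1)] by (simp add: comp_def)
  ultimately show ?thesis using \<tau> LIMSEQ_unique by blast
qed

text \<open>The integral of \<open>x - \<theta> * u\<close> over
  \<open>{-\<rho>..x / \<theta>}\<close> against the density \<open>1 / (2 * \<rho>)\<close>; the
  numerator is \<open>(x + \<theta> * \<rho>)\<^sup>2 / \<theta>\<close> expanded.
  \<open>1 \<le> \<theta>\<close> keeps \<open>x / \<theta>\<close> within the support.\<close>

lemma ramp_mean_eq:
  assumes x: "-\<rho> \<le> x" "x \<le> \<rho>" and \<theta>: "1 \<le> \<theta>"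
  shows "ramp_mean x \<theta> = (x\<^sup>2 / \<theta> + 2 * x * \<rho> + \<theta> * \<rho>\<^sup>2) / (4 * \<rho>)"
proof -
  have bounds: "- \<rho> \<le> x / \<theta>" "x / \<theta> \<le> \<rho>"
  proof -
    have "\<rho> \<le> \<rho> * \<theta>" using \<theta> rho by simp
    then show "- \<rho> \<le> x / \<theta>" "x / \<theta> \<le> \<rho>"
      using \<theta> x by (auto simp: pos_le_divide_eq pos_divide_le_eq)
  qed
  have "ramp_mean x \<theta> = (\<integral>u. max (x - \<theta> * u) 0 \<partial>distr M borel (U 0))"
    unfolding ramp_mean_def by (rule integral_distr[symmetric]) simp_all
  also have "\<dots> = (\<integral>u. max (x - \<theta> * u) 0 \<partial>density lborel (\<lambda>u. ennreal (indicator {-\<rho>..\<rho>} u / (2 * \<rho>))))"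
  proof -
    have "uniform_measure lborel {-\<rho>..\<rho>} = density lborel (\<lambda>u. ennreal (indicator {-\<rho>..\<rho>} u / (2 * \<rho>)))"
      unfolding uniform_measure_def using rho
      by (intro density_cong) (auto simp: indicator_def divide_ennreal simp flip: ennreal_1)
    then show ?thesis by (simp add: distr_U)
  qed
  also have "\<dots> = (\<integral>u. indicator {-\<rho>..\<rho>} u / (2 * \<rho>) * max (x - \<theta> * u) 0 \<partial>lborel)"
    using rho by (subst integral_real_density) auto
  also have "\<dots> = (\<integral>u. 1 / (2 * \<rho>) * (indicator {-\<rho>..x / \<theta>} u *\<^sub>R (x - \<theta> * u)) \<partial>lborel)"
  proof (rule Bochner_Integration.integral_cong[OF refl])
    fix u
    have "x - \<theta> * u \<le> 0 \<longleftrightarrow> x / \<theta> \<le> u" using \<theta> by (simp add: pos_divide_le_eq mult.commute)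
    then show "indicator {-\<rho>..\<rho>} u / (2 * \<rho>) * max (x - \<theta> * u) 0 = 1 / (2 * \<rho>) * (indicator {-\<rho>..x / \<theta>} u *\<^sub>R (x - \<theta> * u))"
      using bounds \<theta> by (cases "u = x / \<theta>") (auto simp: indicator_def max_def)
  qed
  also have "\<dots> = 1 / (2 * \<rho>) * (\<integral>u. indicator {-\<rho>..x / \<theta>} u *\<^sub>R (x - \<theta> * u) \<partial>lborel)"
    by (rule integral_mult_right_zero)
  also have "(\<integral>u. indicator {-\<rho>..x / \<theta>} u *\<^sub>R (x - \<theta> * u) \<partial>lborel)
      = (x * (x / \<theta>) - \<theta> * (x / \<theta>)\<^sup>2 / 2) - (x * (-\<rho>) - \<theta> * (-\<rho>)\<^sup>2 / 2)"
    by (rule integral_FTC_Icc[OF bounds(1)])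
      (auto intro!: derivative_eq_intros continuous_intros simp: has_real_derivative_iff_has_vector_derivative[symmetric])
  also have "1 / (2 * \<rho>) * ((x * (x / \<theta>) - \<theta> * (x / \<theta>)\<^sup>2 / 2) - (x * (-\<rho>) - \<theta> * (-\<rho>)\<^sup>2 / 2))
      = (x\<^sup>2 / \<theta> + 2 * x * \<rho> + \<theta> * \<rho>\<^sup>2) / (4 * \<rho>)"
    using \<theta> rho by (simp add: field_simps power2_eq_square)
  finally show ?thesis .
qed

text \<open>The right-hand side is the derivative of \<open>ramp_mean x\<close> at 1. As the
  increment \<delta> tends to 0, the points \<open>x / \<tau>\<close> tend to \<open>x\<close>,
  where the current is continuous because the speeds have no atoms.\<close>

lemma current_eq:
  assumes x: "-\<rho> \<le> x" "x \<le> \<rho>"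
  shows "current x = (\<rho>\<^sup>2 - x\<^sup>2) / (4 * \<rho>)"
proof -
  define \<delta> where "\<delta> n = 1 / real (Suc n)" for n
  have \<delta>: "0 < \<delta> n" "\<delta> n \<le> 1" for n by (simp_all add: \<delta>_def)
  have \<delta>_lim: "\<delta> \<longlonglongrightarrow> 0"
    unfolding \<delta>_def using LIMSEQ_inverse_real_of_nat by (simp add: inverse_eq_divide)
  have "\<forall>n. \<exists>\<tau>\<in>{1..1 + \<delta> n}. (ramp_mean x (1 + \<delta> n) - ramp_mean x 1) / \<delta> n = current (x / \<tau>)"
    using x rho \<delta> by (intro allI current_mean_value) auto
  then obtain \<tau> where \<tau>: "\<And>n. \<tau> n \<in> {1..1 + \<delta> n}"
    "\<And>n. (ramp_mean x (1 + \<delta> n) - ramp_mean x 1) / \<delta> n = current (x / \<tau> n)"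
    by metis
  have "(ramp_mean x (1 + \<delta> n) - ramp_mean x 1) / \<delta> n = (\<rho>\<^sup>2 - x\<^sup>2 / (1 + \<delta> n)) / (4 * \<rho>)" for n
    using \<delta>(1)[of n] rho by (simp add: ramp_mean_eq[OF x] divide_simps) (simp add: algebra_simps power2_eq_square)
  moreover have "(\<lambda>n. (\<rho>\<^sup>2 - x\<^sup>2 / (1 + \<delta> n)) / (4 * \<rho>)) \<longlonglongrightarrow> (\<rho>\<^sup>2 - x\<^sup>2 / (1 + 0)) / (4 * \<rho>)"
    using rho by (intro tendsto_intros \<delta>_lim) auto
  ultimately have 1: "(\<lambda>n. current (x / \<tau> n)) \<longlonglongrightarrow> (\<rho>\<^sup>2 - x\<^sup>2) / (4 * \<rho>)"
    by (simp add: \<tau>(2))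
  have "\<tau> \<longlonglongrightarrow> 1"
  proof (rule tendsto_sandwich[where f = "\<lambda>_. 1" and h = "\<lambda>n. 1 + \<delta> n"])
    show "(\<lambda>n. 1 + \<delta> n) \<longlonglongrightarrow> 1" using tendsto_add[OF tendsto_const \<delta>_lim, of 1] by simp
  qed (use \<tau>(1) in auto)
  then have lim: "(\<lambda>n. x / \<tau> n) \<longlonglongrightarrow> x" using tendsto_divide[OF tendsto_const, of \<tau> 1 _ x] by simp
  have occ_lim: "AE \<omega> in M. (\<lambda>n. occ (x / \<tau> n) m \<omega>) \<longlonglongrightarrow> occ x m \<omega>" for m
    using AE_U_ne[of m x]
  proof eventually_elim
    case (elim \<omega>)
    then consider "U m \<omega> < x" | "x < U m \<omega>" by linarith
    then have "\<forall>\<^sub>F n in sequentially. (U m \<omega> \<le> x / \<tau> n) = (U m \<omega> \<le> x)"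
    proof cases
      case 1
      then show ?thesis using order_tendstoD(1)[OF lim 1] by (auto elim: eventually_mono)
    next
      case 2
      then show ?thesis using order_tendstoD(2)[OF lim 2] by (auto elim: eventually_mono)
    qed
    then show ?case unfolding occ_def by (intro tendsto_eventually) (auto elim: eventually_mono)
  qed
  have "(\<lambda>n. current (x / \<tau> n)) \<longlonglongrightarrow> current x"
    unfolding current_def
  proof (rule integral_dominated_convergence[where w = "\<lambda>_. 1"])
    show "AE \<omega> in M. (\<lambda>n. jump p (occ (x / \<tau> n) 0 \<omega>) (occ (x / \<tau> n) 1 \<omega>)) \<longlonglongrightarrow> jump p (occ x 0 \<omega>) (occ x 1 \<omega>)"
      using occ_lim[of 0] occ_lim[of 1]
    proof eventually_elim
      case (elim \<omega>)
      then show ?case unfolding jump_def by (intro tendsto_intros)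
    qed
    show "AE \<omega> in M. norm (jump p (occ (x / \<tau> n) 0 \<omega>) (occ (x / \<tau> n) 1 \<omega>)) \<le> 1" for n
      using abs_jump_le[OF p01 occ_cases occ_cases] by simp
  qed (simp_all add: jump_def)
  with 1 show ?thesis by (rule LIMSEQ_unique[rotated])
qed

lemma integrable_occ:
  "integrable M (\<lambda>\<omega>. jump p (occ x i \<omega>) (occ x j \<omega>) * (1 - occ y k \<omega>))"
  "integrable M (\<lambda>\<omega>. occ x i \<omega> * jump p (occ y j \<omega>) (occ y k \<omega>))"
  "integrable M (\<lambda>\<omega>. occ x i \<omega> * (1 - occ y j \<omega>))"
proof -
  have 1: "\<bar>a * b\<bar> \<le> 1" if "\<bar>a\<bar> \<le> 1" "\<bar>b\<bar> \<le> 1" for a b :: real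
    unfolding abs_mult using mult_mono[OF that] by simp
  have o: "\<bar>occ x m \<omega>\<bar> \<le> 1" "\<bar>1 - occ x m \<omega>\<bar> \<le> 1" for x m \<omega> by (simp_all add: occ_def)
  note j = abs_jump_le[OF p01 occ_cases occ_cases]
  show "integrable M (\<lambda>\<omega>. jump p (occ x i \<omega>) (occ x j \<omega>) * (1 - occ y k \<omega>))"
    by (rule integrable_const_bound[of _ 1], unfold real_norm_def, intro AE_I2 1 j o) (simp add: jump_def)
  show "integrable M (\<lambda>\<omega>. occ x i \<omega> * jump p (occ y j \<omega>) (occ y k \<omega>))"
    by (rule integrable_const_bound[of _ 1], unfold real_norm_def, intro AE_I2 1 j o) (simp add: jump_def)
  show "integrable M (\<lambda>\<omega>. occ x i \<omega> * (1 - occ y j \<omega>))"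
    by (rule integrable_const_bound[of _ 1], unfold real_norm_def, intro AE_I2 1 o) simp
qed

definition corr1 :: "real \<Rightarrow> real \<Rightarrow> int \<Rightarrow> real" where
  "corr1 x y k = expectation (\<lambda>\<omega>. jump p (occ x 0 \<omega>) (occ x 1 \<omega>) * (1 - occ y k \<omega>))"

definition corr2 :: "real \<Rightarrow> real \<Rightarrow> int \<Rightarrow> real" where
  "corr2 x y k = expectation (\<lambda>\<omega>. occ x 0 \<omega> * jump p (occ y k \<omega>) (occ y (k + 1) \<omega>))"

lemma corr1_translate:
  "expectation (\<lambda>\<omega>. jump p (occ x (- 1) \<omega>) (occ x 0 \<omega>) * (1 - occ y k \<omega>)) = corr1 x y (k + 1)"
  using expectation_translate[where g = "\<lambda>u v w. jump p (of_bool (u \<le> x)) (of_bool (v \<le> x)) * (1 - of_bool (w \<le> y))"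
      and i = "-1" and j = 0 and k = k and n = 1]
  by (simp add: corr1_def occ_def jump_def)

definition pair_current :: "real \<Rightarrow> real \<Rightarrow> real" where
  "pair_current x y = p * expectation (\<lambda>\<omega>. occ x 0 \<omega> * (1 - occ y 1 \<omega>))
    - (1 - p) * expectation (\<lambda>\<omega>. occ x 1 \<omega> * (1 - occ y 0 \<omega>))"

text \<open>Stationarity for \<open>k = 1\<close>. The current at the edge -1, seen together with
  label 1, becomes after translation the current at the edge 0 seen with label 2; hence the
  arguments 2 and 1.\<close>

lemma pair_current_near:
  assumes "x \<le> y"
  shows "corr1 x y 2 + corr2 x y 1 = pair_current x y"
proof -
  let ?\<Psi> = "\<lambda>a b :: int \<Rightarrow> real. jump p (a (- 1)) (a 0) * (1 - b 1)
      + ((1 - p) * a 1 * (1 - b 0) - p * a 0 * (1 - b 1)) + a 0 * jump p (b 1) (b 2)"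
  have "expectation (\<lambda>\<omega>. ?\<Psi> (\<lambda>m. occ x m \<omega>) (\<lambda>m. occ y m \<omega>)) = 0"
  proof (rule stationary[where k = 1 and \<Psi> = ?\<Psi>])
    show "gen (window (Suc 1)) p (pair_test (x * c) (y * c) 1) \<pi> = ?\<Psi> (below (x * c) \<pi>) (below (y * c) \<pi>)"
      if "0 < c" for c \<pi>
      by (rule gen_pair_test_near) (use assms that in simp)
    show "(\<lambda>n. ?\<Psi> (a n) (b n)) \<longlonglongrightarrow> ?\<Psi> a' b'"
      if "\<And>m. (\<lambda>n. a n m) \<longlonglongrightarrow> a' m" "\<And>m. (\<lambda>n. b n m) \<longlonglongrightarrow> b' m" for a b :: "nat \<Rightarrow> int \<Rightarrow> real" and a' b'
      unfolding jump_def by (intro tendsto_intros that)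
    show "(\<lambda>\<omega>. ?\<Psi> (\<lambda>m. occ x m \<omega>) (\<lambda>m. occ y m \<omega>)) \<in> borel_measurable M"
      unfolding jump_def by measurable
  qed
  also have "expectation (\<lambda>\<omega>. ?\<Psi> (\<lambda>m. occ x m \<omega>) (\<lambda>m. occ y m \<omega>)) = corr1 x y (1 + 1)
      + ((1 - p) * expectation (\<lambda>\<omega>. occ x 1 \<omega> * (1 - occ y 0 \<omega>)) - p * expectation (\<lambda>\<omega>. occ x 0 \<omega> * (1 - occ y 1 \<omega>)))
      + corr2 x y 1"
    unfolding corr1_translate[symmetric] corr2_def mult.assoc
    by (simp add: integrable_occ)
  finally show ?thesis by (simp add: pair_current_def)
qed

text \<open>Stationarity for labels at distance \<open>k\<close> balances four currents; translated,
  it says that \<open>corr1\<close> at \<open>k + 1\<close> plus \<open>corr2\<close> at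
  \<open>k\<close> does not change when \<open>k\<close> is lowered by one.\<close>

lemma pair_current_far:
  assumes k: "2 \<le> k"
  shows "corr1 x y (int k + 1) + corr2 x y (int k) = corr1 x y (int k) + corr2 x y (int k - 1)"
proof -
  let ?\<Psi> = "\<lambda>a b :: int \<Rightarrow> real. jump p (a (- 1)) (a 0) * (1 - b (int k)) - jump p (a 0) (a 1) * (1 - b (int k))
      - a 0 * jump p (b (int k - 1)) (b (int k)) + a 0 * jump p (b (int k)) (b (int k + 1))"
  have "expectation (\<lambda>\<omega>. ?\<Psi> (\<lambda>m. occ x m \<omega>) (\<lambda>m. occ y m \<omega>)) = 0"
  proof (rule stationary[where k = k and \<Psi> = ?\<Psi>])
    show "gen (window (Suc k)) p (pair_test (x * c) (y * c) k) \<pi> = ?\<Psi> (below (x * c) \<pi>) (below (y * c) \<pi>)"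
      if "0 < c" for c \<pi>
      by (rule gen_pair_test_far[OF k])
    show "(\<lambda>n. ?\<Psi> (a n) (b n)) \<longlonglongrightarrow> ?\<Psi> a' b'"
      if "\<And>m. (\<lambda>n. a n m) \<longlonglongrightarrow> a' m" "\<And>m. (\<lambda>n. b n m) \<longlonglongrightarrow> b' m" for a b :: "nat \<Rightarrow> int \<Rightarrow> real" and a' b'
      unfolding jump_def by (intro tendsto_intros that)
    show "(\<lambda>\<omega>. ?\<Psi> (\<lambda>m. occ x m \<omega>) (\<lambda>m. occ y m \<omega>)) \<in> borel_measurable M"
      unfolding jump_def by measurable
  qed
  also have "expectation (\<lambda>\<omega>. ?\<Psi> (\<lambda>m. occ x m \<omega>) (\<lambda>m. occ y m \<omega>)) = corr1 x y (int k + 1) - corr1 x y (int k)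
      - corr2 x y (int k - 1) + corr2 x y (int k)"
    unfolding corr1_translate[symmetric] corr2_def
    unfolding corr1_def by (simp add: integrable_occ)
  finally show ?thesis by simp
qed

lemma pair_current_const:
  assumes "x \<le> y"
  shows "corr1 x y (int (Suc (Suc k))) + corr2 x y (int (Suc k)) = pair_current x y"
proof (induction k)
  case 0
  then show ?case using pair_current_near[OF assms] by simp
next
  case (Suc k)
  then show ?case using pair_current_far[of "Suc (Suc k)" x y] by simp
qed

lemma occ_speed: "occ x k \<omega> = of_bool (speed (shift_clocks k (clk \<omega>)) \<le> x)"
  by (simp add: occ_def U_def)

text \<open>\<open>mixing\<close> speaks of events, so the current is split into two weighted
  events: an occupied label followed by a vacant one, and the reverse.\<close>

lemma corr1_tendsto:
  assumes y: "-\<rho> \<le> y" "y \<le> \<rho>"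
  shows "(\<lambda>k. corr1 x y (int k)) \<longlonglongrightarrow> current x * ((\<rho> - y) / (2 * \<rho>))"
proof -
  let ?S1 = "\<lambda>\<omega>. speed \<omega> \<le> x \<and> \<not> speed (shift_clocks 1 \<omega>) \<le> x"
  let ?S2 = "\<lambda>\<omega>. \<not> speed \<omega> \<le> x \<and> speed (shift_clocks 1 \<omega>) \<le> x"
  let ?T = "\<lambda>\<omega>. \<not> speed \<omega> \<le> y"
  let ?e = "\<lambda>S. expectation (\<lambda>\<omega>. of_bool (S (clk \<omega>)) :: real)"
  let ?m = "\<lambda>S k. expectation (\<lambda>\<omega>. of_bool (S (clk \<omega>)) * of_bool (?T (shift_clocks (int k) (clk \<omega>))) :: real)"
  have meas: "Measurable.pred clock_space ?S1" "Measurable.pred clock_space ?S2" "Measurable.pred clock_space ?T"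
    by measurable
  note [measurable] = meas
  have jump: "jump p (occ x 0 \<omega>) (occ x 1 \<omega>) = p * of_bool (?S1 (clk \<omega>)) - (1 - p) * of_bool (?S2 (clk \<omega>))" for \<omega>
    unfolding occ_speed jump_def by (simp add: of_bool_def)
  have int: "integrable M (\<lambda>\<omega>. of_bool (S (clk \<omega>)) * of_bool (?T (shift_clocks (int k) (clk \<omega>))) :: real)"
    "integrable M (\<lambda>\<omega>. of_bool (S (clk \<omega>)) :: real)"
    if [measurable]: "Measurable.pred clock_space S" for S k
    by (rule integrable_const_bound[of _ 1]; simp)+
  have "corr1 x y (int k) = p * ?m ?S1 k - (1 - p) * ?m ?S2 k" for k
  proof -
    have "corr1 x y (int k) = expectation (\<lambda>\<omega>. p * (of_bool (?S1 (clk \<omega>)) * of_bool (?T (shift_clocks (int k) (clk \<omega>))))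
        - (1 - p) * (of_bool (?S2 (clk \<omega>)) * of_bool (?T (shift_clocks (int k) (clk \<omega>)))))"
      unfolding corr1_def jump occ_speed
      by (intro Bochner_Integration.integral_cong refl) (simp add: of_bool_def jump_def algebra_simps)
    also have "\<dots> = p * ?m ?S1 k - (1 - p) * ?m ?S2 k"
      by (subst Bochner_Integration.integral_diff)
        (auto simp only: integral_mult_right_zero intro!: integrable_mult_right int meas)
    finally show ?thesis .
  qed
  moreover have "(\<lambda>k. p * ?m ?S1 k - (1 - p) * ?m ?S2 k) \<longlonglongrightarrow> p * (?e ?S1 * ?e ?T) - (1 - p) * (?e ?S2 * ?e ?T)"
    by (intro tendsto_intros mixing) measurable
  moreover have "p * (?e ?S1 * ?e ?T) - (1 - p) * (?e ?S2 * ?e ?T) = current x * ((\<rho> - y) / (2 * \<rho>))"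
  proof -
    have c: "current x = p * ?e ?S1 - (1 - p) * ?e ?S2"
      unfolding current_def jump
      by (subst Bochner_Integration.integral_diff)
        (auto simp only: integral_mult_right_zero intro!: integrable_mult_right int meas)
    have T: "?e ?T = (\<rho> - y) / (2 * \<rho>)"
    proof -
      have "?e ?T = expectation (\<lambda>\<omega>. 1 - of_bool (U 0 \<omega> \<le> y))"
        by (intro Bochner_Integration.integral_cong refl) (simp add: U_def of_bool_def)
      also have "\<dots> = 1 - (y + \<rho>) / (2 * \<rho>)"
        using prob_U_le[OF y, of 0] integrable_const_bound[of "\<lambda>\<omega>. of_bool (U 0 \<omega> \<le> y) :: real" 1]
        by (subst Bochner_Integration.integral_diff) (simp_all add: prob_space)
      finally show ?thesis using rho by (simp add: field_simps)
    qed
    have "p * (a * t) - (1 - p) * (b * t) = (p * a - (1 - p) * b) * t" for a b t :: real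
      by (simp add: algebra_simps)
    then show ?thesis unfolding c T .
  qed
  ultimately show ?thesis by simp
qed

lemma corr2_tendsto:
  assumes x: "-\<rho> \<le> x" "x \<le> \<rho>"
  shows "(\<lambda>k. corr2 x y (int k)) \<longlonglongrightarrow> (x + \<rho>) / (2 * \<rho>) * current y"
proof -
  let ?S1 = "\<lambda>\<omega>. speed \<omega> \<le> y \<and> \<not> speed (shift_clocks 1 \<omega>) \<le> y"
  let ?S2 = "\<lambda>\<omega>. \<not> speed \<omega> \<le> y \<and> speed (shift_clocks 1 \<omega>) \<le> y"
  let ?T = "\<lambda>\<omega>. speed \<omega> \<le> x"
  let ?e = "\<lambda>S. expectation (\<lambda>\<omega>. of_bool (S (clk \<omega>)) :: real)"
  let ?m = "\<lambda>S k. expectation (\<lambda>\<omega>. of_bool (?T (clk \<omega>)) * of_bool (S (shift_clocks (int k) (clk \<omega>))) :: real)"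
  have meas: "Measurable.pred clock_space ?S1" "Measurable.pred clock_space ?S2" "Measurable.pred clock_space ?T"
    by measurable
  note [measurable] = meas
  have jump: "jump p (occ y k \<omega>) (occ y (k + 1) \<omega>)
      = p * of_bool (?S1 (shift_clocks k (clk \<omega>))) - (1 - p) * of_bool (?S2 (shift_clocks k (clk \<omega>)))" for k \<omega>
    unfolding occ_speed jump_def shift_clocks_add by (simp add: of_bool_def add.commute)
  have int: "integrable M (\<lambda>\<omega>. of_bool (?T (clk \<omega>)) * of_bool (S (shift_clocks (int k) (clk \<omega>))) :: real)"
    "integrable M (\<lambda>\<omega>. of_bool (S (clk \<omega>)) :: real)"
    if [measurable]: "Measurable.pred clock_space S" for S k
    by (rule integrable_const_bound[of _ 1]; simp)+
  have "corr2 x y (int k) = p * ?m ?S1 k - (1 - p) * ?m ?S2 k" for k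
  proof -
    have "corr2 x y (int k) = expectation (\<lambda>\<omega>. p * (of_bool (?T (clk \<omega>)) * of_bool (?S1 (shift_clocks (int k) (clk \<omega>))))
        - (1 - p) * (of_bool (?T (clk \<omega>)) * of_bool (?S2 (shift_clocks (int k) (clk \<omega>)))))"
      unfolding corr2_def jump occ_speed[of x 0]
      by (intro Bochner_Integration.integral_cong refl) (simp add: of_bool_def jump_def algebra_simps)
    also have "\<dots> = p * ?m ?S1 k - (1 - p) * ?m ?S2 k"
      by (subst Bochner_Integration.integral_diff)
        (auto simp only: integral_mult_right_zero intro!: integrable_mult_right int meas)
    finally show ?thesis .
  qed
  moreover have "(\<lambda>k. p * ?m ?S1 k - (1 - p) * ?m ?S2 k) \<longlonglongrightarrow> p * (?e ?T * ?e ?S1) - (1 - p) * (?e ?T * ?e ?S2)"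
    by (intro tendsto_intros mixing) measurable
  moreover have "p * (?e ?T * ?e ?S1) - (1 - p) * (?e ?T * ?e ?S2) = (x + \<rho>) / (2 * \<rho>) * current y"
  proof -
    have "current y = expectation (\<lambda>\<omega>. p * of_bool (?S1 (clk \<omega>)) - (1 - p) * of_bool (?S2 (clk \<omega>)))"
      unfolding current_def using jump[of 0] by simp
    also have "\<dots> = p * ?e ?S1 - (1 - p) * ?e ?S2"
      by (subst Bochner_Integration.integral_diff)
        (auto simp only: integral_mult_right_zero intro!: integrable_mult_right int meas)
    finally have c: "current y = p * ?e ?S1 - (1 - p) * ?e ?S2" .
    have T: "?e ?T = (x + \<rho>) / (2 * \<rho>)"
      using prob_U_le[OF x, of 0] by (simp add: U_def)
    have "p * (t * a) - (1 - p) * (t * b) = t * (p * a - (1 - p) * b)" for a b t :: real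
      by (simp add: algebra_simps)
    then show ?thesis unfolding c T .
  qed
  ultimately show ?thesis by simp
qed

text \<open>A sum that is constant in \<open>k\<close> equals its limit. Inserting the formula for
  the current leaves the common factor \<open>(\<rho> + x) * (\<rho> - y)\<close>, and the cofactors
  \<open>\<rho> - x\<close> and \<open>\<rho> + y\<close> add up.\<close>

lemma pair_current_eq:
  assumes "-\<rho> \<le> x" "x \<le> y" "y \<le> \<rho>"
  shows "pair_current x y = (\<rho> + x) * (\<rho> - y) * (2 * \<rho> + y - x) / (8 * \<rho>\<^sup>2)"
proof -
  have "(\<lambda>k. corr1 x y (int (Suc (Suc k))) + corr2 x y (int (Suc k)))
      \<longlonglongrightarrow> current x * ((\<rho> - y) / (2 * \<rho>)) + (x + \<rho>) / (2 * \<rho>) * current y"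
    using assms
    by (intro tendsto_add LIMSEQ_Suc[OF LIMSEQ_Suc[OF corr1_tendsto]] LIMSEQ_Suc[OF corr2_tendsto]) auto
  then have "pair_current x y = current x * ((\<rho> - y) / (2 * \<rho>)) + (x + \<rho>) / (2 * \<rho>) * current y"
    unfolding pair_current_const[OF assms(2)] by (simp add: LIMSEQ_const_iff)
  also have "\<dots> = (\<rho> + x) * (\<rho> - y) * (2 * \<rho> + y - x) / (8 * \<rho>\<^sup>2)"
    using assms rho by (simp add: current_eq divide_simps) (simp add: algebra_simps power2_eq_square)
  finally show ?thesis .
qed

end

subsection \<open>From quadrants to Borel sets\<close>

lemma sets_borel_quadrants:
  "sets (borel :: (real \<times> real) measure) = sigma_sets UNIV {{..x} \<times> {y<..} | (x::real) (y::real). True}"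
proof -
  have le: "\<Union> (range (\<lambda>n. {..real n})) = UNIV" by (auto simp: real_arch_simple)
  have ge: "\<Union> (range (\<lambda>n. {- real n<..})) = UNIV"
  proof -
    have "\<exists>n. - real n < v" for v using reals_Archimedean2[of "- v"] by (auto simp: minus_less_iff)
    then show ?thesis by auto
  qed
  have "sets (borel \<Otimes>\<^sub>M borel :: (real \<times> real) measure)
      = sets (sigma (space borel \<times> space borel) {a \<times> b | a b. a \<in> range (\<lambda>x::real. {..x}) \<and> b \<in> range (\<lambda>y::real. {y<..})})"
  proof (rule sets_pair_eq)
    show "sets (borel :: real measure) = sigma_sets (space borel) (range (\<lambda>x. {..x}))"
      by (subst borel_eq_atMost) simp
    show "sets (borel :: real measure) = sigma_sets (space borel) (range (\<lambda>y. {y<..}))"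
      by (subst borel_Ioi) simp
    show "countable (range (\<lambda>n. {..real n}))" "countable (range (\<lambda>n. {- real n<..}))" by auto
    show "\<Union> (range (\<lambda>n. {..real n})) = space borel" using le by simp
    show "\<Union> (range (\<lambda>n. {- real n<..})) = space borel" using ge by simp
  qed auto
  moreover have "{a \<times> b | a b. a \<in> range (\<lambda>x::real. {..x}) \<and> b \<in> range (\<lambda>y::real. {y<..})}
      = {{..x} \<times> {y<..} | (x::real) (y::real). True}" by blast
  ultimately have "sets (borel \<Otimes>\<^sub>M borel :: (real \<times> real) measure) = sigma_sets UNIV {{..x} \<times> {y<..} | (x::real) (y::real). True}"
    by simp
  then show ?thesis by (simp only: borel_prod)
qed

text \<open>The identity is given for quadrants with \<open>x \<le> y\<close>, while generating the
  Borel sets takes all quadrants. Intersection with \<open>Q\<close> turns any quadrant into the one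
  with parameters \<open>min x q\<close> and \<open>max y q\<close>, which are in the right order.
  The Dynkin argument tolerates the difference of measures, since it uses linear identities
  only.\<close>

lemma measure_eq_quadrant:
  fixes \<mu> \<mu>' \<nu> :: "(real \<times> real) measure" and a b q :: real
  defines "Q \<equiv> {..q} \<times> {q<..}"
  assumes fin: "finite_measure \<mu>" "finite_measure \<mu>'" "finite_measure \<nu>"
    and sets: "sets \<mu> = sets borel" "sets \<mu>' = sets borel" "sets \<nu> = sets borel"
    and eq: "\<And>x y. x \<le> y \<Longrightarrow> a * measure \<mu> ({..x} \<times> {y<..}) - b * measure \<mu>' ({..x} \<times> {y<..}) = measure \<nu> ({..x} \<times> {y<..})"
    and A: "A \<in> sets borel"
  shows "a * measure \<mu> (A \<inter> Q) - b * measure \<mu>' (A \<inter> Q) = measure \<nu> (A \<inter> Q)"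
proof -
  let ?G = "{{..x} \<times> {y<..} | (x::real) (y::real). True}"
  interpret \<mu>: finite_measure \<mu> by fact
  interpret \<mu>': finite_measure \<mu>' by fact
  interpret \<nu>: finite_measure \<nu> by fact
  have Q: "Q \<in> sets borel"
    using sigma_sets.Basic[of Q ?G UNIV] unfolding sets_borel_quadrants Q_def by blast
  have "Int_stable ?G"
  proof (rule Int_stableI)
    fix A B assume "A \<in> ?G" "B \<in> ?G"
    then obtain x y x' y' where "A = {..x} \<times> {y<..}" "B = {..x'} \<times> {y'<..}" by blast
    then have "A \<inter> B = {..min x x'} \<times> {max y y'<..}" by auto
    then show "A \<inter> B \<in> ?G" by blast
  qed
  moreover have "?G \<subseteq> Pow UNIV" by simp
  moreover have "A \<in> sigma_sets UNIV ?G" using A by (simp only: sets_borel_quadrants)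
  ultimately show ?thesis
  proof (induction rule: sigma_sets_induct_disjoint)
    case (basic A)
    then obtain x y where "A = {..x} \<times> {y<..}" by blast
    then have "A \<inter> Q = {..min x q} \<times> {max y q<..}" unfolding Q_def by auto
    then show ?case using eq[of "min x q" "max y q"] by simp
  next
    case empty
    show ?case by simp
  next
    case (compl A)
    then have A: "A \<in> sets borel" by (simp only: sets_borel_quadrants)
    have eqQ: "(UNIV - A) \<inter> Q = Q - A \<inter> Q" by auto
    have D: "measure N (Q - A \<inter> Q) = measure N Q - measure N (A \<inter> Q)"
      if "finite_measure N" "sets N = sets borel" for N
      using finite_measure.finite_measure_Diff[OF that(1), of Q "A \<inter> Q"] A Q that(2) by simp
    have "a * measure \<mu> Q - b * measure \<mu>' Q = measure \<nu> Q"
      using eq[of q q] by (simp add: Q_def)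
    then show ?case
      unfolding eqQ D[OF fin(1) sets(1)] D[OF fin(2) sets(2)] D[OF fin(3) sets(3)]
      using compl(2) by (simp add: right_diff_distrib)
  next
    case (union A)
    then have A: "A i \<in> sets borel" for i by (auto simp only: sets_borel_quadrants)
    have sums: "(\<lambda>i. measure N (A i \<inter> Q)) sums measure N ((\<Union>i. A i) \<inter> Q)"
      if "finite_measure N" "sets N = sets borel" for N
    proof -
      have "(\<lambda>i. measure N (A i \<inter> Q)) sums measure N (\<Union>i. A i \<inter> Q)"
      proof (rule finite_measure.finite_measure_UNION[OF that(1)])
        show "range (\<lambda>i. A i \<inter> Q) \<subseteq> sets N" using A Q that(2) by auto
        show "disjoint_family (\<lambda>i. A i \<inter> Q)" using union(1) unfolding disjoint_family_on_def by blast
      qed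
      also have "(\<Union>i. A i \<inter> Q) = (\<Union>i. A i) \<inter> Q" by blast
      finally show ?thesis .
    qed
    have "(\<lambda>i. a * measure \<mu> (A i \<inter> Q) - b * measure \<mu>' (A i \<inter> Q))
        sums (a * measure \<mu> ((\<Union>i. A i) \<inter> Q) - b * measure \<mu>' ((\<Union>i. A i) \<inter> Q))"
      by (intro sums_diff sums_mult sums fin sets)
    then show ?case
      unfolding union(3) using sums[OF fin(3) sets(3)] by (metis sums_unique2)
  qed
qed

text \<open>The region above the diagonal is covered by the quadrants whose corner is a rational
  point of the diagonal; making this countable cover disjoint cuts \<open>A\<close> into pieces to
  which \<open>measure_eq_quadrant\<close> applies.\<close>

lemma measure_eq_above_diagonal:
  fixes \<mu> \<mu>' \<nu> :: "(real \<times> real) measure" and a b :: real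
  assumes fin: "finite_measure \<mu>" "finite_measure \<mu>'" "finite_measure \<nu>"
    and sets: "sets \<mu> = sets borel" "sets \<mu>' = sets borel" "sets \<nu> = sets borel"
    and eq: "\<And>x y. x \<le> y \<Longrightarrow> a * measure \<mu> ({..x} \<times> {y<..}) - b * measure \<mu>' ({..x} \<times> {y<..}) = measure \<nu> ({..x} \<times> {y<..})"
    and A: "A \<in> sets borel" "A \<subseteq> {(x, y). x < y}"
  shows "a * measure \<mu> A - b * measure \<mu>' A = measure \<nu> A"
proof -
  define Q where "Q n = {..of_rat (from_nat n) :: real} \<times> {(of_rat (from_nat n) :: real)<..}" for n :: nat
  have Q: "Q n \<in> sets (borel :: (real \<times> real) measure)" for n
    unfolding sets_borel_quadrants Q_def by (intro sigma_sets.Basic) blast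
  define B where "B n = A \<inter> disjointed Q n" for n
  have dQ: "disjointed Q n \<in> sets borel" for n
    using sets.range_disjointed_sets[of Q borel] Q by auto
  have B: "B n \<in> sets borel" "B n \<inter> Q n = B n" for n
    using A(1) dQ disjointed_subset[of Q n] by (auto simp: B_def)
  have "A \<subseteq> (\<Union>n. Q n)"
  proof
    fix z assume "z \<in> A"
    then obtain x y where z: "z = (x, y)" "x < y" using A(2) by auto
    then obtain q where "x < of_rat q" "of_rat q < y" using of_rat_dense by blast
    then have "z \<in> Q (to_nat q)" by (simp add: Q_def z)
    then show "z \<in> (\<Union>n. Q n)" by blast
  qed
  then have UN: "(\<Union>n. B n) = A" unfolding B_def using UN_disjointed_eq[of Q] by blast
  have disj: "disjoint_family B"
    using disjoint_family_disjointed[of Q] unfolding B_def disjoint_family_on_def by blast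
  have sums: "(\<lambda>n. measure N (B n)) sums measure N A" if "finite_measure N" "sets N = sets borel" for N
    using finite_measure.finite_measure_UNION[OF that(1), of B] B(1) disj that(2) UN by auto
  have "(\<lambda>n. a * measure \<mu> (B n) - b * measure \<mu>' (B n)) sums (a * measure \<mu> A - b * measure \<mu>' A)"
    by (intro sums_diff sums_mult sums fin sets)
  moreover have "a * measure \<mu> (B n) - b * measure \<mu>' (B n) = measure \<nu> (B n)" for n
    using measure_eq_quadrant[where q = "of_rat (from_nat n)", OF fin sets eq B(1)[of n]] B(2)[of n]
    by (simp add: Q_def)
  ultimately show ?thesis using sums[OF fin(3) sets(3)] by (metis (no_types, lifting) sums_cong sums_unique2)
qed

section \<open>The density on the triangle\<close>

context
  fixes \<rho> :: real
  assumes \<rho>: "0 < \<rho>"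
begin

definition tri_density :: "real \<times> real \<Rightarrow> real" where
  "tri_density z = (if -\<rho> \<le> fst z \<and> fst z < snd z \<and> snd z \<le> \<rho> then (snd z - fst z) / (4 * \<rho>\<^sup>2) else 0)"

text \<open>Turns the claimed density into a finite measure on the whole plane, so that it can be
  compared on quadrants.\<close>

definition tri_measure :: "(real \<times> real) measure" where
  "tri_measure = density lborel (\<lambda>z. ennreal (tri_density z))"

lemma measurable_tri_density [measurable]: "tri_density \<in> borel_measurable borel"
proof -
  have "tri_density \<in> borel_measurable (borel \<Otimes>\<^sub>M borel)" unfolding tri_density_def by measurable
  then show ?thesis by (simp add: borel_prod)
qed

lemma tri_density_nonneg: "0 \<le> tri_density z"
  by (simp add: tri_density_def)

lemma emeasure_tri_measure:
  assumes "A \<in> sets borel"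
  shows "emeasure tri_measure A = (\<integral>\<^sup>+z. ennreal (tri_density z) * indicator A z \<partial>lborel)"
  unfolding tri_measure_def using assms by (intro emeasure_density) simp_all

lemma finite_tri_measure: "finite_measure tri_measure"
proof (rule finite_measureI)
  let ?C = "{-\<rho>..\<rho>} \<times> {-\<rho>..\<rho>}"
  have "emeasure tri_measure (space tri_measure) = (\<integral>\<^sup>+z. ennreal (tri_density z) \<partial>lborel)"
    by (subst emeasure_tri_measure) (simp_all add: tri_measure_def)
  also have "\<dots> \<le> (\<integral>\<^sup>+z. ennreal (2 * \<rho> / (4 * \<rho>\<^sup>2)) * indicator ?C z \<partial>lborel)"
  proof (rule nn_integral_mono)
    fix z
    have "tri_density z \<le> 2 * \<rho> / (4 * \<rho>\<^sup>2)"
    proof (cases "-\<rho> \<le> fst z \<and> fst z < snd z \<and> snd z \<le> \<rho>")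
      case True
      then have "(snd z - fst z) / (4 * \<rho>\<^sup>2) \<le> 2 * \<rho> / (4 * \<rho>\<^sup>2)" by (intro divide_right_mono) auto
      then show ?thesis unfolding tri_density_def using True by (simp only: if_True simp_thms)
    next
      case False
      then show ?thesis using \<rho> unfolding tri_density_def by (simp only: if_False) simp
    qed
    moreover have "tri_density z = 0" if "z \<notin> ?C" using that by (cases z) (auto simp: tri_density_def)
    ultimately show "ennreal (tri_density z) \<le> ennreal (2 * \<rho> / (4 * \<rho>\<^sup>2)) * indicator ?C z"
      by (auto simp: indicator_def intro!: ennreal_leI)
  qed
  also have "\<dots> = ennreal (2 * \<rho> / (4 * \<rho>\<^sup>2)) * emeasure lborel ?C"
  proof (rule nn_integral_cmult_indicator)
    have "closed ?C" by (intro closed_Times) auto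
    then show "?C \<in> sets lborel" by simp
  qed
  also have "\<dots> < \<infinity>"
  proof -
    have "bounded ?C" by (intro bounded_Times) auto
    then have "emeasure lborel ?C < \<infinity>" by (rule emeasure_bounded_finite)
    then show ?thesis by (simp add: ennreal_mult_less_top)
  qed
  finally show "emeasure tri_measure (space tri_measure) \<noteq> \<infinity>" by simp
qed

lemma measure_tri_measure_eq_integral:
  assumes A: "A \<in> sets borel" "A \<subseteq> {(x, y). -\<rho> \<le> x \<and> x < y \<and> y \<le> \<rho>}"
  shows "measure tri_measure A = (LINT (x, y):A|lborel. (y - x) / (4 * \<rho>\<^sup>2))"
proof -
  have [measurable]: "A \<in> sets borel" by fact
  have "(LINT (x, y):A|lborel. (y - x) / (4 * \<rho>\<^sup>2)) = (\<integral>z. tri_density z * indicator A z \<partial>lborel)"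
    unfolding set_lebesgue_integral_def
    by (intro Bochner_Integration.integral_cong refl)
      (use A(2) in \<open>auto simp: tri_density_def indicator_def\<close>)
  also have "\<dots> = enn2real (\<integral>\<^sup>+z. ennreal (tri_density z * indicator A z) \<partial>lborel)"
    by (rule integral_eq_nn_integral) (auto simp: tri_density_nonneg)
  also have "(\<integral>\<^sup>+z. ennreal (tri_density z * indicator A z) \<partial>lborel) = emeasure tri_measure A"
    unfolding emeasure_tri_measure[OF A(1)]
    by (intro nn_integral_cong) (simp add: indicator_def)
  finally show ?thesis by (simp add: measure_def)
qed

text \<open>Integration over the second coordinate from \<open>y\<close> to \<rho> gives the length
  \<open>\<rho> - y\<close> times the value of the density at the midpoint
  \<open>(\<rho> + y) / 2\<close>, which is again linear in the first coordinate.\<close>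

lemma measure_tri_measure_quadrant:
  assumes xy: "-\<rho> \<le> x" "x \<le> y" "y \<le> \<rho>"
  shows "measure tri_measure ({..x} \<times> {y<..}) = (\<rho> + x) * (\<rho> - y) * (2 * \<rho> + y - x) / (8 * \<rho>\<^sup>2)"
proof -
  let ?k = "4 * \<rho>\<^sup>2"
  have R: "{..x} \<times> {y<..} \<in> sets (borel :: (real \<times> real) measure)"
    unfolding sets_borel_quadrants by (intro sigma_sets.Basic) blast
  have inner: "(\<integral>\<^sup>+v. ennreal (tri_density (u, v)) * indicator ({..x} \<times> {y<..}) (u, v) \<partial>lborel)
      = ennreal ((\<rho> - y) * ((\<rho> + y) / 2 - u) / ?k) * indicator {-\<rho>..x} u" for u
  proof (cases "u \<in> {-\<rho>..x}")
    case True
    have "(\<integral>\<^sup>+v. ennreal (tri_density (u, v)) * indicator ({..x} \<times> {y<..}) (u, v) \<partial>lborel)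
        = (\<integral>\<^sup>+v. ennreal ((v - u) / ?k) * indicator {y..\<rho>} v \<partial>lborel)"
    proof (rule nn_integral_cong_AE)
      show "AE v in lborel. ennreal (tri_density (u, v)) * indicator ({..x} \<times> {y<..}) (u, v)
          = ennreal ((v - u) / ?k) * indicator {y..\<rho>} v"
        \<comment> \<open>The quadrant is open at \<open>y\<close>, the interval of integration
          closed.\<close>
        using AE_lborel_singleton[of y]
        by eventually_elim (use True xy in \<open>auto simp: tri_density_def indicator_def\<close>)
    qed
    also have "\<dots> = ennreal ((\<rho>\<^sup>2 / 2 - u * \<rho>) / ?k - (y\<^sup>2 / 2 - u * y) / ?k)"
    proof (rule nn_integral_FTC_Icc[where F = "\<lambda>v. (v\<^sup>2 / 2 - u * v) / ?k"])
      fix v assume "v \<in> {y..\<rho>}"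
      show "((\<lambda>v. (v\<^sup>2 / 2 - u * v) / ?k) has_real_derivative (v - u) / ?k) (at v)"
        by (rule DERIV_cdivide) (auto intro!: derivative_eq_intros)
      show "0 \<le> (v - u) / ?k" using \<open>v \<in> {y..\<rho>}\<close> True xy by simp
    qed (use xy in auto)
    also have "(\<rho>\<^sup>2 / 2 - u * \<rho>) / ?k - (y\<^sup>2 / 2 - u * y) / ?k = (\<rho> - y) * ((\<rho> + y) / 2 - u) / ?k"
      unfolding diff_divide_distrib[symmetric]
      by (rule arg_cong[where f = "\<lambda>t. t / ?k"]) (simp add: field_simps power2_eq_square)
    finally show ?thesis using True by simp
  next
    case False
    have 0: "ennreal (tri_density (u, v)) * indicator ({..x} \<times> {y<..}) (u, v) = 0" for v
    proof -
      have "tri_density (u, v) = 0 \<or> (u, v) \<notin> {..x} \<times> {y<..}" using False by (auto simp: tri_density_def)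
      then show ?thesis by (elim disjE) simp_all
    qed
    show ?thesis unfolding 0 using False by simp
  qed
  have "emeasure tri_measure ({..x} \<times> {y<..})
      = (\<integral>\<^sup>+z. ennreal (tri_density z) * indicator ({..x} \<times> {y<..}) z \<partial>(lborel \<Otimes>\<^sub>M lborel))"
    unfolding emeasure_tri_measure[OF R] lborel_prod ..
  also have "\<dots> = (\<integral>\<^sup>+u. \<integral>\<^sup>+v. ennreal (tri_density (u, v)) * indicator ({..x} \<times> {y<..}) (u, v) \<partial>lborel \<partial>lborel)"
    by (rule lborel.nn_integral_fst[symmetric]) (use R in \<open>simp add: lborel_prod\<close>)
  also have "\<dots> = (\<integral>\<^sup>+u. ennreal ((\<rho> - y) * ((\<rho> + y) / 2 - u) / ?k) * indicator {-\<rho>..x} u \<partial>lborel)"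
    by (simp only: inner)
  also have "\<dots> = ennreal ((\<rho> - y) * ((\<rho> + y) / 2 * x - x\<^sup>2 / 2) / ?k - (\<rho> - y) * ((\<rho> + y) / 2 * (-\<rho>) - (-\<rho>)\<^sup>2 / 2) / ?k)"
  proof (rule nn_integral_FTC_Icc[where F = "\<lambda>u. (\<rho> - y) * ((\<rho> + y) / 2 * u - u\<^sup>2 / 2) / ?k"])
    fix u assume u: "u \<in> {-\<rho>..x}"
    show "((\<lambda>u. (\<rho> - y) * ((\<rho> + y) / 2 * u - u\<^sup>2 / 2) / ?k) has_real_derivative (\<rho> - y) * ((\<rho> + y) / 2 - u) / ?k) (at u)"
      by (rule DERIV_cdivide) (auto intro!: derivative_eq_intros)
    show "0 \<le> (\<rho> - y) * ((\<rho> + y) / 2 - u) / ?k"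
      using u xy by (intro divide_nonneg_nonneg mult_nonneg_nonneg) auto
  qed (use xy in auto)
  also have "(\<rho> - y) * ((\<rho> + y) / 2 * x - x\<^sup>2 / 2) / ?k - (\<rho> - y) * ((\<rho> + y) / 2 * (-\<rho>) - (-\<rho>)\<^sup>2 / 2) / ?k
      = (\<rho> + x) * (\<rho> - y) * (2 * \<rho> + y - x) / (8 * \<rho>\<^sup>2)"
    using \<rho> by (simp add: divide_simps) (simp add: algebra_simps power2_eq_square)
  finally have "emeasure tri_measure ({..x} \<times> {y<..}) = ennreal ((\<rho> + x) * (\<rho> - y) * (2 * \<rho> + y - x) / (8 * \<rho>\<^sup>2))" .
  moreover have "0 \<le> (\<rho> + x) * (\<rho> - y) * (2 * \<rho> + y - x) / (8 * \<rho>\<^sup>2)"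
    using xy \<rho> by (intro divide_nonneg_nonneg mult_nonneg_nonneg) auto
  ultimately show ?thesis by (simp add: measure_def)
qed

lemma measure_tri_measure_quadrant_0:
  assumes "x < -\<rho> \<or> \<rho> < y"
  shows "measure tri_measure ({..x} \<times> {y<..}) = 0"
proof -
  have R: "{..x} \<times> {y<..} \<in> sets (borel :: (real \<times> real) measure)"
    unfolding sets_borel_quadrants by (intro sigma_sets.Basic) blast
  have 0: "ennreal (tri_density z) * indicator ({..x} \<times> {y<..}) z = 0" for z
  proof -
    have "tri_density z = 0 \<or> z \<notin> {..x} \<times> {y<..}"
      using assms by (cases z) (auto simp: tri_density_def)
    then show ?thesis by (elim disjE) simp_all
  qed
  show ?thesis unfolding measure_def emeasure_tri_measure[OF R] 0 by simp
qed

end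

section \<open>The joint law above the diagonal\<close>

context asep_speeds
begin

lemma measure_quadrant:
  "measure (distr M borel (\<lambda>\<omega>. (U i \<omega>, U j \<omega>))) ({..x} \<times> {y<..}) = expectation (\<lambda>\<omega>. occ x i \<omega> * (1 - occ y j \<omega>))"
proof -
  have m: "(\<lambda>\<omega>. (U i \<omega>, U j \<omega>)) \<in> borel_measurable M" by measurable
  have R: "{..x} \<times> {y<..} \<in> sets (borel :: (real \<times> real) measure)"
    unfolding sets_borel_quadrants by (intro sigma_sets.Basic) blast
  have "measure (distr M borel (\<lambda>\<omega>. (U i \<omega>, U j \<omega>))) ({..x} \<times> {y<..})
      = (\<integral>z. indicat_real ({..x} \<times> {y<..}) z \<partial>distr M borel (\<lambda>\<omega>. (U i \<omega>, U j \<omega>)))"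
    using R by simp
  also have "\<dots> = expectation (\<lambda>\<omega>. indicat_real ({..x} \<times> {y<..}) (U i \<omega>, U j \<omega>))"
    using R by (intro integral_distr[OF m]) simp
  also have "\<dots> = expectation (\<lambda>\<omega>. occ x i \<omega> * (1 - occ y j \<omega>))"
    by (intro Bochner_Integration.integral_cong refl) (auto simp: occ_def indicator_def)
  finally show ?thesis .
qed

lemma occ_outside:
  assumes "x < -\<rho> \<or> \<rho> < y"
  shows "expectation (\<lambda>\<omega>. occ x i \<omega> * (1 - occ y j \<omega>)) = 0"
proof -
  have "expectation (\<lambda>\<omega>. occ x i \<omega> * (1 - occ y j \<omega>)) = expectation (\<lambda>\<omega>. 0)"
  proof (rule integral_cong_AE)
    show "AE \<omega> in M. occ x i \<omega> * (1 - occ y j \<omega>) = 0"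
      using AE_U_bounds[of i] AE_U_bounds[of j]
      by eventually_elim (use assms in \<open>auto simp: occ_def\<close>)
  qed simp_all
  then show ?thesis by simp
qed

lemma reflection_speed_law2:
  "reflection (speed_law2 M Y) = distr M borel (\<lambda>\<omega>. (U 1 \<omega>, U 0 \<omega>))"
proof -
  have swap: "(\<lambda>(x, y). (y, x)) \<in> measurable (borel :: (real \<times> real) measure) (borel :: (real \<times> real) measure)"
    unfolding borel_prod[symmetric] by measurable
  have m: "(\<lambda>\<omega>. (U 0 \<omega>, U 1 \<omega>)) \<in> borel_measurable M" by measurable
  show ?thesis
    unfolding reflection_def speed_law2_eq distr_distr[OF swap m] by (simp add: comp_def)
qed

text \<open>The reflection is the law of \<open>(U 1, U 0)\<close>, so on a quadrant the left-hand
  side is exactly \<open>pair_current x y\<close>, whose value is the integral of the density over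
  the same quadrant.\<close>

lemma speed_law2_above_diagonal:
  assumes A: "A \<in> sets borel" "A \<subseteq> {(x, y). -\<rho> \<le> x \<and> x < y \<and> y \<le> \<rho>}"
  shows "p * measure (speed_law2 M Y) A - (1 - p) * measure (reflection (speed_law2 M Y)) A
    = (LINT (x, y):A|lborel. (y - x) / (4 * \<rho>\<^sup>2))"
proof -
  let ?\<mu> = "\<lambda>i j. distr M borel (\<lambda>\<omega>. (U i \<omega>, U j \<omega>))"
  have fin: "finite_measure (?\<mu> i j)" for i j
  proof -
    have "prob_space (?\<mu> i j)" by (rule prob_space_distr) measurable
    then show ?thesis by (rule prob_space.finite_measure)
  qed
  have "p * measure (?\<mu> 0 1) A - (1 - p) * measure (?\<mu> 1 0) A = measure (tri_measure \<rho>) A"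
  proof (rule measure_eq_above_diagonal[OF fin fin finite_tri_measure[OF rho(1)]])
    fix x y :: real assume xy: "x \<le> y"
    show "p * measure (?\<mu> 0 1) ({..x} \<times> {y<..}) - (1 - p) * measure (?\<mu> 1 0) ({..x} \<times> {y<..})
        = measure (tri_measure \<rho>) ({..x} \<times> {y<..})"
    \<comment> \<open>Otherwise \<open>x < -\<rho>\<close> or \<open>\<rho> < y\<close>, and the
      quadrant misses the triangle and, almost surely, both pairs of speeds.\<close>
    proof (cases "-\<rho> \<le> x \<and> y \<le> \<rho>")
      case True
      then show ?thesis
        using measure_tri_measure_quadrant[OF rho(1), of x y] pair_current_eq[of x y] xy
        by (simp add: measure_quadrant pair_current_def)
    next
      case False
      then show ?thesis
        using measure_tri_measure_quadrant_0[OF rho(1), of x y] occ_outside[of x y]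
        by (simp add: measure_quadrant not_le)
    qed
  qed (use A in \<open>auto simp: tri_measure_def[OF rho(1)]\<close>)
  also have "\<dots> = (LINT (x, y):A|lborel. (y - x) / (4 * \<rho>\<^sup>2))"
    by (rule measure_tri_measure_eq_integral[OF rho(1) A])
  finally show ?thesis unfolding reflection_speed_law2 unfolding speed_law2_eq .
qed

end

theorem theorem1p13:
  fixes M :: "'w measure" and p pbar \<rho> :: real
    and gap :: "int \<Rightarrow> nat \<Rightarrow> 'w \<Rightarrow> real" and coin :: "int \<Rightarrow> nat \<Rightarrow> 'w \<Rightarrow> bool"
    and Y :: "real \<Rightarrow> 'w \<Rightarrow> int \<Rightarrow> real"
    and A :: "(real \<times> real) set"
  assumes p: "1 / 2 < p" "p \<le> 1" and pbar: "pbar = 1 - p" and rho: "\<rho> = 2 * p - 1"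
    and asep: "multi_type_asep M p gap coin (\<lambda>n. real_of_int n) Y"
    and speed_exists:
      "AE \<omega> in M. \<exists>u. ((\<lambda>t. real_of_int (asep_position Y 0 t \<omega>) / t) \<longlongrightarrow> u) at_top"
    and speed_uniform: "speed_law M Y 0 = uniform_measure lborel {-\<rho>..\<rho>}"
    and A: "A \<in> sets borel" "A \<subseteq> {(x, y). -\<rho> \<le> x \<and> x < y \<and> y \<le> \<rho>}"
  shows "p * measure (speed_law2 M Y) A - pbar * measure (reflection (speed_law2 M Y)) A
           = (LINT (x, y):A|lborel. (y - x) / (4 * \<rho>\<^sup>2))"
proof -
  interpret multi_type_asep M p gap coin real_of_int Y by (rule asep)
  interpret asep_speeds M p gap coin Y \<rho>
    by unfold_locales (use p rho speed_exists speed_uniform in simp_all)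
  show ?thesis unfolding pbar by (rule speed_law2_above_diagonal[OF A])
qed

end
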